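(* Let $k$ be a field of characteristic zero. Let $F \colon \overline{k\mathsf{S}} \to \mathsf{A}^{\boxtimes\infty}$ be the map of 2-rigs (unique up to isomorphism) that sends the generating object $x \in \overline{k\mathsf{S}}$ to the coproduct $s_1 \oplus s_2 \oplus \cdots \in \mathsf{A}^{\boxtimes\infty}$. Then $F$ is an extension; that is, $F$ is faithful, conservative (if $F(f)$ is an isomorphism then $f$ is an isomorphism), and essentially injective (if $F(c)\cong F(c')$ then $c \cong c'$).
   Context: A 2-rig is a symmetric monoidal $k$-linear category (tensor product $k$-bilinear on morphisms) that is Cauchy complete: it has finite biproducts, including a zero object, and all idempotents split. A map of 2-rigs is a $k$-linear (strong) symmetric monoidal functor; isomorphisms between such maps are invertible symmetric monoidal $k$-linear natural transformations. $\overline{k\mathsf{S}}$: Let $\mathsf{S}$ be the groupoid of finite sets and bijections, symmetric monoidal under disjoint union. $\overline{k\mathsf{S}}$ is the category of functors $\mathsf{S}\to \mathsf{FinVect}$ (finite-dimensional $k$-vector spaces) that vanish on all sets of sufficiently large cardinality, with the Day convolution tensor product. Equivalently it is the coproduct of Cauchy complete $k$-linear categories $\bigoplus_n \mathsf{Rep}(S_n)$ of finite-dimensional representations of the symmetric groups. It is the free 2-rig on one object, the generator $x$ being the functor that is $k$ on one-element sets and $0$ on other sets: for every 2-rig $\mathsf{R}$ and object $r$ there is a 2-rig map $\overline{k\mathsf{S}}\to\mathsf{R}$ sending $x$ to $r$, unique up to isomorphism. $\mathsf{A}^{\boxtimes\infty}$: For $N\in\mathbb{N}$ let $\mathsf{A}^{\boxtimes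 N}$ be the 2-rig of $\mathbb{N}^N$-graded vector spaces of finite total dimension, with the usual graded tensor product and unsigned symmetry. It is graded: its $m$th grade consists of the objects supported on $N$-tuples with sum $m$. Let $\phi_N\colon \mathsf{A}^{\boxtimes (N+1)}\to\mathsf{A}^{\boxtimes N}$ be the graded 2-rig map $\phi_N(V)_{(m_1,\dots,m_N)} = V_{(m_1,\dots,m_N,0)}$. $\mathsf{A}^{\boxtimes\infty}$ is the strict limit, taken in graded 2-rigs, of the diagram $\cdots \to \mathsf{A}^{\boxtimes (N+1)} \xrightarrow{\phi_N} \mathsf{A}^{\boxtimes N}\to\cdots\to \mathsf{A}^{\boxtimes 0}$. Explicitly, let $\mathbb{N}^{(\infty)}(m)$ be the set of sequences $(m_1,m_2,\dots)$ of natural numbers with sum $m$. The $m$th grade of $\mathsf{A}^{\boxtimes\infty}$ is the category $[\mathbb{N}^{(\infty)}(m),\mathsf{FinVect}]$ of families of finite-dimensional vector spaces indexed by the set $\mathbb{N}^{(\infty)}(m)$, and $\mathsf{A}^{\boxtimes\infty}$ is the coproduct, as Cauchy complete $k$-linear categories, of these grades over $m\in\mathbb{N}$ (so each object has only finitely many nonzero homogeneous components, and maps preserve grades). The tensor product is $(V\otimes W)_a=\bigoplus_{b+c=a}V_b\otimes W_c$ (a finite sum), with the unsigned symmetry. The object $s_i$ is the family in grade $1$ that is $k$ at the sequence with $1$ in place $i$ and $0$ elsewhere, and zero at all other sequences. The coproduct $s_1\oplus s_2\oplus\cdots$ is the constant family with value $k$ on $\mathbb{N}^{(\infty)}(1)$,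 an object of grade $1$. *)

theory Defs
  imports
    Complex_Main
    "HOL-Library.Function_Algebras"
    "HOL-Library.FuncSet"
    "HOL-Library.FSet"
    "HOL-Library.Poly_Mapping"
begin

section \<open>2-rigs and their maps\<close>

text \<open>
  The data of a symmetric monoidal \<open>k\<close>-linear category with objects in \<open>'o\<close> and arrows in \<open>'a\<close>.
  \<open>cmp C g f\<close> is \<open>g\<close> after \<open>f\<close>, and \<open>assoc C a b c\<close> goes from \<open>(a \<otimes> b) \<otimes> c\<close> to \<open>a \<otimes> (b \<otimes> c)\<close>.
\<close>

record ('k, 'o, 'a) smlc =
  obj :: "'o set"
  hom :: "'o \<Rightarrow> 'o \<Rightarrow> 'a set"
  ide :: "'o \<Rightarrow> 'a"
  cmp :: "'a \<Rightarrow> 'a \<Rightarrow> 'a"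
  zer :: "'o \<Rightarrow> 'o \<Rightarrow> 'a"
  add :: "'a \<Rightarrow> 'a \<Rightarrow> 'a"
  scl :: "'k \<Rightarrow> 'a \<Rightarrow> 'a"
  unit :: "'o"
  ten :: "'o \<Rightarrow> 'o \<Rightarrow> 'o"
  tena :: "'a \<Rightarrow> 'a \<Rightarrow> 'a"
  assoc :: "'o \<Rightarrow> 'o \<Rightarrow> 'o \<Rightarrow> 'a"
  lunit :: "'o \<Rightarrow> 'a"
  runit :: "'o \<Rightarrow> 'a"
  braid :: "'o \<Rightarrow> 'o \<Rightarrow> 'a"

definition iso_arrow :: "('k, 'o, 'a) smlc \<Rightarrow> 'o \<Rightarrow> 'o \<Rightarrow> 'a \<Rightarrow> bool" where
  "iso_arrow C a b f \<longleftrightarrow> f \<in> hom C a b \<and>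
     (\<exists>g \<in> hom C b a. cmp C g f = ide C a \<and> cmp C f g = ide C b)"

definition isomorphic :: "('k, 'o, 'a) smlc \<Rightarrow> 'o \<Rightarrow> 'o \<Rightarrow> bool" where
  "isomorphic C a b \<longleftrightarrow> (\<exists>f. iso_arrow C a b f)"

definition is_category :: "('k, 'o, 'a) smlc \<Rightarrow> bool" where
  "is_category C \<longleftrightarrow>
     (\<forall>a \<in> obj C. ide C a \<in> hom C a a) \<and>
     (\<forall>a \<in> obj C. \<forall>b \<in> obj C. \<forall>f \<in> hom C a b. cmp C f (ide C a) = f \<and> cmp C (ide C b) f = f) \<and>
     (\<forall>a \<in> obj C. \<forall>b \<in> obj C. \<forall>c \<in> obj C. \<forall>f \<in> hom C a b. \<forall>g \<in> hom C b c.
        cmp C g f \<in> hom C a c) \<and>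
     (\<forall>a \<in> obj C. \<forall>b \<in> obj C. \<forall>c \<in> obj C. \<forall>d \<in> obj C.
        \<forall>f \<in> hom C a b. \<forall>g \<in> hom C b c. \<forall>h \<in> hom C c d.
        cmp C h (cmp C g f) = cmp C (cmp C h g) f)"

definition is_linear_category :: "('k::field, 'o, 'a) smlc \<Rightarrow> bool" where
  "is_linear_category C \<longleftrightarrow> is_category C \<and>
     (\<forall>a \<in> obj C. \<forall>b \<in> obj C.
        zer C a b \<in> hom C a b \<and>
        (\<forall>f \<in> hom C a b. \<forall>g \<in> hom C a b. add C f g \<in> hom C a b \<and> add C f g = add C g f) \<and>
        (\<forall>f \<in> hom C a b. \<forall>g \<in> hom C a b. \<forall>h \<in> hom C a b.
           add C (add C f g) h = add C f (add C g h)) \<and>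
        (\<forall>f \<in> hom C a b. add C (zer C a b) f = f \<and> scl C 1 f = f \<and> scl C 0 f = zer C a b) \<and>
        (\<forall>r. \<forall>f \<in> hom C a b. scl C r f \<in> hom C a b) \<and>
        (\<forall>r s. \<forall>f \<in> hom C a b. scl C (r + s) f = add C (scl C r f) (scl C s f) \<and>
           scl C (r * s) f = scl C r (scl C s f)) \<and>
        (\<forall>r. \<forall>f \<in> hom C a b. \<forall>g \<in> hom C a b.
           scl C r (add C f g) = add C (scl C r f) (scl C r g))) \<and>
     (\<forall>a \<in> obj C. \<forall>b \<in> obj C. \<forall>c \<in> obj C.
        (\<forall>f \<in> hom C a b. \<forall>g \<in> hom C a b. \<forall>h \<in> hom C b c.
           cmp C h (add C f g) = add C (cmp C h f) (cmp C h g)) \<and>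
        (\<forall>f \<in> hom C a b. \<forall>g \<in> hom C b c. \<forall>h \<in> hom C b c.
           cmp C (add C g h) f = add C (cmp C g f) (cmp C h f)) \<and>
        (\<forall>r. \<forall>f \<in> hom C a b. \<forall>g \<in> hom C b c.
           cmp C g (scl C r f) = scl C r (cmp C g f) \<and>
           cmp C (scl C r g) f = scl C r (cmp C g f)))"

definition has_linear_tensor :: "('k::field, 'o, 'a) smlc \<Rightarrow> bool" where
  "has_linear_tensor C \<longleftrightarrow>
     unit C \<in> obj C \<and>
     (\<forall>a \<in> obj C. \<forall>b \<in> obj C. ten C a b \<in> obj C \<and>
        tena C (ide C a) (ide C b) = ide C (ten C a b)) \<and>
     (\<forall>a \<in> obj C. \<forall>a' \<in> obj C. \<forall>b \<in> obj C. \<forall>b' \<in> obj C.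
        \<forall>f \<in> hom C a a'. \<forall>g \<in> hom C b b'.
        tena C f g \<in> hom C (ten C a b) (ten C a' b') \<and>
        (\<forall>r. tena C (scl C r f) g = scl C r (tena C f g) \<and>
             tena C f (scl C r g) = scl C r (tena C f g)) \<and>
        (\<forall>h \<in> hom C a a'. tena C (add C f h) g = add C (tena C f g) (tena C h g)) \<and>
        (\<forall>h \<in> hom C b b'. tena C f (add C g h) = add C (tena C f g) (tena C f h)) \<and>
        (\<forall>a'' \<in> obj C. \<forall>b'' \<in> obj C. \<forall>f' \<in> hom C a' a''. \<forall>g' \<in> hom C b' b''.
           tena C (cmp C f' f) (cmp C g' g) = cmp C (tena C f' g') (tena C f g)))"

definition is_symmetric_monoidal :: "('k::field, 'o, 'a) smlc \<Rightarrow> bool" where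
  "is_symmetric_monoidal C \<longleftrightarrow> has_linear_tensor C \<and>
     (\<forall>a \<in> obj C. \<forall>b \<in> obj C. \<forall>c \<in> obj C.
        iso_arrow C (ten C (ten C a b) c) (ten C a (ten C b c)) (assoc C a b c)) \<and>
     (\<forall>a \<in> obj C. iso_arrow C (ten C (unit C) a) a (lunit C a) \<and>
        iso_arrow C (ten C a (unit C)) a (runit C a)) \<and>
     (\<forall>a \<in> obj C. \<forall>b \<in> obj C. braid C a b \<in> hom C (ten C a b) (ten C b a)) \<and>
     (\<comment> \<open>naturality\<close>
      \<forall>a \<in> obj C. \<forall>a' \<in> obj C. \<forall>b \<in> obj C. \<forall>b' \<in> obj C. \<forall>c \<in> obj C. \<forall>c' \<in> obj C.
        \<forall>f \<in> hom C a a'. \<forall>g \<in> hom C b b'. \<forall>h \<in> hom C c c'.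
        cmp C (assoc C a' b' c') (tena C (tena C f g) h) =
          cmp C (tena C f (tena C g h)) (assoc C a b c) \<and>
        cmp C (braid C a' b') (tena C f g) = cmp C (tena C g f) (braid C a b) \<and>
        cmp C (lunit C a') (tena C (ide C (unit C)) f) = cmp C f (lunit C a) \<and>
        cmp C (runit C a') (tena C f (ide C (unit C))) = cmp C f (runit C a)) \<and>
     (\<comment> \<open>pentagon\<close>
      \<forall>a \<in> obj C. \<forall>b \<in> obj C. \<forall>c \<in> obj C. \<forall>d \<in> obj C.
        cmp C (assoc C a b (ten C c d)) (assoc C (ten C a b) c d) =
        cmp C (tena C (ide C a) (assoc C b c d))
          (cmp C (assoc C a (ten C b c) d) (tena C (assoc C a b c) (ide C d)))) \<and>
     (\<comment> \<open>triangle\<close>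
      \<forall>a \<in> obj C. \<forall>b \<in> obj C.
        cmp C (tena C (ide C a) (lunit C b)) (assoc C a (unit C) b) =
        tena C (runit C a) (ide C b)) \<and>
     (\<comment> \<open>symmetry\<close>
      \<forall>a \<in> obj C. \<forall>b \<in> obj C. cmp C (braid C b a) (braid C a b) = ide C (ten C a b)) \<and>
     (\<comment> \<open>hexagon\<close>
      \<forall>a \<in> obj C. \<forall>b \<in> obj C. \<forall>c \<in> obj C.
        cmp C (assoc C b c a) (cmp C (braid C a (ten C b c)) (assoc C a b c)) =
        cmp C (tena C (ide C b) (braid C a c))
          (cmp C (assoc C b a c) (tena C (braid C a b) (ide C c))))"

definition is_Cauchy_complete :: "('k::field, 'o, 'a) smlc \<Rightarrow> bool" where
  "is_Cauchy_complete C \<longleftrightarrow>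
     (\<exists>z \<in> obj C. ide C z = zer C z z) \<and>
     (\<forall>a \<in> obj C. \<forall>b \<in> obj C. \<exists>s \<in> obj C.
        \<exists>i \<in> hom C a s. \<exists>j \<in> hom C b s. \<exists>p \<in> hom C s a. \<exists>q \<in> hom C s b.
        cmp C p i = ide C a \<and> cmp C q j = ide C b \<and>
        cmp C q i = zer C a b \<and> cmp C p j = zer C b a \<and>
        add C (cmp C i p) (cmp C j q) = ide C s) \<and>
     (\<forall>a \<in> obj C. \<forall>e \<in> hom C a a. cmp C e e = e \<longrightarrow>
        (\<exists>s \<in> obj C. \<exists>i \<in> hom C s a. \<exists>p \<in> hom C a s. cmp C p i = ide C s \<and> cmp C i p = e))"

definition two_rig :: "('k::field, 'o, 'a) smlc \<Rightarrow> bool" where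
  "two_rig C \<longleftrightarrow> is_linear_category C \<and> is_symmetric_monoidal C \<and> is_Cauchy_complete C"

text \<open>
  A functor with the comparison arrows \<open>mu a b : F a \<otimes> F b \<rightarrow> F (a \<otimes> b)\<close> and \<open>eps : I \<rightarrow> F I\<close>.
\<close>

record ('o, 'a, 'p, 'b) smfun =
  fo :: "'o \<Rightarrow> 'p"
  fa :: "'a \<Rightarrow> 'b"
  mu :: "'o \<Rightarrow> 'o \<Rightarrow> 'b"
  eps :: "'b"

definition is_linear_functor ::
  "('k, 'o, 'a) smlc \<Rightarrow> ('k, 'p, 'b) smlc \<Rightarrow> ('o, 'a, 'p, 'b) smfun \<Rightarrow> bool" where
  "is_linear_functor C D F \<longleftrightarrow>
     (\<forall>a \<in> obj C. fo F a \<in> obj D \<and> fa F (ide C a) = ide D (fo F a)) \<and>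
     (\<forall>a \<in> obj C. \<forall>b \<in> obj C. \<forall>f \<in> hom C a b.
        fa F f \<in> hom D (fo F a) (fo F b) \<and>
        (\<forall>r. fa F (scl C r f) = scl D r (fa F f)) \<and>
        (\<forall>g \<in> hom C a b. fa F (add C f g) = add D (fa F f) (fa F g)) \<and>
        (\<forall>c \<in> obj C. \<forall>g \<in> hom C b c. fa F (cmp C g f) = cmp D (fa F g) (fa F f)))"

definition two_rig_map ::
  "('k::field, 'o, 'a) smlc \<Rightarrow> ('k, 'p, 'b) smlc \<Rightarrow> ('o, 'a, 'p, 'b) smfun \<Rightarrow> bool" where
  "two_rig_map C D F \<longleftrightarrow> two_rig C \<and> two_rig D \<and> is_linear_functor C D F \<and>
     iso_arrow D (unit D) (fo F (unit C)) (eps F) \<and>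
     (\<forall>a \<in> obj C. \<forall>b \<in> obj C.
        iso_arrow D (ten D (fo F a) (fo F b)) (fo F (ten C a b)) (mu F a b)) \<and>
     (\<comment> \<open>naturality\<close>
      \<forall>a \<in> obj C. \<forall>a' \<in> obj C. \<forall>b \<in> obj C. \<forall>b' \<in> obj C. \<forall>f \<in> hom C a a'. \<forall>g \<in> hom C b b'.
        cmp D (mu F a' b') (tena D (fa F f) (fa F g)) = cmp D (fa F (tena C f g)) (mu F a b)) \<and>
     (\<comment> \<open>associativity\<close>
      \<forall>a \<in> obj C. \<forall>b \<in> obj C. \<forall>c \<in> obj C.
        cmp D (fa F (assoc C a b c))
          (cmp D (mu F (ten C a b) c) (tena D (mu F a b) (ide D (fo F c)))) =
        cmp D (mu F a (ten C b c))
          (cmp D (tena D (ide D (fo F a)) (mu F b c)) (assoc D (fo F a) (fo F b) (fo F c)))) \<and>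
     (\<comment> \<open>units\<close>
      \<forall>a \<in> obj C.
        cmp D (fa F (lunit C a))
          (cmp D (mu F (unit C) a) (tena D (eps F) (ide D (fo F a)))) = lunit D (fo F a) \<and>
        cmp D (fa F (runit C a))
          (cmp D (mu F a (unit C)) (tena D (ide D (fo F a)) (eps F))) = runit D (fo F a)) \<and>
     (\<comment> \<open>symmetry\<close>
      \<forall>a \<in> obj C. \<forall>b \<in> obj C.
        cmp D (fa F (braid C a b)) (mu F a b) = cmp D (mu F b a) (braid D (fo F a) (fo F b)))"

definition faithful ::
  "('k, 'o, 'a) smlc \<Rightarrow> ('k, 'p, 'b) smlc \<Rightarrow> ('o, 'a, 'p, 'b) smfun \<Rightarrow> bool" where
  "faithful C D F \<longleftrightarrow> (\<forall>a \<in> obj C. \<forall>b \<in> obj C. inj_on (fa F) (hom C a b))"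

definition conservative ::
  "('k, 'o, 'a) smlc \<Rightarrow> ('k, 'p, 'b) smlc \<Rightarrow> ('o, 'a, 'p, 'b) smfun \<Rightarrow> bool" where
  "conservative C D F \<longleftrightarrow> (\<forall>a \<in> obj C. \<forall>b \<in> obj C. \<forall>f \<in> hom C a b.
     iso_arrow D (fo F a) (fo F b) (fa F f) \<longrightarrow> iso_arrow C a b f)"

definition essentially_injective ::
  "('k, 'o, 'a) smlc \<Rightarrow> ('k, 'p, 'b) smlc \<Rightarrow> ('o, 'a, 'p, 'b) smfun \<Rightarrow> bool" where
  "essentially_injective C D F \<longleftrightarrow> (\<forall>a \<in> obj C. \<forall>b \<in> obj C.
     isomorphic D (fo F a) (fo F b) \<longrightarrow> isomorphic C a b)"

definition is_extension ::
  "('k, 'o, 'a) smlc \<Rightarrow> ('k, 'p, 'b) smlc \<Rightarrow> ('o, 'a, 'p, 'b) smfun \<Rightarrow> bool" where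
  "is_extension C D F \<longleftrightarrow> faithful C D F \<and> conservative C D F \<and> essentially_injective C D F"


section \<open>Finite-dimensional vector spaces\<close>

text \<open>
  A finite-dimensional space is a finite-dimensional linear subspace of \<open>'i \<Rightarrow> 'k\<close>; the type \<open>'i\<close>
  used below is infinite, so every finite-dimensional \<open>k\<close>-vector space is isomorphic to one of these.
\<close>

definition fscale :: "'k::field \<Rightarrow> ('i \<Rightarrow> 'k) \<Rightarrow> 'i \<Rightarrow> 'k" where
  "fscale c v = (\<lambda>i. c * v i)"

global_interpretation fs: vector_space "fscale :: 'k::field \<Rightarrow> ('i \<Rightarrow> 'k) \<Rightarrow> 'i \<Rightarrow> 'k"
  by standard (simp_all add: fscale_def fun_eq_iff algebra_simps)

definition fin_space :: "('i \<Rightarrow> 'k::field) set \<Rightarrow> bool" where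
  "fin_space V \<longleftrightarrow> (\<exists>B. finite B \<and> V = fs.span B)"

text \<open>
  Arrows are total functions on the ambient space, made unique by the value \<open>0\<close> off the domain.
  Since linear maps preserve \<open>0\<close>, plain composition respects this convention.
\<close>

definition restrict0 :: "'v set \<Rightarrow> ('v \<Rightarrow> 'w::zero) \<Rightarrow> 'v \<Rightarrow> 'w" where
  "restrict0 V f = (\<lambda>v. if v \<in> V then f v else 0)"

definition lin_maps :: "('i \<Rightarrow> 'k::field) set \<Rightarrow> ('j \<Rightarrow> 'k) set \<Rightarrow> (('i \<Rightarrow> 'k) \<Rightarrow> 'j \<Rightarrow> 'k) set" where
  "lin_maps V W = {f. f ` V \<subseteq> W \<and> (\<forall>u \<in> V. \<forall>v \<in> V. f (u + v) = f u + f v) \<and>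
     (\<forall>c. \<forall>v \<in> V. f (fscale c v) = fscale c (f v)) \<and> (\<forall>v. v \<notin> V \<longrightarrow> f v = 0)}"


section \<open>Convolution of families of spaces\<close>

text \<open>
  The tensor products of both categories have the form
  \<open>(V \<otimes> W) x = \<Oplus> {V a \<otimes> W b | a \<cdot> b = x}\<close> for a partial commutative monoid \<open>P\<close>: finite
  sets under disjoint union, and sequences under addition. For functors on \<open>S\<close> this sum is the
  coend that defines Day convolution, evaluated as a sum over the decompositions of a finite set.
\<close>

record 'd pcm =
  compatible :: "'d \<Rightarrow> 'd \<Rightarrow> bool"
  join :: "'d \<Rightarrow> 'd \<Rightarrow> 'd"
  neutral :: "'d"

definition decomp :: "'d pcm \<Rightarrow> 'd \<Rightarrow> ('d \<times> 'd) set" where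
  "decomp P x = {(a, b). compatible P a b \<and> join P a b = x}"

text \<open>
  \<open>Pt\<close> is the basis element of the space \<open>k\<close>, and \<open>Ten a i b j\<close> is the tensor of the coordinate
  \<open>i\<close> of \<open>V a\<close> with the coordinate \<open>j\<close> of \<open>W b\<close>. The labels \<open>a, b\<close> make the sum over
  decompositions direct.
\<close>

datatype 'd ix = Pt | Ten 'd "'d ix" 'd "'d ix"

type_synonym ('d, 'k) vec = "'d ix \<Rightarrow> 'k"

definition line :: "('d, 'k::field) vec set" where
  "line = fs.span {\<lambda>i. if i = Pt then 1 else 0}"

definition pure :: "'d \<Rightarrow> ('d, 'k::field) vec \<Rightarrow> 'd \<Rightarrow> ('d, 'k) vec \<Rightarrow> ('d, 'k) vec" where
  "pure a v b w = (\<lambda>l. case l of Pt \<Rightarrow> 0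
     | Ten a' i b' j \<Rightarrow> if a' = a \<and> b' = b then v i * w j else 0)"

definition conv_sp :: "'d pcm \<Rightarrow> ('d \<Rightarrow> ('d, 'k::field) vec set) \<Rightarrow> ('d \<Rightarrow> ('d, 'k) vec set) \<Rightarrow>
    'd \<Rightarrow> ('d, 'k) vec set" where
  "conv_sp P V W x =
     fs.span {pure a v b w | a b v w. (a, b) \<in> decomp P x \<and> v \<in> V a \<and> w \<in> W b}"

text \<open>
  For linear \<open>f\<close> and \<open>g\<close>, \<open>tensor_map f g\<close> is \<open>v \<otimes> w \<mapsto> f v \<otimes> g w\<close>: apply \<open>f\<close> in the first
  coordinate and then \<open>g\<close> in the second one.
\<close>

definition tensor_map ::
  "(('d, 'k::field) vec \<Rightarrow> ('d, 'k) vec) \<Rightarrow> (('d, 'k) vec \<Rightarrow> ('d, 'k) vec) \<Rightarrow>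
     ('d ix \<Rightarrow> 'd ix \<Rightarrow> 'k) \<Rightarrow> 'd ix \<Rightarrow> 'd ix \<Rightarrow> 'k" where
  "tensor_map f g t = (\<lambda>i j. g (\<lambda>j'. f (\<lambda>i'. t i' j') i) j)"

record ('o, 'd, 'k) arrow =
  src :: "'o"
  tgt :: "'o"
  comp_at :: "'d \<Rightarrow> ('d, 'k) vec \<Rightarrow> ('d, 'k) vec"

definition conv_map :: "('d \<Rightarrow> ('d, 'k::field) vec \<Rightarrow> ('d, 'k) vec) \<Rightarrow>
    ('d \<Rightarrow> ('d, 'k) vec \<Rightarrow> ('d, 'k) vec) \<Rightarrow> ('d, 'k) vec \<Rightarrow> ('d, 'k) vec" where
  "conv_map f g t = (\<lambda>l. case l of Pt \<Rightarrow> 0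
     | Ten a i b j \<Rightarrow> tensor_map (f a) (g b) (\<lambda>i' j'. t (Ten a i' b j')) i j)"

text \<open>The associator, unitors and symmetry rebracket and permute pure tensors, without signs.\<close>

definition conv_assoc :: "'d pcm \<Rightarrow> ('d, 'k::field) vec \<Rightarrow> ('d, 'k) vec" where
  "conv_assoc P t = (\<lambda>l. case l of
       Ten a i p (Ten b j c m) \<Rightarrow>
         if p = join P b c then t (Ten (join P a b) (Ten a i b j) c m) else 0
     | _ \<Rightarrow> 0)"

definition conv_lunit :: "'d pcm \<Rightarrow> 'd \<Rightarrow> ('d, 'k::field) vec \<Rightarrow> ('d, 'k) vec" where
  "conv_lunit P x t = (\<lambda>i. t (Ten (neutral P) Pt x i))"

definition conv_runit :: "'d pcm \<Rightarrow> 'd \<Rightarrow> ('d, 'k::field) vec \<Rightarrow> ('d, 'k) vec" where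
  "conv_runit P x t = (\<lambda>i. t (Ten x i (neutral P) Pt))"

definition conv_braid :: "('d, 'k::field) vec \<Rightarrow> ('d, 'k) vec" where
  "conv_braid t = (\<lambda>l. case l of Pt \<Rightarrow> 0 | Ten b j a i \<Rightarrow> t (Ten a i b j))"

text \<open>
  The 2-rig with given objects and homs, in which everything but the tensor product of objects is
  computed componentwise; \<open>U\<close> is the family of spaces underlying an object.
\<close>

definition conv_rig :: "'d pcm \<Rightarrow> ('o \<Rightarrow> 'd \<Rightarrow> ('d, 'k::field) vec set) \<Rightarrow>
    'o set \<Rightarrow> ('o \<Rightarrow> 'o \<Rightarrow> ('d \<Rightarrow> ('d, 'k) vec \<Rightarrow> ('d, 'k) vec) set) \<Rightarrow> 'o \<Rightarrow> ('o \<Rightarrow> 'o \<Rightarrow> 'o) \<Rightarrow>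
    ('k, 'o, ('o, 'd, 'k) arrow) smlc" where
  "conv_rig P U Obs Maps I T = \<lparr>
     obj = Obs,
     hom = (\<lambda>V W. {f. src f = V \<and> tgt f = W \<and> comp_at f \<in> Maps V W}),
     ide = (\<lambda>V. \<lparr>src = V, tgt = V, comp_at = (\<lambda>x. restrict0 (U V x) (\<lambda>v. v))\<rparr>),
     cmp = (\<lambda>g f. \<lparr>src = src f, tgt = tgt g, comp_at = (\<lambda>x. comp_at g x \<circ> comp_at f x)\<rparr>),
     zer = (\<lambda>V W. \<lparr>src = V, tgt = W, comp_at = (\<lambda>x v. 0)\<rparr>),
     add = (\<lambda>f g. \<lparr>src = src f, tgt = tgt f, comp_at = (\<lambda>x v. comp_at f x v + comp_at g x v)\<rparr>),
     scl = (\<lambda>c f. \<lparr>src = src f, tgt = tgt f, comp_at = (\<lambda>x v. fscale c (comp_at f x v))\<rparr>),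
     unit = I,
     ten = T,
     tena = (\<lambda>f g. \<lparr>src = T (src f) (src g), tgt = T (tgt f) (tgt g),
       comp_at = (\<lambda>x. restrict0 (U (T (src f) (src g)) x) (conv_map (comp_at f) (comp_at g)))\<rparr>),
     assoc = (\<lambda>V W Z. \<lparr>src = T (T V W) Z, tgt = T V (T W Z),
       comp_at = (\<lambda>x. restrict0 (U (T (T V W) Z) x) (conv_assoc P))\<rparr>),
     lunit = (\<lambda>V. \<lparr>src = T I V, tgt = V,
       comp_at = (\<lambda>x. restrict0 (U (T I V) x) (conv_lunit P x))\<rparr>),
     runit = (\<lambda>V. \<lparr>src = T V I, tgt = V,
       comp_at = (\<lambda>x. restrict0 (U (T V I) x) (conv_runit P x))\<rparr>),
     braid = (\<lambda>V W. \<lparr>src = T V W, tgt = T W V,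
       comp_at = (\<lambda>x. restrict0 (U (T V W) x) conv_braid)\<rparr>)\<rparr>"


section \<open>Representations of the groupoid of finite sets\<close>

text \<open>
  \<open>S\<close> is replaced by the equivalent groupoid of finite subsets of \<open>nat\<close>.
\<close>

definition bijections :: "nat fset \<Rightarrow> nat fset \<Rightarrow> (nat \<Rightarrow> nat) set" where
  "bijections X Y = {s. bij_betw s (fset X) (fset Y) \<and> s \<in> extensional (fset X)}"

record 'k species =
  sp :: "nat fset \<Rightarrow> (nat fset, 'k) vec set"
  act :: "nat fset \<Rightarrow> nat fset \<Rightarrow> (nat \<Rightarrow> nat) \<Rightarrow> (nat fset, 'k) vec \<Rightarrow> (nat fset, 'k) vec"

definition species_obj :: "'k::field species set" where
  "species_obj = {V.
     (\<forall>X. fin_space (sp V X)) \<and>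
     (\<forall>X Y. \<forall>s \<in> bijections X Y. act V X Y s \<in> lin_maps (sp V X) (sp V Y)) \<and>
     (\<forall>X. act V X X (restrict id (fset X)) = restrict0 (sp V X) (\<lambda>v. v)) \<and>
     (\<forall>X Y Z. \<forall>s \<in> bijections X Y. \<forall>t \<in> bijections Y Z.
        act V X Z (compose (fset X) t s) = act V Y Z t \<circ> act V X Y s) \<and>
     (\<exists>N. \<forall>X. N \<le> fcard X \<longrightarrow> sp V X = {0})}"

definition species_maps :: "'k::field species \<Rightarrow> 'k species \<Rightarrow>
    (nat fset \<Rightarrow> (nat fset, 'k) vec \<Rightarrow> (nat fset, 'k) vec) set" where
  "species_maps V W = {h. (\<forall>X. h X \<in> lin_maps (sp V X) (sp W X)) \<and>
     (\<forall>X Y. \<forall>s \<in> bijections X Y. h Y \<circ> act V X Y s = act W X Y s \<circ> h X)}"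

definition finset_pcm :: "nat fset pcm" where
  "finset_pcm = \<lparr>compatible = (\<lambda>A B. A |\<inter>| B = {||}), join = (|\<union>|), neutral = {||}\<rparr>"

definition const_species :: "(nat fset \<Rightarrow> bool) \<Rightarrow> 'k::field species" where
  "const_species Q = (let V = (\<lambda>X. if Q X then line else {0}) in
     \<lparr>sp = V, act = (\<lambda>X Y s. restrict0 (V X) (\<lambda>v. v))\<rparr>)"

definition species_unit :: "'k::field species" where
  "species_unit = const_species (\<lambda>X. X = {||})"

definition species_gen :: "'k::field species" where
  "species_gen = const_species (\<lambda>X. fcard X = 1)"

text \<open>
  A bijection \<open>s : X \<rightarrow> Y\<close> carries the summand of \<open>(A, B)\<close> to that of \<open>(s A, s B)\<close>, so the
  summand of \<open>(A', B')\<close> in the result comes from that of the preimages of \<open>A'\<close> and \<open>B'\<close>.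
\<close>

definition species_ten :: "'k::field species \<Rightarrow> 'k species \<Rightarrow> 'k species" where
  "species_ten V W = \<lparr>
     sp = conv_sp finset_pcm (sp V) (sp W),
     act = (\<lambda>X Y s. restrict0 (conv_sp finset_pcm (sp V) (sp W) X) (\<lambda>t l. case l of Pt \<Rightarrow> 0
       | Ten A' i B' j \<Rightarrow>
           if (A', B') \<in> decomp finset_pcm Y then
             let A = ffilter (\<lambda>x. s x |\<in>| A') X; B = ffilter (\<lambda>x. s x |\<in>| B') X
             in tensor_map (act V A A' (restrict s (fset A))) (act W B B' (restrict s (fset B)))
                  (\<lambda>i' j'. t (Ten A i' B j')) i j
           else 0))\<rparr>"

definition kS_bar :: "('k::field, 'k species, ('k species, nat fset, 'k) arrow) smlc" where
  "kS_bar = conv_rig finset_pcm sp species_obj species_maps species_unit species_ten"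


section \<open>Families graded by finitely supported sequences\<close>

text \<open>
  A sequence of natural numbers with finite sum is an element of \<open>nat \<Rightarrow>\<^sub>0 nat\<close>, with places
  numbered from \<open>0\<close>.
\<close>

definition weight :: "(nat \<Rightarrow>\<^sub>0 nat) \<Rightarrow> nat" where
  "weight a = (\<Sum>i \<in> Poly_Mapping.keys a. Poly_Mapping.lookup a i)"

type_synonym 'k family = "(nat \<Rightarrow>\<^sub>0 nat) \<Rightarrow> (nat \<Rightarrow>\<^sub>0 nat, 'k) vec set"

definition family_obj :: "'k::field family set" where
  "family_obj = {V. (\<forall>a. fin_space (V a)) \<and> (\<exists>M. \<forall>a. M \<le> weight a \<longrightarrow> V a = {0})}"

definition family_maps :: "'k::field family \<Rightarrow> 'k family \<Rightarrow>
    ((nat \<Rightarrow>\<^sub>0 nat) \<Rightarrow> (nat \<Rightarrow>\<^sub>0 nat, 'k) vec \<Rightarrow> (nat \<Rightarrow>\<^sub>0 nat, 'k) vec) set" where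
  "family_maps V W = {h. \<forall>a. h a \<in> lin_maps (V a) (W a)}"

definition seq_pcm :: "(nat \<Rightarrow>\<^sub>0 nat) pcm" where
  "seq_pcm = \<lparr>compatible = (\<lambda>a b. True), join = (+), neutral = 0\<rparr>"

definition family_unit :: "'k::field family" where
  "family_unit = (\<lambda>a. if a = 0 then line else {0})"

definition A_infinity ::
  "('k::field, 'k family, ('k family, nat \<Rightarrow>\<^sub>0 nat, 'k) arrow) smlc" where
  "A_infinity = conv_rig seq_pcm (\<lambda>V. V) family_obj family_maps family_unit (conv_sp seq_pcm)"

text \<open>The coproduct of all \<open>s\<^sub>i\<close>.\<close>

definition s_sum :: "'k::field family" where
  "s_sum = (\<lambda>a. if weight a = 1 then line else {0})"

end

theory Submission
  imports Defs "HOL-Combinatorics.Permutations" "HOL-Combinatorics.Cycles"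
begin

text \<open>
  Write \<open>x\<close> for the generator and \<open>s\<close> for the sum of all \<open>s\<^sub>i\<close>. The comparison maps of \<open>F\<close> give
  isomorphisms of the \<open>n\<close>-fold tensor power of \<open>s\<close> with the image of that of \<open>x\<close>, compatible with
  permutations of the factors. In degree \<open>a\<close> the power of \<open>s\<close> has as basis the words with content \<open>a\<close>.

  The degree-\<open>n\<close> part of the power of \<open>x\<close> is the regular representation of \<open>S\<^sub>n\<close>, so nonzero arrows of
  species remain nonzero after composing with suitable arrows from and to powers of \<open>x\<close>. On the
  words without repeated letters permutations act freely, whence \<open>F\<close> is faithful. Arrows of
  species are von Neumann regular (Maschke), so a faithful functor is conservative.

  Writing the identity of \<open>V\<close> as a sum of arrows factoring through powers of \<open>x\<close> and taking
  traces, the dimension of \<open>F V\<close> in degree \<open>a\<close> is the inner product of the character of \<open>V\<close> with the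
  function counting the words of content \<open>a\<close> fixed by a permutation. These functions span the class
  functions: a permutation fixing a word whose level sets are the orbits of \<open>\<sigma>\<close> either has
  smaller orbits than \<open>\<sigma>\<close> or is conjugate to it. So \<open>F V\<close> determines the character of \<open>V\<close>, and
  hence \<open>V\<close>, as the characteristic is zero.
\<close>

text \<open>\<open>F\<close> is known only through its comparison arrows, so no formula for
  \<open>F V\<close> is available. What can be computed is \<open>F\<close> on endomorphisms of a
  power of \<open>x\<close>. On the enumerations of an \<open>n\<close>-element set, bijections of
  the set act on the letters and permutations of the factors on the places; one action is left
  translation and the other right translation, so every endomorphism is a combination of place
  permutations, and these \<open>F\<close> must respect. Any other arrow is reached by squeezing it
  between an arrow from a power and an arrow to one. The field may fail to be algebraically closed,
  so characters are compared without irreducibles. An equivariant map of maximal rank leaves two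
  complements without nonzero maps between them, and the norm of a character is the trace of the
  averaging projection on endomorphisms. Dimensions enter only as traces of identities, that is, as
  elements of \<open>k\<close>; characteristic zero is what lets a vanishing trace force an
  idempotent to vanish.\<close>

lemma sum_fun_apply: "(\<Sum>i\<in>I. f i) x = (\<Sum>i\<in>I. f i x :: 'k::comm_monoid_add)"
  by (induction I rule: infinite_finite_induct) auto

section \<open>Traces\<close>

text \<open>Linearity is demanded on \<open>V\<close> only and the values elsewhere are arbitrary,
  so coordinates and composites qualify without being cut off.\<close>

definition functional :: "('i \<Rightarrow> 'k::field) set \<Rightarrow> (('i \<Rightarrow> 'k) \<Rightarrow> 'k) \<Rightarrow> bool" where
  "functional V \<xi> \<longleftrightarrow> (\<forall>u\<in>V. \<forall>v\<in>V. \<xi> (u + v) = \<xi> u + \<xi> v) \<and>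
     (\<forall>c. \<forall>v\<in>V. \<xi> (fscale c v) = c * \<xi> v)"

text \<open>A resolution of the identity; the vectors need not be independent.\<close>

definition frame :: "('i \<Rightarrow> 'k::field) set \<Rightarrow> 'a set \<Rightarrow> ('a \<Rightarrow> 'i \<Rightarrow> 'k) \<Rightarrow>
    ('a \<Rightarrow> ('i \<Rightarrow> 'k) \<Rightarrow> 'k) \<Rightarrow> bool" where
  "frame V I v \<xi> \<longleftrightarrow> finite I \<and> (\<forall>i\<in>I. v i \<in> V \<and> functional V (\<xi> i)) \<and>
     (\<forall>u\<in>V. u = (\<Sum>i\<in>I. fscale (\<xi> i u) (v i)))"

lemma fin_space_subspace: "fin_space V \<Longrightarrow> fs.subspace V"
  unfolding fin_space_def by auto

lemma fin_space_basis:
  assumes "fin_space V"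
  obtains B where "finite B" "fs.independent B" "fs.span B = V"
proof -
  obtain B0 where B0: "finite B0" "V = fs.span B0" using assms unfolding fin_space_def by blast
  obtain B where "B \<subseteq> B0" "fs.independent B" "B0 \<subseteq> fs.span B"
    using fs.maximal_independent_subset[of B0] by blast
  then show ?thesis
    using that B0 finite_subset fs.span_mono fs.span_span by (metis subset_antisym)
qed

lemma lin_mapsD:
  assumes "f \<in> lin_maps V W"
  shows "\<And>v. v \<in> V \<Longrightarrow> f v \<in> W" "\<And>u v. u \<in> V \<Longrightarrow> v \<in> V \<Longrightarrow> f (u + v) = f u + f v"
    "\<And>c v. v \<in> V \<Longrightarrow> f (fscale c v) = fscale c (f v)" "\<And>v. v \<notin> V \<Longrightarrow> f v = 0"
  using assms unfolding lin_maps_def by auto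

lemma lin_maps_zero [simp]: "f \<in> lin_maps V W \<Longrightarrow> f 0 = 0"
  using lin_mapsD(3)[of f V W 0 0] lin_mapsD(4)[of f V W 0]
  by (cases "0 \<in> V") (auto simp: fscale_def fun_eq_iff zero_fun_def)

lemma lin_map_sum:
  assumes "f \<in> lin_maps V W" "fs.subspace V" "\<And>i. i \<in> I \<Longrightarrow> w i \<in> V"
  shows "f (\<Sum>i\<in>I. fscale (c i) (w i)) = (\<Sum>i\<in>I. fscale (c i) (f (w i)))"
  using assms(3)
proof (induction I rule: infinite_finite_induct)
  case (insert i I)
  have "(\<Sum>i\<in>I. fscale (c i) (w i)) \<in> V"
    using insert assms(2) by (intro fs.subspace_sum) (auto intro: fs.subspace_scale)
  then have "f (fscale (c i) (w i) + (\<Sum>i\<in>I. fscale (c i) (w i))) =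
      fscale (c i) (f (w i)) + (\<Sum>i\<in>I. fscale (c i) (f (w i)))"
    using insert lin_mapsD(2,3)[OF assms(1)] assms(2) by (auto simp: fs.subspace_scale)
  then show ?case unfolding sum.insert[OF insert(1,2)] .
qed (use assms(1) in auto)

lemma functional_sum:
  assumes "functional V \<xi>" "fs.subspace V" "\<And>i. i \<in> I \<Longrightarrow> w i \<in> V"
  shows "\<xi> (\<Sum>i\<in>I. fscale (c i) (w i)) = (\<Sum>i\<in>I. c i * \<xi> (w i))"
  using assms(3)
proof (induction I rule: infinite_finite_induct)
  case (insert i I)
  have "(\<Sum>i\<in>I. fscale (c i) (w i)) \<in> V"
    using insert assms(2) by (intro fs.subspace_sum) (auto intro: fs.subspace_scale)
  then have "\<xi> (fscale (c i) (w i) + (\<Sum>i\<in>I. fscale (c i) (w i))) =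
      c i * \<xi> (w i) + (\<Sum>i\<in>I. c i * \<xi> (w i))"
    using insert assms(1,2) unfolding functional_def by (auto simp: fs.subspace_scale)
  then show ?case unfolding sum.insert[OF insert(1,2)] .
next
  case empty
  have "\<xi> (fscale 0 0) = 0 * \<xi> 0"
    using assms(1,2) fs.subspace_0 unfolding functional_def by blast
  then show ?case by (simp add: fscale_def zero_fun_def)
next
  case (infinite A)
  have "\<xi> (fscale 0 0) = 0 * \<xi> 0"
    using assms(1,2) fs.subspace_0 unfolding functional_def by blast
  then show ?case using infinite by (simp add: fscale_def zero_fun_def)
qed

lemma functional_comp:
  assumes "functional W \<xi>" "f \<in> lin_maps V W"
  shows "functional V (\<lambda>v. \<xi> (f v))"
  using assms lin_mapsD[OF assms(2)] unfolding functional_def by auto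

lemma functional_coord: "functional V (\<lambda>v. v i)"
  unfolding functional_def by (simp add: fscale_def)

lemma basis_frame:
  assumes "finite B" "fs.independent B" "fs.span B = V"
  shows "frame V B (\<lambda>b. b) (\<lambda>b u. fs.representation B u b)"
  using assms unfolding frame_def functional_def
  by (auto simp: fs.representation_add fs.representation_scale fs.sum_representation_eq
      intro: fs.span_base)

lemma frame_exists:
  fixes V :: "('i \<Rightarrow> 'k::field) set"
  assumes "fin_space V"
  obtains B :: "('i \<Rightarrow> 'k) set" and \<xi> where "frame V B (\<lambda>b. b) \<xi>"
  using fin_space_basis[OF assms] basis_frame by metis

text \<open>Computed in an arbitrarily chosen basis; \<open>tr_frame\<close> shows that every frame
  gives the same value.\<close>

definition tr :: "('i \<Rightarrow> 'k::field) set \<Rightarrow> (('i \<Rightarrow> 'k) \<Rightarrow> 'i \<Rightarrow> 'k) \<Rightarrow> 'k" where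
  "tr V f = (let B = SOME B. finite B \<and> fs.independent B \<and> fs.span B = V
     in \<Sum>b\<in>B. fs.representation B (f b) b)"

text \<open>Expanding \<open>f (v i)\<close> in the frame of \<open>W\<close> and
  \<open>g (w j)\<close> in that of \<open>V\<close> turns both sides into the same double sum.
  Independence of the frame and cyclicity of the trace are both instances.\<close>

lemma frame_trace_commute:
  assumes V: "fs.subspace V" "frame V I v \<xi>" and W: "fs.subspace W" "frame W J w \<eta>"
    and f: "\<And>i. i \<in> I \<Longrightarrow> f (v i) \<in> W" "\<And>j. j \<in> J \<Longrightarrow> functional V (\<lambda>u. \<eta> j (f u))"
    and g: "g \<in> lin_maps W V"
  shows "(\<Sum>i\<in>I. \<xi> i (g (f (v i)))) = (\<Sum>j\<in>J. \<eta> j (f (g (w j))))"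
proof -
  have v: "\<And>i. i \<in> I \<Longrightarrow> v i \<in> V" "\<And>i. i \<in> I \<Longrightarrow> functional V (\<xi> i)"
    and w: "\<And>j. j \<in> J \<Longrightarrow> w j \<in> W" "\<And>j. j \<in> J \<Longrightarrow> functional W (\<eta> j)"
    using V W unfolding frame_def by auto
  have "(\<Sum>i\<in>I. \<xi> i (g (f (v i)))) = (\<Sum>i\<in>I. \<Sum>j\<in>J. \<eta> j (f (v i)) * \<xi> i (g (w j)))"
  proof (rule sum.cong)
    fix i assume i: "i \<in> I"
    have "f (v i) = (\<Sum>j\<in>J. fscale (\<eta> j (f (v i))) (w j))"
      using W(2) f(1)[OF i] unfolding frame_def by blast
    then have "\<xi> i (g (f (v i))) = \<xi> i (g (\<Sum>j\<in>J. fscale (\<eta> j (f (v i))) (w j)))" by simp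
    also have "\<dots> = \<xi> i (\<Sum>j\<in>J. fscale (\<eta> j (f (v i))) (g (w j)))"
      by (simp add: lin_map_sum[OF g W(1)] w)
    also have "\<dots> = (\<Sum>j\<in>J. \<eta> j (f (v i)) * \<xi> i (g (w j)))"
      by (rule functional_sum[OF v(2)[OF i] V(1)]) (use lin_mapsD(1)[OF g] w in auto)
    finally show "\<xi> i (g (f (v i))) = (\<Sum>j\<in>J. \<eta> j (f (v i)) * \<xi> i (g (w j)))" .
  qed simp
  also have "\<dots> = (\<Sum>j\<in>J. \<Sum>i\<in>I. \<eta> j (f (v i)) * \<xi> i (g (w j)))"
    by (rule sum.swap)
  also have "\<dots> = (\<Sum>j\<in>J. \<eta> j (f (g (w j))))"
  proof (rule sum.cong)
    fix j assume j: "j \<in> J"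
    have gw: "g (w j) \<in> V" using lin_mapsD(1)[OF g] w j by auto
    have "g (w j) = (\<Sum>i\<in>I. fscale (\<xi> i (g (w j))) (v i))"
      using V(2) gw unfolding frame_def by blast
    then have "\<eta> j (f (g (w j))) = \<eta> j (f (\<Sum>i\<in>I. fscale (\<xi> i (g (w j))) (v i)))" by simp
    also have "\<dots> = (\<Sum>i\<in>I. \<xi> i (g (w j)) * \<eta> j (f (v i)))"
      by (rule functional_sum[OF f(2)[OF j] V(1)]) (use v in auto)
    finally show "(\<Sum>i\<in>I. \<eta> j (f (v i)) * \<xi> i (g (w j))) = \<eta> j (f (g (w j)))"
      by (simp add: mult.commute)
  qed simp
  finally show ?thesis .
qed

lemma restrict0_id_lin_maps: "fs.subspace V \<Longrightarrow> restrict0 V (\<lambda>v. v) \<in> lin_maps V V"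
  unfolding lin_maps_def restrict0_def
  by (auto simp: fs.subspace_add fs.subspace_scale)

text \<open>Compares the basis chosen in \<open>tr\<close> with the given frame by
  \<open>frame_trace_commute\<close>, the second map being the identity. That identity has to vanish
  off \<open>V\<close> in order to belong to \<open>lin_maps\<close>.\<close>

lemma tr_frame:
  assumes V: "fin_space V" and fr: "frame V I v \<xi>" and f: "f \<in> lin_maps V V"
  shows "tr V f = (\<Sum>i\<in>I. \<xi> i (f (v i)))"
proof -
  define B where "B = (SOME B. finite B \<and> fs.independent B \<and> fs.span B = V)"
  have B: "finite B \<and> fs.independent B \<and> fs.span B = V"
    unfolding B_def by (rule someI_ex) (use fin_space_basis[OF V] in metis)
  have sub: "fs.subspace V" by (rule fin_space_subspace[OF V])
  have frB: "frame V B (\<lambda>b. b) (\<lambda>b u. fs.representation B u b)"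
    by (rule basis_frame) (use B in auto)
  have id: "restrict0 V (\<lambda>v. v) \<in> lin_maps V V" by (rule restrict0_id_lin_maps[OF sub])
  have vV: "\<And>i. i \<in> I \<Longrightarrow> v i \<in> V" using fr unfolding frame_def by auto
  have BV: "\<And>b. b \<in> B \<Longrightarrow> b \<in> V" using B fs.span_base by blast
  have "(\<Sum>b\<in>B. fs.representation B (f b) b) =
      (\<Sum>b\<in>B. fs.representation B (restrict0 V (\<lambda>v. v) (f b)) b)"
    by (rule sum.cong) (use BV lin_mapsD(1)[OF f] in \<open>auto simp: restrict0_def\<close>)
  also have "\<dots> = (\<Sum>i\<in>I. \<xi> i (f (restrict0 V (\<lambda>v. v) (v i))))"
    by (rule frame_trace_commute[OF sub frB sub fr _ _ id])
      (use BV lin_mapsD(1)[OF f] fr functional_comp[OF _ f] in \<open>auto simp: frame_def\<close>)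
  also have "\<dots> = (\<Sum>i\<in>I. \<xi> i (f (v i)))"
    by (rule sum.cong) (use vV in \<open>auto simp: restrict0_def\<close>)
  finally show ?thesis unfolding tr_def Let_def B_def .
qed

lemma lin_maps_comp: "f \<in> lin_maps V W \<Longrightarrow> g \<in> lin_maps W X \<Longrightarrow> (g \<circ> f) \<in> lin_maps V X"
  using lin_maps_zero[of g W X] unfolding lin_maps_def by (auto simp: image_subset_iff)

lemma tr_commute:
  assumes V: "fin_space V" and W: "fin_space W" and f: "f \<in> lin_maps V W" and g: "g \<in> lin_maps W V"
  shows "tr V (g \<circ> f) = tr W (f \<circ> g)"
proof -
  obtain B \<xi> where B: "frame V B (\<lambda>b. b) \<xi>" using frame_exists[OF V] .
  obtain C \<eta> where C: "frame W C (\<lambda>b. b) \<eta>" using frame_exists[OF W] .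
  have "tr V (g \<circ> f) = (\<Sum>b\<in>B. \<xi> b (g (f b)))"
    using tr_frame[OF V B lin_maps_comp[OF f g]] by simp
  also have "\<dots> = (\<Sum>c\<in>C. \<eta> c (f (g c)))"
    by (rule frame_trace_commute[OF fin_space_subspace[OF V] B fin_space_subspace[OF W] C _ _ g])
      (use B C lin_mapsD(1)[OF f] functional_comp[OF _ f] in \<open>auto simp: frame_def\<close>)
  also have "\<dots> = tr W (f \<circ> g)"
    using tr_frame[OF W C lin_maps_comp[OF g f]] by simp
  finally show ?thesis .
qed

lemma tr_cong:
  assumes "fin_space V" "\<And>v. v \<in> V \<Longrightarrow> f v = g v"
  shows "tr V f = tr V g"
proof -
  define B where "B = (SOME B. finite B \<and> fs.independent B \<and> fs.span B = V)"
  have B: "finite B \<and> fs.independent B \<and> fs.span B = V"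
    unfolding B_def by (rule someI_ex) (use fin_space_basis[OF assms(1)] in metis)
  have "\<And>b. b \<in> B \<Longrightarrow> b \<in> V" using B fs.span_base by blast
  then show ?thesis
    unfolding tr_def Let_def B_def[symmetric] using assms(2) by (intro sum.cong) auto
qed

lemma lin_maps_lin_comb:
  assumes "fs.subspace V" "fs.subspace W" "\<And>i. i \<in> I \<Longrightarrow> f i \<in> lin_maps V W"
  shows "(\<lambda>v. \<Sum>i\<in>I. fscale (c i) (f i v)) \<in> lin_maps V W"
proof -
  have "(\<Sum>i\<in>I. fscale (c i) (f i v)) \<in> W" if "v \<in> V" for v
    using assms that by (intro fs.subspace_sum) (auto intro!: fs.subspace_scale dest: lin_mapsD(1))
  moreover have "(\<Sum>i\<in>I. fscale (c i) (f i (u + v))) =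
      (\<Sum>i\<in>I. fscale (c i) (f i u)) + (\<Sum>i\<in>I. fscale (c i) (f i v))" if "u \<in> V" "v \<in> V" for u v
    unfolding sum.distrib[symmetric]
    by (rule sum.cong) (use lin_mapsD(2)[OF assms(3)] that in \<open>auto simp: fs.scale_right_distrib\<close>)
  moreover have "(\<Sum>i\<in>I. fscale (c i) (f i (fscale d v))) =
      fscale d (\<Sum>i\<in>I. fscale (c i) (f i v))" if "v \<in> V" for d v
    unfolding fs.scale_sum_right
    by (rule sum.cong) (use lin_mapsD(3)[OF assms(3)] that in \<open>auto simp: mult.commute\<close>)
  moreover have "(\<Sum>i\<in>I. fscale (c i) (f i v)) = 0" if "v \<notin> V" for v
    by (rule sum.neutral) (use lin_mapsD(4)[OF assms(3)] that in auto)
  ultimately show ?thesis unfolding lin_maps_def by auto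
qed

lemma tr_lin_comb:
  assumes V: "fin_space V" and f: "\<And>i. i \<in> I \<Longrightarrow> f i \<in> lin_maps V V"
  shows "tr V (\<lambda>v. \<Sum>i\<in>I. fscale (c i) (f i v)) = (\<Sum>i\<in>I. c i * tr V (f i))"
proof -
  obtain B \<xi> where B: "frame V B (\<lambda>b. b) \<xi>" using frame_exists[OF V] .
  note sub = fin_space_subspace[OF V]
  have BV: "\<And>b. b \<in> B \<Longrightarrow> b \<in> V" "\<And>b. b \<in> B \<Longrightarrow> functional V (\<xi> b)"
    using B unfolding frame_def by auto
  have "tr V (\<lambda>v. \<Sum>i\<in>I. fscale (c i) (f i v)) = (\<Sum>b\<in>B. \<xi> b (\<Sum>i\<in>I. fscale (c i) (f i b)))"
    by (rule tr_frame[OF V B lin_maps_lin_comb[OF sub sub f]])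
  also have "\<dots> = (\<Sum>b\<in>B. \<Sum>i\<in>I. c i * \<xi> b (f i b))"
    by (rule sum.cong, simp, rule functional_sum[OF BV(2) sub])
      (use BV lin_mapsD(1)[OF f] in auto)
  also have "\<dots> = (\<Sum>i\<in>I. c i * (\<Sum>b\<in>B. \<xi> b (f i b)))"
    by (subst sum.swap) (simp add: sum_distrib_left)
  also have "\<dots> = (\<Sum>i\<in>I. c i * tr V (f i))"
    by (rule sum.cong) (auto simp: tr_frame[OF V B f])
  finally show ?thesis .
qed

text \<open>The trace of the identity is the number of basis vectors taken in \<open>k\<close>, and
  in characteristic zero this vanishes only for the empty basis.\<close>

lemma tr_id_nonzero:
  fixes V :: "('i \<Rightarrow> 'k::field_char_0) set"
  assumes V: "fin_space V" and tr: "tr V (restrict0 V (\<lambda>v. v)) = 0"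
  shows "V = {0}"
proof -
  obtain B where B: "finite B" "fs.independent B" "fs.span B = V" using fin_space_basis[OF V] .
  have BV: "\<And>b. b \<in> B \<Longrightarrow> b \<in> V" using B fs.span_base by blast
  have "tr V (restrict0 V (\<lambda>v. v)) =
      (\<Sum>b\<in>B. fs.representation B (restrict0 V (\<lambda>v. v) b) b)"
    by (rule tr_frame[OF V basis_frame[OF B] restrict0_id_lin_maps[OF fin_space_subspace[OF V]]])
  also have "\<dots> = (\<Sum>b\<in>B. 1)"
    by (rule sum.cong)
      (use BV B in \<open>auto simp: restrict0_def fs.representation_basis\<close>)
  finally have "of_nat (card B) = (0::'k)" using tr by simp
  then have "B = {}" using B(1) by simp
  then show ?thesis using B(3) by simp
qed

section \<open>Images, idempotents and dimension\<close>

lemma lin_maps_image_subspace: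
  assumes "f \<in> lin_maps V W" "fs.subspace V"
  shows "fs.subspace (f ` V)"
  unfolding fs.subspace_def
  using lin_mapsD[OF assms(1)] assms(2) lin_maps_zero[OF assms(1)]
  by (auto simp: fs.subspace_def)
    (metis image_eqI)+

lemma subspace_fin_space:
  assumes "fin_space W" "fs.subspace U" "U \<subseteq> W"
  shows "fin_space U"
proof -
  obtain C where C: "finite C" "W = fs.span C" using assms(1) unfolding fin_space_def by blast
  obtain B where B: "B \<subseteq> U" "fs.independent B" "U \<subseteq> fs.span B"
    using fs.maximal_independent_subset[of U] by blast
  have "B \<subseteq> fs.span C" using B assms(3) C by auto
  then have "finite B" using fs.independent_span_bound[OF C(1) B(2)] by simp
  moreover have "U = fs.span B"
    using B assms(2) fs.span_minimal by blast
  ultimately show ?thesis unfolding fin_space_def by blast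
qed

text \<open>An idempotent factors through its image and is the identity there, so by cyclicity its
  trace is the dimension of the image.\<close>

lemma idempotent_trace_zero:
  fixes V :: "('i \<Rightarrow> 'k::field_char_0) set"
  assumes V: "fin_space V" and e: "e \<in> lin_maps V V" "\<And>v. v \<in> V \<Longrightarrow> e (e v) = e v"
    and tr: "tr V e = 0" and v: "v \<in> V"
  shows "e v = 0"
proof -
  define W where "W = e ` V"
  have sub: "fs.subspace V" by (rule fin_space_subspace[OF V])
  have Wsub: "fs.subspace W" unfolding W_def by (rule lin_maps_image_subspace[OF e(1) sub])
  have WV: "W \<subseteq> V" unfolding W_def using lin_mapsD(1)[OF e(1)] by auto
  have W: "fin_space W" by (rule subspace_fin_space[OF V Wsub WV])
  have eW: "e \<in> lin_maps V W" using e(1) unfolding lin_maps_def W_def by auto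
  have i: "restrict0 W (\<lambda>v. v) \<in> lin_maps W V"
    using restrict0_id_lin_maps[OF Wsub] WV unfolding lin_maps_def by auto
  have "tr V e = tr V (restrict0 W (\<lambda>v. v) \<circ> e)"
    by (rule tr_cong[OF V]) (simp add: restrict0_def W_def)
  also have "\<dots> = tr W (e \<circ> restrict0 W (\<lambda>v. v))" by (rule tr_commute[OF V W eW i])
  also have "\<dots> = tr W (restrict0 W (\<lambda>v. v))"
    by (rule tr_cong[OF W]) (auto simp: restrict0_def W_def e(2))
  finally have "W = {0}" using tr_id_nonzero[OF W] tr by simp
  then show ?thesis using v unfolding W_def by auto
qed

text \<open>The coordinates are dual to the spanning vectors, so they form a frame. For a
  permutation of the coordinates the sum counts fixed points, which is how \<open>trace_pC\<close>
  uses it.\<close>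

lemma tr_coordinates:
  fixes V :: "('i \<Rightarrow> 'k::field) set"
  assumes J: "finite J" "V = fs.span ((\<lambda>j i. if i = j then 1 else 0) ` J)" and f: "f \<in> lin_maps V V"
  shows "tr V f = (\<Sum>j\<in>J. f (\<lambda>i. if i = j then 1 else 0) j)"
proof -
  let ?e = "\<lambda>j i. if i = j then 1 else (0::'k)"
  have V: "fin_space V" unfolding fin_space_def using J by blast
  have outside: "u i = 0" if "u \<in> V" "i \<notin> J" for u i
    using that(1) unfolding J(2)
    by (induction rule: fs.span_induct_alt) (use that(2) in \<open>auto simp: fscale_def split: if_splits\<close>)
  have "u = (\<Sum>j\<in>J. fscale (u j) (?e j))" if "u \<in> V" for u
    using outside[OF that] J(1)
    by (simp add: fun_eq_iff fscale_def if_distrib sum_fun_apply cong: if_cong)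
  then have "frame V J ?e (\<lambda>j u. u j)"
    unfolding frame_def using J by (auto simp: functional_coord intro: fs.span_base)
  from tr_frame[OF V this f] show ?thesis .
qed

text \<open>The bound by \<open>W\<close> matters because the ambient function space may be
  infinite-dimensional, where a strict inclusion says nothing about dimensions.\<close>

lemma dim_strict:
  assumes "fin_space W" "fs.subspace I" "fs.subspace I'" "I \<subseteq> I'" "I \<noteq> I'" "I' \<subseteq> W"
  shows "fs.dim I < fs.dim I'"
proof -
  obtain B where B: "B \<subseteq> I" "fs.independent B" "I \<subseteq> fs.span B" "card B = fs.dim I"
    using fs.basis_exists[of I] by blast
  obtain C where C: "B \<subseteq> C" "C \<subseteq> I'" "fs.independent C" "I' \<subseteq> fs.span C"
    using fs.maximal_independent_subset_extend[of B I'] B assms(4) by blast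
  obtain D where D: "finite D" "W = fs.span D" using assms(1) unfolding fin_space_def by blast
  have fC: "finite C" using fs.independent_span_bound[OF D(1) C(3)] C(2) assms(6) D(2) by auto
  have "B \<noteq> C"
  proof
    assume "B = C"
    then have "I' \<subseteq> I" using B(1) C(4) assms(2) fs.span_minimal by blast
    then show False using assms(4,5) by auto
  qed
  then have "card B < card C" using C(1) fC by (simp add: psubset_card_mono psubset_eq)
  moreover have "fs.dim I' = card C" using C by (intro fs.dim_unique) auto
  ultimately show ?thesis using B(4) by simp
qed

text \<open>Bounds the ranks of maps into \<open>W\<close>, so that a map of maximal rank
  exists.\<close>

lemma dim_bound:
  assumes "fin_space W"
  shows "\<exists>N. \<forall>I. I \<subseteq> W \<longrightarrow> fs.dim I \<le> N"
proof -
  obtain D where D: "finite D" "W = fs.span D" using assms(1) unfolding fin_space_def by blast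
  have "fs.dim I \<le> card D" if "I \<subseteq> W" for I using fs.dim_le_card[of I D] that D by auto
  then show ?thesis by blast
qed

section \<open>Representations of permutation groups\<close>

text \<open>Maps in \<open>lin_maps V V\<close> vanish off \<open>V\<close>, so
  \<open>\<rho> id\<close> is in general not the identity function; the laws are therefore imposed
  on \<open>V\<close> only.\<close>

definition is_rep :: "'s set \<Rightarrow> ('i \<Rightarrow> 'k::field) set \<Rightarrow> (('s \<Rightarrow> 's) \<Rightarrow> ('i \<Rightarrow> 'k) \<Rightarrow> 'i \<Rightarrow> 'k) \<Rightarrow> bool" where
  "is_rep S V \<rho> \<longleftrightarrow> fin_space V \<and> (\<forall>\<sigma>. \<sigma> permutes S \<longrightarrow> \<rho> \<sigma> \<in> lin_maps V V) \<and>
     (\<forall>v\<in>V. \<rho> id v = v) \<and>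
     (\<forall>\<sigma> \<tau>. \<sigma> permutes S \<longrightarrow> \<tau> permutes S \<longrightarrow> (\<forall>v\<in>V. \<rho> (\<sigma> \<circ> \<tau>) v = \<rho> \<sigma> (\<rho> \<tau> v)))"

definition equivariant where
  "equivariant S V \<rho> \<rho>' f \<longleftrightarrow> (\<forall>\<sigma>. \<sigma> permutes S \<longrightarrow> (\<forall>v\<in>V. f (\<rho> \<sigma> v) = \<rho>' \<sigma> (f v)))"

lemma is_repD:
  assumes "is_rep S V \<rho>"
  shows "fin_space V" "fs.subspace V" "\<And>\<sigma>. \<sigma> permutes S \<Longrightarrow> \<rho> \<sigma> \<in> lin_maps V V"
    "\<And>v. v \<in> V \<Longrightarrow> \<rho> id v = v"
    "\<And>\<sigma> \<tau> v. \<sigma> permutes S \<Longrightarrow> \<tau> permutes S \<Longrightarrow> v \<in> V \<Longrightarrow> \<rho> (\<sigma> \<circ> \<tau>) v = \<rho> \<sigma> (\<rho> \<tau> v)"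
    "\<And>\<sigma> v. \<sigma> permutes S \<Longrightarrow> v \<in> V \<Longrightarrow> \<rho> \<sigma> v \<in> V"
    "\<And>\<sigma> v. \<sigma> permutes S \<Longrightarrow> v \<in> V \<Longrightarrow> \<rho> \<sigma> (\<rho> (inv \<sigma>) v) = v"
    "\<And>\<sigma> v. \<sigma> permutes S \<Longrightarrow> v \<in> V \<Longrightarrow> \<rho> (inv \<sigma>) (\<rho> \<sigma> v) = v"
proof -
  note d = assms[unfolded is_rep_def]
  show 1: "fin_space V" "\<And>\<sigma>. \<sigma> permutes S \<Longrightarrow> \<rho> \<sigma> \<in> lin_maps V V"
    "\<And>v. v \<in> V \<Longrightarrow> \<rho> id v = v"
    "\<And>\<sigma> \<tau> v. \<sigma> permutes S \<Longrightarrow> \<tau> permutes S \<Longrightarrow> v \<in> V \<Longrightarrow> \<rho> (\<sigma> \<circ> \<tau>) v = \<rho> \<sigma> (\<rho> \<tau> v)"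
    using d by auto
  show "fs.subspace V" by (rule fin_space_subspace[OF 1(1)])
  show "\<And>\<sigma> v. \<sigma> permutes S \<Longrightarrow> v \<in> V \<Longrightarrow> \<rho> \<sigma> v \<in> V" using 1(2) lin_mapsD(1) by blast
  show "\<And>\<sigma> v. \<sigma> permutes S \<Longrightarrow> v \<in> V \<Longrightarrow> \<rho> \<sigma> (\<rho> (inv \<sigma>) v) = v"
    "\<And>\<sigma> v. \<sigma> permutes S \<Longrightarrow> v \<in> V \<Longrightarrow> \<rho> (inv \<sigma>) (\<rho> \<sigma> v) = v"
    using 1(3,4) permutes_inv permutes_inv_o by metis+
qed

text \<open>The Reynolds operator: the mean of the conjugates of \<open>h\<close>, a projection of
  linear maps onto equivariant ones.\<close>

definition avg where
  "avg S \<rho> \<rho>' h = (\<lambda>v. \<Sum>\<sigma> | \<sigma> permutes S. fscale (1 / of_nat (card {\<sigma>. \<sigma> permutes S})) (\<rho>' \<sigma> (h (\<rho> (inv \<sigma>) v))))"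

section \<open>Averaging over the group and orthogonality of characters\<close>

context
  fixes S :: "'s set" and V :: "('i \<Rightarrow> 'k::field_char_0) set" and W :: "('j \<Rightarrow> 'k) set" and \<rho> \<rho>'
  assumes S: "finite S" and V: "is_rep S V \<rho>" and W: "is_rep S W \<rho>'"
begin

lemma conj_lin_maps:
  assumes "h \<in> lin_maps V W" "\<sigma> permutes S"
  shows "(\<lambda>v. \<rho>' \<sigma> (h (\<rho> (inv \<sigma>) v))) \<in> lin_maps V W"
  using lin_maps_comp[OF lin_maps_comp[OF is_repD(3)[OF V permutes_inv[OF assms(2)]] assms(1)]
      is_repD(3)[OF W assms(2)]]
  by (simp add: comp_def)

lemma avg_lin_maps: "h \<in> lin_maps V W \<Longrightarrow> avg S \<rho> \<rho>' h \<in> lin_maps V W"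
  unfolding avg_def
  by (rule lin_maps_lin_comb[OF is_repD(2)[OF V] is_repD(2)[OF W]]) (simp add: conj_lin_maps)

text \<open>Reindexing the sum by left composition with \<open>\<tau>\<close> pulls
  \<open>\<rho>' \<tau>\<close> out of every term.\<close>

lemma avg_equivariant:
  assumes h: "h \<in> lin_maps V W"
  shows "equivariant S V \<rho> \<rho>' (avg S \<rho> \<rho>' h)"
  unfolding equivariant_def
proof (intro allI impI ballI)
  fix \<tau> v assume \<tau>: "\<tau> permutes S" and v: "v \<in> V"
  let ?c = "1 / of_nat (card {\<sigma>. \<sigma> permutes S}) :: 'k"
  have "avg S \<rho> \<rho>' h (\<rho> \<tau> v) =
      (\<Sum>\<sigma> | \<sigma> permutes S. fscale ?c (\<rho>' (\<tau> \<circ> \<sigma>) (h (\<rho> (inv (\<tau> \<circ> \<sigma>)) (\<rho> \<tau> v)))))"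
    unfolding avg_def by (rule setum_permutations_compose_left[OF \<tau>])
  also have "\<dots> = (\<Sum>\<sigma> | \<sigma> permutes S. fscale ?c (\<rho>' \<tau> (\<rho>' \<sigma> (h (\<rho> (inv \<sigma>) v)))))"
  proof (rule sum.cong)
    fix \<sigma> assume "\<sigma> \<in> {\<sigma>. \<sigma> permutes S}"
    then have \<sigma>: "\<sigma> permutes S" by simp
    have "inv (\<tau> \<circ> \<sigma>) = inv \<sigma> \<circ> inv \<tau>"
      using \<sigma> \<tau> by (metis o_inv_distrib permutes_bij)
    then have "\<rho> (inv (\<tau> \<circ> \<sigma>)) (\<rho> \<tau> v) = \<rho> (inv \<sigma>) v"
      using is_repD[OF V] \<sigma> \<tau> v permutes_inv by metis
    moreover have "h (\<rho> (inv \<sigma>) v) \<in> W"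
      using lin_mapsD(1)[OF h] is_repD(6)[OF V permutes_inv[OF \<sigma>] v] by blast
    ultimately show "fscale ?c (\<rho>' (\<tau> \<circ> \<sigma>) (h (\<rho> (inv (\<tau> \<circ> \<sigma>)) (\<rho> \<tau> v)))) =
        fscale ?c (\<rho>' \<tau> (\<rho>' \<sigma> (h (\<rho> (inv \<sigma>) v))))"
      using is_repD(5)[OF W \<tau> \<sigma>] by simp
  qed simp
  also have "\<dots> = \<rho>' \<tau> (avg S \<rho> \<rho>' h v)"
    unfolding avg_def
    by (rule lin_map_sum[OF is_repD(3)[OF W \<tau>] is_repD(2)[OF W], symmetric])
      (use lin_mapsD(1)[OF conj_lin_maps[OF h] v] in auto)
  finally show "avg S \<rho> \<rho>' h (\<rho> \<tau> v) = \<rho>' \<tau> (avg S \<rho> \<rho>' h v)" .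
qed

lemma card_permutes_nonzero: "of_nat (card {\<sigma>. \<sigma> permutes S}) \<noteq> (0::'k)"
  using permutes_id[of S] finite_permutations[OF S] by (metis card_0_eq empty_iff mem_Collect_eq of_nat_eq_0_iff)

lemma sum_const_average: "(\<Sum>\<sigma> | \<sigma> permutes S. fscale (1 / of_nat (card {\<sigma>. \<sigma> permutes S})) x) = (x :: 'j \<Rightarrow> 'k)"
  using card_permutes_nonzero by (simp add: fscale_def fun_eq_iff sum_fun_apply)

lemma avg_of_equivariant:
  assumes "equivariant S V \<rho> \<rho>' h" "v \<in> V"
  shows "avg S \<rho> \<rho>' h v = h v"
proof -
  have "\<rho>' \<sigma> (h (\<rho> (inv \<sigma>) v)) = h v" if \<sigma>: "\<sigma> permutes S" for \<sigma>
    using assms \<sigma> is_repD(6,7)[OF V] permutes_inv unfolding equivariant_def by metis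
  then show ?thesis unfolding avg_def using sum_const_average by simp
qed

text \<open>The average of a rank-one map is equivariant, hence zero. Its value on \<open>b\<close>,
  measured by \<open>\<eta> c\<close>, is the mean of a product of diagonal coefficients, and
  summing over \<open>b\<close> and \<open>c\<close> gives the product of the traces.\<close>

lemma characters_orthogonal:
  assumes "\<And>h. h \<in> lin_maps V W \<Longrightarrow> equivariant S V \<rho> \<rho>' h \<Longrightarrow> \<forall>v\<in>V. h v = 0"
  shows "(\<Sum>\<sigma> | \<sigma> permutes S. tr V (\<rho> (inv \<sigma>)) * tr W (\<rho>' \<sigma>)) = 0"
proof -
  obtain B \<xi> where B: "frame V B (\<lambda>b. b) \<xi>" using frame_exists[OF is_repD(1)[OF V]] .
  obtain C \<eta> where C: "frame W C (\<lambda>b. b) \<eta>" using frame_exists[OF is_repD(1)[OF W]] .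
  let ?G = "{\<sigma>. \<sigma> permutes S}"
  let ?c = "1 / of_nat (card ?G) :: 'k"
  note sV = is_repD(2)[OF V] and sW = is_repD(2)[OF W]
  have zero: "(\<Sum>\<sigma>\<in>?G. \<xi> b (\<rho> (inv \<sigma>) b) * \<eta> c (\<rho>' \<sigma> c)) = 0" if b: "b \<in> B" and c: "c \<in> C" for b c
  proof -
    have bV: "b \<in> V" "functional V (\<xi> b)" using B b unfolding frame_def by auto
    have cW: "c \<in> W" "functional W (\<eta> c)" using C c unfolding frame_def by auto
    \<comment> \<open>The matrix unit sending \<open>b\<close> to \<open>c\<close> in the two
      frames, cut off outside \<open>V\<close>.\<close>
    define h where "h = restrict0 V (\<lambda>v. fscale (\<xi> b v) c)"
    have h: "h \<in> lin_maps V W"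
      using bV cW sV sW unfolding h_def lin_maps_def restrict0_def functional_def
      by (auto simp: fs.subspace_scale fs.subspace_add fs.scale_left_distrib)
    have "avg S \<rho> \<rho>' h b = 0"
      using assms[OF avg_lin_maps[OF h] avg_equivariant[OF h]] bV by blast
    then have "0 = \<eta> c (avg S \<rho> \<rho>' h b)"
      using cW(2) sW fs.subspace_0[OF sW] unfolding functional_def
      by (metis add_cancel_right_left add.right_neutral)
    also have "\<dots> = (\<Sum>\<sigma>\<in>?G. ?c * \<eta> c (\<rho>' \<sigma> (h (\<rho> (inv \<sigma>) b))))"
      unfolding avg_def
      by (rule functional_sum[OF cW(2) sW]) (use lin_mapsD(1)[OF conj_lin_maps[OF h] bV(1)] in auto)
    also have "\<dots> = (\<Sum>\<sigma>\<in>?G. ?c * (\<xi> b (\<rho> (inv \<sigma>) b) * \<eta> c (\<rho>' \<sigma> c)))"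
    proof (rule sum.cong)
      fix \<sigma> assume "\<sigma> \<in> ?G"
      then have \<sigma>: "\<sigma> permutes S" by simp
      have "h (\<rho> (inv \<sigma>) b) = fscale (\<xi> b (\<rho> (inv \<sigma>) b)) c"
        using is_repD(6)[OF V permutes_inv[OF \<sigma>] bV(1)] unfolding h_def restrict0_def by simp
      then have "\<rho>' \<sigma> (h (\<rho> (inv \<sigma>) b)) = fscale (\<xi> b (\<rho> (inv \<sigma>) b)) (\<rho>' \<sigma> c)"
        using lin_mapsD(3)[OF is_repD(3)[OF W \<sigma>] cW(1)] by simp
      then show "?c * \<eta> c (\<rho>' \<sigma> (h (\<rho> (inv \<sigma>) b))) = ?c * (\<xi> b (\<rho> (inv \<sigma>) b) * \<eta> c (\<rho>' \<sigma> c))"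
        using cW(2) is_repD(6)[OF W \<sigma> cW(1)] unfolding functional_def by simp
    qed simp
    also have "\<dots> = ?c * (\<Sum>\<sigma>\<in>?G. \<xi> b (\<rho> (inv \<sigma>) b) * \<eta> c (\<rho>' \<sigma> c))"
      by (simp add: sum_distrib_left)
    finally show ?thesis using card_permutes_nonzero by simp
  qed
  have "(\<Sum>\<sigma>\<in>?G. tr V (\<rho> (inv \<sigma>)) * tr W (\<rho>' \<sigma>)) =
      (\<Sum>\<sigma>\<in>?G. \<Sum>b\<in>B. \<Sum>c\<in>C. \<xi> b (\<rho> (inv \<sigma>) b) * \<eta> c (\<rho>' \<sigma> c))"
    by (rule sum.cong)
      (auto simp: tr_frame[OF is_repD(1)[OF V] B is_repD(3)[OF V permutes_inv]]
        tr_frame[OF is_repD(1)[OF W] C is_repD(3)[OF W]] sum_product)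
  also have "\<dots> = (\<Sum>b\<in>B. \<Sum>c\<in>C. \<Sum>\<sigma>\<in>?G. \<xi> b (\<rho> (inv \<sigma>) b) * \<eta> c (\<rho>' \<sigma> c))"
    by (subst sum.swap) (simp add: sum.swap[of _ C])
  also have "\<dots> = 0" using zero by simp
  finally show ?thesis .
qed

end

text \<open>A linear section of \<open>f\<close> over its image, extended by zero along a
  complement, is averaged. Since \<open>f\<close> is equivariant, each conjugate is again a section
  on the image, so the mean still satisfies \<open>f (g (f v)) = f v\<close>. This form of Maschke's
  theorem needs neither kernels nor quotients.\<close>

lemma equivariant_regular:
  fixes V :: "('i \<Rightarrow> 'k::field_char_0) set" and W :: "('j \<Rightarrow> 'k) set"
  assumes S: "finite S" and V: "is_rep S V \<rho>" and W: "is_rep S W \<rho>'"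
    and f: "f \<in> lin_maps V W" "equivariant S V \<rho> \<rho>' f"
  obtains g where "g \<in> lin_maps W V" "equivariant S W \<rho>' \<rho> g" "\<And>v. v \<in> V \<Longrightarrow> f (g (f v)) = f v"
proof -
  note sV = is_repD(2)[OF V] and sW = is_repD(2)[OF W]
  define I where "I = f ` V"
  have sI: "fs.subspace I" unfolding I_def by (rule lin_maps_image_subspace[OF f(1) sV])
  have IW: "I \<subseteq> W" unfolding I_def using lin_mapsD(1)[OF f(1)] by auto
  obtain D where D: "finite D" "fs.independent D" "fs.span D = I"
    using fin_space_basis[OF subspace_fin_space[OF is_repD(1)[OF W] sI IW]] .
  have DW: "D \<subseteq> W" using D IW fs.span_base by blast
  obtain C where C: "D \<subseteq> C" "C \<subseteq> W" "fs.independent C" "W \<subseteq> fs.span C"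
    using fs.maximal_independent_subset_extend[OF DW D(2)] by blast
  have CW: "fs.span C = W" using C sW fs.span_minimal by blast
  define p where "p = (\<lambda>c. SOME v. v \<in> V \<and> f v = c)"
  have p: "p c \<in> V" "f (p c) = c" if "c \<in> D" for c
  proof -
    have "c \<in> f ` V" using that D(3) fs.span_base unfolding I_def by blast
    then have "\<exists>v. v \<in> V \<and> f v = c" by auto
    from someI_ex[OF this] show "p c \<in> V" "f (p c) = c" unfolding p_def by auto
  qed
  define g0 where "g0 = restrict0 W (\<lambda>w. \<Sum>c\<in>D. fscale (fs.representation C w c) (p c))"
  have g0: "g0 \<in> lin_maps W V"
  proof -
    have "(\<Sum>c\<in>D. fscale (fs.representation C w c) (p c)) \<in> V" for w
      using p sV by (intro fs.subspace_sum) (auto intro: fs.subspace_scale)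
    then show ?thesis
      unfolding g0_def lin_maps_def restrict0_def
      using fs.subspace_add[OF sW] fs.subspace_scale[OF sW] C(3) CW
      by (auto simp: fs.representation_add fs.representation_scale fs.scale_left_distrib
          sum.distrib fs.scale_sum_right)
  qed
  have fg0: "f (g0 w) = w" if w: "w \<in> I" for w
  proof -
    have "fs.representation C w = fs.representation D w"
      using fs.representation_extend[OF C(3) _ C(1)] w D(3) by auto
    then have "f (g0 w) = f (\<Sum>c\<in>D. fscale (fs.representation D w c) (p c))"
      using w IW unfolding g0_def restrict0_def by auto
    also have "\<dots> = (\<Sum>c\<in>D. fscale (fs.representation D w c) (f (p c)))"
      by (rule lin_map_sum[OF f(1) sV p(1)])
    also have "\<dots> = (\<Sum>c\<in>D. fscale (fs.representation D w c) c)"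
      using p by simp
    also have "\<dots> = w" using fs.sum_representation_eq[OF D(2) _ D(1)] w D(3) by simp
    finally show ?thesis .
  qed
  have conj: "f (\<rho> \<sigma> (g0 (\<rho>' (inv \<sigma>) (f v)))) = f v" if \<sigma>: "\<sigma> permutes S" and v: "v \<in> V" for \<sigma> v
  proof -
    note i = permutes_inv[OF \<sigma>]
    have e: "\<And>\<tau> u. \<tau> permutes S \<Longrightarrow> u \<in> V \<Longrightarrow> f (\<rho> \<tau> u) = \<rho>' \<tau> (f u)"
      using f(2) unfolding equivariant_def by blast
    have m: "\<rho>' (inv \<sigma>) (f v) \<in> I"
      using e[OF i v, symmetric] is_repD(6)[OF V i v] unfolding I_def by auto
    then have "g0 (\<rho>' (inv \<sigma>) (f v)) \<in> V" using IW lin_mapsD(1)[OF g0] by auto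
    then have "f (\<rho> \<sigma> (g0 (\<rho>' (inv \<sigma>) (f v)))) = \<rho>' \<sigma> (\<rho>' (inv \<sigma>) (f v))"
      using e[OF \<sigma>] fg0[OF m] by simp
    also have "\<dots> = f v" using is_repD(7)[OF W \<sigma>] lin_mapsD(1)[OF f(1) v] by simp
    finally show ?thesis .
  qed
  let ?c = "1 / of_nat (card {\<sigma>. \<sigma> permutes S}) :: 'k"
  have "f (avg S \<rho>' \<rho> g0 (f v)) = f v" if v: "v \<in> V" for v
  proof -
    have "f (avg S \<rho>' \<rho> g0 (f v)) = (\<Sum>\<sigma> | \<sigma> permutes S. fscale ?c (f (\<rho> \<sigma> (g0 (\<rho>' (inv \<sigma>) (f v))))))"
      unfolding avg_def
      by (rule lin_map_sum[OF f(1) sV])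
        (use lin_mapsD(1)[OF f(1) v] lin_mapsD(1)[OF g0] is_repD(6)[OF V] is_repD(6)[OF W permutes_inv] in auto)
    also have "\<dots> = f v" using conj[OF _ v] sum_const_average[OF S V W, of "f v"] by (simp del: sum_constant)
    finally show ?thesis .
  qed
  with that show ?thesis
    using avg_lin_maps[OF S W V g0] avg_equivariant[OF S W V g0] by blast
qed

lemma subrep:
  assumes V: "is_rep S V \<rho>" and U: "fs.subspace U" "U \<subseteq> V"
    "\<And>\<sigma> v. \<sigma> permutes S \<Longrightarrow> v \<in> U \<Longrightarrow> \<rho> \<sigma> v \<in> U"
  shows "is_rep S U (\<lambda>\<sigma>. restrict0 U (\<rho> \<sigma>))"
proof -
  have "restrict0 U (\<rho> \<sigma>) \<in> lin_maps U U" if "\<sigma> permutes S" for \<sigma>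
    using lin_mapsD[OF is_repD(3)[OF V that]] U that fs.subspace_add[OF U(1)] fs.subspace_scale[OF U(1)]
    unfolding lin_maps_def restrict0_def by (auto simp: subset_iff)
  moreover have "fin_space U" by (rule subspace_fin_space[OF is_repD(1)[OF V] U(1,2)])
  ultimately show ?thesis
    using is_repD(4,5)[OF V] U unfolding is_rep_def restrict0_def by (auto simp: subset_iff)
qed

text \<open>Averaging is an idempotent on the endomorphisms of \<open>K\<close>, and the sum of characters below
  is its trace; endomorphisms are encoded as vectors with coordinates \<open>(v, i)\<close>.\<close>

lemma rep_norm_zero:
  fixes K :: "('i \<Rightarrow> 'k::field_char_0) set"
  assumes S: "finite S" and K: "is_rep S K \<rho>"
    and zero: "(\<Sum>\<sigma> | \<sigma> permutes S. tr K (\<rho> (inv \<sigma>)) * tr K (\<rho> \<sigma>)) = 0"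
  shows "K = {0}"
proof -
  obtain B \<xi> where B: "frame K B (\<lambda>b. b) \<xi>" using frame_exists[OF is_repD(1)[OF K]] .
  have BK: "\<And>b. b \<in> B \<Longrightarrow> b \<in> K" "\<And>b. b \<in> B \<Longrightarrow> functional K (\<xi> b)" "finite B"
    using B unfolding frame_def by auto
  let ?G = "{\<sigma>. \<sigma> permutes S}"
  let ?N = "1 / of_nat (card ?G) :: 'k"
  define enc :: "(('i \<Rightarrow> 'k) \<Rightarrow> 'i \<Rightarrow> 'k) \<Rightarrow> (('i \<Rightarrow> 'k) \<times> 'i) \<Rightarrow> 'k" where "enc = (\<lambda>h (v, i). h v i)"
  define dec :: "((('i \<Rightarrow> 'k) \<times> 'i) \<Rightarrow> 'k) \<Rightarrow> (('i \<Rightarrow> 'k) \<Rightarrow> 'i \<Rightarrow> 'k)" where "dec = (\<lambda>m v i. m (v, i))"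
  have [simp]: "dec (enc h) = h" "enc (dec m) = m" for h m by (auto simp: enc_def dec_def)
  have dec_lin: "dec (m + m') = (\<lambda>v. dec m v + dec m' v)" "dec (fscale c m) = (\<lambda>v. fscale c (dec m v))" for m m' c
    by (auto simp: dec_def fscale_def plus_fun_def)
  have enc_lin: "enc (\<lambda>v. h v + h' v) = enc h + enc h'" "enc (\<lambda>v. fscale c (h v)) = fscale c (enc h)" for h h' c
    by (auto simp: enc_def fscale_def plus_fun_def)
  \<comment> \<open>Functions of a vector become vectors with coordinates, so that
    \<open>fin_space\<close> and \<open>tr\<close> apply to the space of endomorphisms
    itself.\<close>
  define H where "H = enc ` lin_maps K K"
  have H_iff: "m \<in> H \<longleftrightarrow> dec m \<in> lin_maps K K" for m
    unfolding H_def by (metis \<open>\<And>h. dec (enc h) = h\<close> \<open>\<And>m. enc (dec m) = m\<close> image_iff)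
  note sK = is_repD(2)[OF K]
  have lin_add: "(\<lambda>v. h v + h' v) \<in> lin_maps K K" if "h \<in> lin_maps K K" "h' \<in> lin_maps K K" for h h'
    using that lin_mapsD[OF that(1)] lin_mapsD[OF that(2)] fs.subspace_add[OF sK]
    unfolding lin_maps_def by (auto simp: fs.scale_right_distrib image_subset_iff)
  have lin_scale: "(\<lambda>v. fscale c (h v)) \<in> lin_maps K K" if "h \<in> lin_maps K K" for h c
    using lin_mapsD[OF that] fs.subspace_scale[OF sK]
    unfolding lin_maps_def by (auto simp: fs.scale_right_distrib image_subset_iff mult.commute)
  have lin_zero: "(\<lambda>v. 0) \<in> lin_maps K K"
    using fs.subspace_0[OF sK] unfolding lin_maps_def by auto
  have dec_zero: "dec 0 = (\<lambda>v. 0)" by (simp add: dec_def zero_fun_def)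
  have sH: "fs.subspace H"
    unfolding fs.subspace_def H_iff dec_lin
    using lin_add lin_scale lin_zero dec_zero H_iff by auto
  \<comment> \<open>\<open>un\<close> are the matrix units of the frame and \<open>co\<close> the
    matrix coefficients; together they resolve the identity of \<open>H\<close>, although the frame
    need not be a basis.\<close>
  define un where "un = (\<lambda>(b, c). enc (restrict0 K (\<lambda>v. fscale (\<xi> b v) c)))"
  define co where "co = (\<lambda>(b, c) m. \<xi> c (dec m b))"
  have un: "un p \<in> H" if "p \<in> B \<times> B" for p
    using that BK sK unfolding un_def H_iff lin_maps_def restrict0_def functional_def
    by (auto simp: fs.subspace_scale fs.subspace_add fs.scale_left_distrib)
  have co: "functional H (co p)" if pB: "p \<in> B \<times> B" for p
  proof -
    obtain b c where p: "p = (b, c)" "b \<in> B" "c \<in> B" using pB by (rule SigmaE)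
    show ?thesis
      unfolding functional_def co_def p
      using BK(2)[OF p(3)] lin_mapsD(1)[OF _ BK(1)[OF p(2)], of _ K] H_iff
      by (simp add: dec_lin functional_def)
  qed
  have res: "m = (\<Sum>p\<in>B \<times> B. fscale (co p m) (un p))" if "m \<in> H" for m
  proof -
    have dm: "dec m \<in> lin_maps K K" using that H_iff by simp
    have "dec m v = (\<Sum>b\<in>B. \<Sum>c\<in>B. fscale (\<xi> c (dec m b)) (fscale (\<xi> b v) c))" if v: "v \<in> K" for v
    proof -
      have "v = (\<Sum>b\<in>B. fscale (\<xi> b v) b)" using B v unfolding frame_def by auto
      then have "dec m v = dec m (\<Sum>b\<in>B. fscale (\<xi> b v) b)" by simp
      also have "\<dots> = (\<Sum>b\<in>B. fscale (\<xi> b v) (dec m b))"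
        by (rule lin_map_sum[OF dm sK]) (use BK in auto)
      also have "\<dots> = (\<Sum>b\<in>B. fscale (\<xi> b v) (\<Sum>c\<in>B. fscale (\<xi> c (dec m b)) c))"
      proof (rule sum.cong)
        fix b assume "b \<in> B"
        then have "dec m b \<in> K" using lin_mapsD(1)[OF dm] BK by auto
        then show "fscale (\<xi> b v) (dec m b) = fscale (\<xi> b v) (\<Sum>c\<in>B. fscale (\<xi> c (dec m b)) c)"
          using B unfolding frame_def by auto
      qed simp
      also have "\<dots> = (\<Sum>b\<in>B. \<Sum>c\<in>B. fscale (\<xi> c (dec m b)) (fscale (\<xi> b v) c))"
        by (simp add: fs.scale_sum_right mult.commute)
      finally show ?thesis .
    qed
    moreover have "(\<Sum>p\<in>B \<times> B. fscale (co p m) (un p)) (v, i) =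
        (\<Sum>b\<in>B. \<Sum>c\<in>B. \<xi> c (dec m b) * un (b, c) (v, i))" for v i
      unfolding sum_fun_apply sum.cartesian_product by (rule sum.cong) (auto simp: fscale_def co_def)
    ultimately have "dec m v i = (\<Sum>p\<in>B \<times> B. fscale (co p m) (un p)) (v, i)" for v i
      using lin_mapsD(4)[OF dm, of v]
      by (cases "v \<in> K") (simp_all add: sum_fun_apply un_def fscale_def enc_def restrict0_def)
    then show ?thesis by (auto simp: dec_def)
  qed
  have fH: "frame H (B \<times> B) un co"
    unfolding frame_def using BK(3) un co res by simp
  have finH: "fin_space H"
    unfolding fin_space_def
  proof (intro exI conjI)
    show "finite (un ` (B \<times> B))" using BK(3) by simp
    show "H = fs.span (un ` (B \<times> B))"
    proof
      show "H \<subseteq> fs.span (un ` (B \<times> B))"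
      proof
        fix m assume "m \<in> H"
        then have "m = (\<Sum>p\<in>B \<times> B. fscale (co p m) (un p))" by (rule res)
        moreover have "(\<Sum>p\<in>B \<times> B. fscale (co p m) (un p)) \<in> fs.span (un ` (B \<times> B))"
          by (intro fs.span_sum fs.span_scale fs.span_base) auto
        ultimately show "m \<in> fs.span (un ` (B \<times> B))" by simp
      qed
      show "fs.span (un ` (B \<times> B)) \<subseteq> H"
        by (rule fs.span_minimal[OF _ sH]) (use un in auto)
    qed
  qed
  define E where "E = restrict0 H (\<lambda>m. enc (avg S \<rho> \<rho> (dec m)))"
  have avg_add: "avg S \<rho> \<rho> (\<lambda>v. h v + h' v) = (\<lambda>v. avg S \<rho> \<rho> h v + avg S \<rho> \<rho> h' v)"
    if "h \<in> lin_maps K K" "h' \<in> lin_maps K K" for h h'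
  proof
    fix v
    have "fscale ?N (\<rho> \<sigma> (h (\<rho> (inv \<sigma>) v) + h' (\<rho> (inv \<sigma>) v))) =
        fscale ?N (\<rho> \<sigma> (h (\<rho> (inv \<sigma>) v))) + fscale ?N (\<rho> \<sigma> (h' (\<rho> (inv \<sigma>) v)))"
      if \<sigma>: "\<sigma> permutes S" for \<sigma>
    proof (cases "\<rho> (inv \<sigma>) v \<in> K")
      case True
      then show ?thesis
        using lin_mapsD(1) \<open>h \<in> lin_maps K K\<close> \<open>h' \<in> lin_maps K K\<close> lin_mapsD(2)[OF is_repD(3)[OF K \<sigma>]]
        by (metis fs.scale_right_distrib)
    qed (use that lin_mapsD(4)[OF \<open>h \<in> lin_maps K K\<close>] lin_mapsD(4)[OF \<open>h' \<in> lin_maps K K\<close>] is_repD(3)[OF K \<sigma>] in auto)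
    then show "avg S \<rho> \<rho> (\<lambda>v. h v + h' v) v = avg S \<rho> \<rho> h v + avg S \<rho> \<rho> h' v"
      unfolding avg_def sum.distrib[symmetric] by (intro sum.cong) auto
  qed
  have avg_scale: "avg S \<rho> \<rho> (\<lambda>v. fscale c (h v)) = (\<lambda>v. fscale c (avg S \<rho> \<rho> h v))"
    if "h \<in> lin_maps K K" for h c
  proof
    fix v
    have "fscale ?N (\<rho> \<sigma> (fscale c (h (\<rho> (inv \<sigma>) v)))) =
        fscale c (fscale ?N (\<rho> \<sigma> (h (\<rho> (inv \<sigma>) v))))"
      if \<sigma>: "\<sigma> permutes S" for \<sigma>
    proof (cases "\<rho> (inv \<sigma>) v \<in> K")
      case True
      then show ?thesis
        using lin_mapsD(1) \<open>h \<in> lin_maps K K\<close> lin_mapsD(3)[OF is_repD(3)[OF K \<sigma>]]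
        by (metis fs.scale_scale mult.commute)
    qed (use that lin_mapsD(4)[OF \<open>h \<in> lin_maps K K\<close>] is_repD(3)[OF K \<sigma>] in auto)
    then show "avg S \<rho> \<rho> (\<lambda>v. fscale c (h v)) v = fscale c (avg S \<rho> \<rho> h v)"
      unfolding avg_def fs.scale_sum_right by (intro sum.cong) auto
  qed
  have E: "E \<in> lin_maps H H"
  proof -
    have "E m \<in> H" if "m \<in> H" for m
      using that avg_lin_maps[OF S K K] by (simp add: E_def restrict0_def H_iff)
    moreover have "E (m + m') = E m + E m'" if "m \<in> H" "m' \<in> H" for m m'
      using that fs.subspace_add[OF sH that] avg_add[of "dec m" "dec m'"]
      by (simp add: E_def restrict0_def H_iff dec_lin enc_lin)
    moreover have "E (fscale c m) = fscale c (E m)" if "m \<in> H" for m c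
      using that fs.subspace_scale[OF sH that] avg_scale[of "dec m"]
      by (simp add: E_def restrict0_def H_iff dec_lin enc_lin)
    ultimately show ?thesis unfolding lin_maps_def by (auto simp: E_def restrict0_def)
  qed
  have EE: "E (E m) = E m" if m: "m \<in> H" for m
  proof -
    have d: "dec m \<in> lin_maps K K" using m H_iff by simp
    let ?a = "avg S \<rho> \<rho> (dec m)"
    have a: "?a \<in> lin_maps K K" by (rule avg_lin_maps[OF S K K d])
    have "avg S \<rho> \<rho> ?a = ?a"
    proof
      fix v show "avg S \<rho> \<rho> ?a v = ?a v"
        using avg_of_equivariant[OF S K K avg_equivariant[OF S K K d], of v]
          lin_mapsD(4)[OF a, of v] lin_mapsD(4)[OF avg_lin_maps[OF S K K a], of v]
        by (cases "v \<in> K") auto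
    qed
    then show ?thesis using m a by (simp add: E_def restrict0_def H_iff)
  qed
  \<comment> \<open>The coefficient at \<open>(b, c)\<close> of the averaged matrix unit at
    \<open>(b, c)\<close> is the mean of products of diagonal coefficients of
    \<open>inv \<sigma>\<close> and \<open>\<sigma>\<close>. The sum over all pairs is the mean of
    the products of character values.\<close>
  have "tr H E = (\<Sum>p\<in>B \<times> B. co p (E (un p)))"
    by (rule tr_frame[OF finH fH E])
  also have "\<dots> = (\<Sum>b\<in>B. \<Sum>c\<in>B. ?N * (\<Sum>\<sigma>\<in>?G. \<xi> b (\<rho> (inv \<sigma>) b) * \<xi> c (\<rho> \<sigma> c)))"
    unfolding sum.cartesian_product
  proof (rule sum.cong)
    fix p assume "p \<in> B \<times> B"
    then obtain b c where p: "p = (b, c)" "b \<in> B" "c \<in> B" by auto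
    note bK = BK(1,2)[OF p(2)] and cK = BK(1,2)[OF p(3)]
    have uH: "un (b, c) \<in> H" using un p by auto
    then have dK: "dec (un (b, c)) \<in> lin_maps K K" using H_iff by simp
    have "co p (E (un p)) = \<xi> c (avg S \<rho> \<rho> (dec (un (b, c))) b)"
      using uH by (simp add: p co_def E_def restrict0_def)
    also have "\<dots> = (\<Sum>\<sigma>\<in>?G. ?N * \<xi> c (\<rho> \<sigma> (dec (un (b, c)) (\<rho> (inv \<sigma>) b))))"
      unfolding avg_def
      by (rule functional_sum[OF cK(2) sK])
        (use lin_mapsD(1)[OF conj_lin_maps[OF S K K dK] bK(1)] in auto)
    also have "\<dots> = (\<Sum>\<sigma>\<in>?G. ?N * (\<xi> b (\<rho> (inv \<sigma>) b) * \<xi> c (\<rho> \<sigma> c)))"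
    proof (rule sum.cong)
      fix \<sigma> assume "\<sigma> \<in> ?G"
      then have \<sigma>: "\<sigma> permutes S" by simp
      have "dec (un (b, c)) (\<rho> (inv \<sigma>) b) = fscale (\<xi> b (\<rho> (inv \<sigma>) b)) c"
        using is_repD(6)[OF K permutes_inv[OF \<sigma>] bK(1)] unfolding un_def restrict0_def by simp
      then have "\<rho> \<sigma> (dec (un (b, c)) (\<rho> (inv \<sigma>) b)) = fscale (\<xi> b (\<rho> (inv \<sigma>) b)) (\<rho> \<sigma> c)"
        using lin_mapsD(3)[OF is_repD(3)[OF K \<sigma>] cK(1)] by simp
      then show "?N * \<xi> c (\<rho> \<sigma> (dec (un (b, c)) (\<rho> (inv \<sigma>) b))) = ?N * (\<xi> b (\<rho> (inv \<sigma>) b) * \<xi> c (\<rho> \<sigma> c))"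
        using cK(2) is_repD(6)[OF K \<sigma> cK(1)] unfolding functional_def by simp
    qed simp
    finally show "co p (E (un p)) =
        (case p of (b, c) \<Rightarrow> ?N * (\<Sum>\<sigma>\<in>?G. \<xi> b (\<rho> (inv \<sigma>) b) * \<xi> c (\<rho> \<sigma> c)))"
      by (simp add: p sum_distrib_left)
  qed simp
  also have "\<dots> = ?N * (\<Sum>\<sigma>\<in>?G. \<Sum>b\<in>B. \<Sum>c\<in>B. \<xi> b (\<rho> (inv \<sigma>) b) * \<xi> c (\<rho> \<sigma> c))"
    by (subst (3) sum.swap) (simp add: sum.swap[of _ ?G] sum_distrib_left)
  also have "(\<Sum>\<sigma>\<in>?G. \<Sum>b\<in>B. \<Sum>c\<in>B. \<xi> b (\<rho> (inv \<sigma>) b) * \<xi> c (\<rho> \<sigma> c)) =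
      (\<Sum>\<sigma>\<in>?G. tr K (\<rho> (inv \<sigma>)) * tr K (\<rho> \<sigma>))"
    by (rule sum.cong)
      (auto simp: tr_frame[OF is_repD(1)[OF K] B is_repD(3)[OF K permutes_inv]]
        tr_frame[OF is_repD(1)[OF K] B is_repD(3)[OF K]] sum_product)
  finally have trE: "tr H E = 0" using zero by simp
  let ?id = "restrict0 K (\<lambda>v. v)"
  have id: "?id \<in> lin_maps K K" by (rule restrict0_id_lin_maps[OF sK])
  \<comment> \<open>An idempotent of trace zero vanishes, whereas averaging fixes the identity of
    \<open>K\<close>; hence that identity is zero.\<close>
  have "E (enc ?id) = 0"
    by (rule idempotent_trace_zero[OF finH E EE trE]) (simp_all add: H_iff id)
  then have "avg S \<rho> \<rho> ?id = (\<lambda>v. 0)"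
    using id by (simp add: E_def restrict0_def H_iff) (simp add: enc_def fun_eq_iff)
  moreover have "equivariant S K \<rho> \<rho> ?id"
    unfolding equivariant_def restrict0_def using is_repD(6)[OF K] by auto
  ultimately have "?id v = 0" if "v \<in> K" for v
    using avg_of_equivariant[OF S K K _ that, of ?id] by simp
  then show ?thesis using fs.subspace_0[OF sK] by (auto simp: restrict0_def)
qed


section \<open>Complements of equivariant idempotents, and spaces with equal characters\<close>

lemma tr_add:
  assumes "fin_space V" "f \<in> lin_maps V V" "g \<in> lin_maps V V"
  shows "tr V (\<lambda>v. f v + g v) = tr V f + tr V g"
proof -
  have "tr V (\<lambda>v. \<Sum>b\<in>UNIV. fscale 1 ((if b then f else g) v)) = (\<Sum>b\<in>UNIV. 1 * tr V (if b then f else g))"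
    by (rule tr_lin_comb) (use assms in auto)
  then show ?thesis by (simp add: UNIV_bool add.commute)
qed

lemma lin_maps_add:
  assumes "fs.subspace W" "f \<in> lin_maps V W" "g \<in> lin_maps V W"
  shows "(\<lambda>v. f v + g v) \<in> lin_maps V W"
  using lin_mapsD[OF assms(2)] lin_mapsD[OF assms(3)] fs.subspace_add[OF assms(1)]
  unfolding lin_maps_def by (auto simp: fs.scale_right_distrib image_subset_iff)

lemma lin_maps_uminus:
  assumes "fs.subspace W" "f \<in> lin_maps V W"
  shows "(\<lambda>v. - f v) \<in> lin_maps V W"
  using lin_mapsD[OF assms(2)] fs.subspace_neg[OF assms(1)]
  unfolding lin_maps_def by (auto simp: image_subset_iff)

text \<open>The complementary projection lands in the kernel and fixes it pointwise, so cyclicity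
  moves the trace from \<open>K\<close> to \<open>V\<close>, where it is a difference of two
  traces.\<close>

lemma kernel_rep:
  fixes V :: "('i \<Rightarrow> 'k::field) set"
  assumes V: "is_rep S V \<rho>" and e: "e \<in> lin_maps V V" "equivariant S V \<rho> \<rho> e"
    and ee: "\<forall>v\<in>V. e (e v) = e v"
  defines "K \<equiv> {v \<in> V. e v = 0}"
  shows "is_rep S K (\<lambda>\<sigma>. restrict0 K (\<rho> \<sigma>))"
    and "\<sigma> permutes S \<Longrightarrow> tr K (restrict0 K (\<rho> \<sigma>)) = tr V (\<rho> \<sigma>) - tr V (\<rho> \<sigma> \<circ> e)"
    and "\<sigma> permutes S \<Longrightarrow> v \<in> K \<Longrightarrow> \<rho> \<sigma> v \<in> K"
proof -
  note sV = is_repD(2)[OF V]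
  have sK: "fs.subspace K"
    unfolding K_def fs.subspace_def using sV lin_mapsD[OF e(1)] e(1)
    by (auto simp: fs.subspace_add fs.subspace_scale fs.subspace_0)
  have inv: "\<rho> \<sigma> v \<in> K" if "\<sigma> permutes S" "v \<in> K" for \<sigma> v
    using that e(2) is_repD(6)[OF V] lin_maps_zero[OF is_repD(3)[OF V]]
    unfolding K_def equivariant_def by auto
  then show "\<sigma> permutes S \<Longrightarrow> v \<in> K \<Longrightarrow> \<rho> \<sigma> v \<in> K" .
  have KV: "K \<subseteq> V" unfolding K_def by auto
  show rep: "is_rep S K (\<lambda>\<sigma>. restrict0 K (\<rho> \<sigma>))"
    by (rule subrep[OF V sK KV inv])
  assume \<sigma>: "\<sigma> permutes S"
  define \<pi> where "\<pi> = (\<lambda>v. restrict0 V (\<lambda>v. v) v + - e v)"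
  have \<pi>: "\<pi> \<in> lin_maps V V"
    unfolding \<pi>_def by (rule lin_maps_add[OF sV restrict0_id_lin_maps[OF sV] lin_maps_uminus[OF sV e(1)]])
  have \<pi>K: "\<pi> \<in> lin_maps V K"
  proof -
    have "\<pi> v \<in> K" if v: "v \<in> V" for v
    proof -
      have "e v + e (\<pi> v) = e (e v + \<pi> v)"
        using lin_mapsD(2)[OF e(1)] lin_mapsD(1)[OF e(1) v] lin_mapsD(1)[OF \<pi> v] bspec[OF ee v] by simp
      also have "e v + \<pi> v = v" using v by (simp add: \<pi>_def restrict0_def)
      finally have "e (\<pi> v) = 0" by (metis add_cancel_right_right)
      then show ?thesis using lin_mapsD(1)[OF \<pi> v] by (simp add: K_def)
    qed
    then show ?thesis using \<pi> unfolding lin_maps_def by auto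
  qed
  have iK: "restrict0 K (\<rho> \<sigma>) \<in> lin_maps K V"
    using is_repD(3)[OF rep \<sigma>] KV unfolding lin_maps_def by auto
  have neg: "(\<lambda>v. - (\<rho> \<sigma> \<circ> e) v) \<in> lin_maps V V"
    by (rule lin_maps_uminus[OF sV lin_maps_comp[OF e(1) is_repD(3)[OF V \<sigma>]]])
  have "tr K (restrict0 K (\<rho> \<sigma>)) = tr K (\<pi> \<circ> restrict0 K (\<rho> \<sigma>))"
  proof (rule tr_cong[OF is_repD(1)[OF rep]])
    fix v assume v: "v \<in> K"
    then show "restrict0 K (\<rho> \<sigma>) v = (\<pi> \<circ> restrict0 K (\<rho> \<sigma>)) v"
      using inv[OF \<sigma> v] by (simp add: restrict0_def \<pi>_def K_def)
  qed
  also have "\<dots> = tr V (restrict0 K (\<rho> \<sigma>) \<circ> \<pi>)"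
    by (rule tr_commute[OF is_repD(1)[OF rep] is_repD(1)[OF V] iK \<pi>K])
  also have "\<dots> = tr V (\<lambda>v. \<rho> \<sigma> v + - (\<rho> \<sigma> \<circ> e) v)"
  proof (rule tr_cong[OF is_repD(1)[OF V]])
    fix v assume v: "v \<in> V"
    have "\<rho> \<sigma> (\<pi> v + e v) = \<rho> \<sigma> (\<pi> v) + \<rho> \<sigma> (e v)"
      using lin_mapsD(2)[OF is_repD(3)[OF V \<sigma>]] lin_mapsD(1)[OF \<pi> v] lin_mapsD(1)[OF e(1) v] by blast
    moreover have "\<pi> v + e v = v" using v by (simp add: \<pi>_def restrict0_def)
    ultimately show "(restrict0 K (\<rho> \<sigma>) \<circ> \<pi>) v = \<rho> \<sigma> v + - (\<rho> \<sigma> \<circ> e) v"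
      using lin_mapsD(1)[OF \<pi>K v] by (simp add: restrict0_def)
  qed
  also have "\<dots> = tr V (\<rho> \<sigma>) + tr V (\<lambda>v. - (\<rho> \<sigma> \<circ> e) v)"
    by (rule tr_add[OF is_repD(1)[OF V] is_repD(3)[OF V \<sigma>] neg])
  also have "tr V (\<lambda>v. - (\<rho> \<sigma> \<circ> e) v) = tr V (\<lambda>v. \<Sum>b\<in>{()}. fscale (- 1) ((\<rho> \<sigma> \<circ> e) v))"
    by (simp add: fscale_def fun_Compl_def)
  also have "\<dots> = - tr V (\<rho> \<sigma> \<circ> e)"
    by (subst tr_lin_comb[OF is_repD(1)[OF V] lin_maps_comp[OF e(1) is_repD(3)[OF V \<sigma>]]]) simp
  finally show "tr K (restrict0 K (\<rho> \<sigma>)) = tr V (\<rho> \<sigma>) - tr V (\<rho> \<sigma> \<circ> e)" by simp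
qed

text \<open>Take an equivariant \<open>f\<close> of maximal rank and an equivariant \<open>g\<close>
  with \<open>f (g (f v)) = f v\<close>. Maximality excludes nonzero equivariant maps from the
  kernel \<open>K\<close> of \<open>g \<circ> f\<close> to the kernel \<open>L\<close> of
  \<open>f \<circ> g\<close>, so their characters are orthogonal. These characters are also equal,
  so their norms vanish and with them both spaces.\<close>

lemma equal_characters_isomorphic:
  fixes V :: "('i \<Rightarrow> 'k::field_char_0) set" and W :: "('j \<Rightarrow> 'k) set"
  assumes S: "finite S" and V: "is_rep S V \<rho>" and W: "is_rep S W \<rho>'"
    and eq: "\<And>\<sigma>. \<sigma> permutes S \<Longrightarrow> tr V (\<rho> \<sigma>) = tr W (\<rho>' \<sigma>)"
  obtains f g where "f \<in> lin_maps V W" "equivariant S V \<rho> \<rho>' f"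
    "g \<in> lin_maps W V" "equivariant S W \<rho>' \<rho> g"
    "\<And>v. v \<in> V \<Longrightarrow> g (f v) = v" "\<And>w. w \<in> W \<Longrightarrow> f (g w) = w"
proof -
  note sV = is_repD(2)[OF V] and sW = is_repD(2)[OF W]
  let ?Q = "\<lambda>f. f \<in> lin_maps V W \<and> equivariant S V \<rho> \<rho>' f"
  obtain N where N: "\<And>I. I \<subseteq> W \<Longrightarrow> fs.dim I \<le> N" using dim_bound[OF is_repD(1)[OF W]] by blast
  have "?Q (\<lambda>v. 0)"
    using fs.subspace_0[OF sW] lin_maps_zero[OF is_repD(3)[OF W]]
    unfolding lin_maps_def equivariant_def by auto
  moreover have "\<forall>f. ?Q f \<longrightarrow> fs.dim (f ` V) < Suc N"
    using N unfolding lin_maps_def less_Suc_eq_le by blast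
  ultimately have "\<exists>f. ?Q f \<and> (\<forall>f'. ?Q f' \<longrightarrow> fs.dim (f' ` V) \<le> fs.dim (f ` V))"
    by (rule Lattices_Big.ex_has_greatest_nat)
  then obtain f where f: "f \<in> lin_maps V W" "equivariant S V \<rho> \<rho>' f"
    and max: "\<And>f'. f' \<in> lin_maps V W \<Longrightarrow> equivariant S V \<rho> \<rho>' f' \<Longrightarrow> fs.dim (f' ` V) \<le> fs.dim (f ` V)"
    by blast
  obtain g where g: "g \<in> lin_maps W V" "equivariant S W \<rho>' \<rho> g" "\<And>v. v \<in> V \<Longrightarrow> f (g (f v)) = f v"
    using equivariant_regular[OF S V W f] by metis
  have fV: "\<And>v. v \<in> V \<Longrightarrow> f v \<in> W" and gW: "\<And>w. w \<in> W \<Longrightarrow> g w \<in> V"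
    using lin_mapsD(1)[OF f(1)] lin_mapsD(1)[OF g(1)] by auto
  have fe: "\<And>\<tau> u. \<tau> permutes S \<Longrightarrow> u \<in> V \<Longrightarrow> f (\<rho> \<tau> u) = \<rho>' \<tau> (f u)"
    using f(2) unfolding equivariant_def by blast
  have ge: "\<And>\<tau> u. \<tau> permutes S \<Longrightarrow> u \<in> W \<Longrightarrow> g (\<rho>' \<tau> u) = \<rho> \<tau> (g u)"
    using g(2) unfolding equivariant_def by blast
  have gf: "(g \<circ> f) \<in> lin_maps V V" "equivariant S V \<rho> \<rho> (g \<circ> f)"
    "\<forall>v\<in>V. (g \<circ> f) ((g \<circ> f) v) = (g \<circ> f) v"
    using lin_maps_comp[OF f(1) g(1)] fe ge fV g(3) unfolding equivariant_def by auto
  have fg: "(f \<circ> g) \<in> lin_maps W W" "equivariant S W \<rho>' \<rho>' (f \<circ> g)"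
    "\<forall>v\<in>W. (f \<circ> g) ((f \<circ> g) v) = (f \<circ> g) v"
    using lin_maps_comp[OF g(1) f(1)] fe ge gW g(3) unfolding equivariant_def by auto
  define K where "K = {v \<in> V. (g \<circ> f) v = 0}"
  define L where "L = {w \<in> W. (f \<circ> g) w = 0}"
  note K = kernel_rep[OF V gf, folded K_def] and L = kernel_rep[OF W fg, folded L_def]
  have Kf: "f v = 0" if "v \<in> K" for v
    using that g(3)[of v] lin_maps_zero[OF f(1)] unfolding K_def by simp
  define \<pi> where "\<pi> = (\<lambda>v. restrict0 V (\<lambda>v. v) v + - (g \<circ> f) v)"
  have \<pi>: "\<pi> \<in> lin_maps V V"
    unfolding \<pi>_def by (rule lin_maps_add[OF sV restrict0_id_lin_maps[OF sV] lin_maps_uminus[OF sV gf(1)]])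
  have sum\<pi>: "(g \<circ> f) v + \<pi> v = v" if "v \<in> V" for v
    using that by (simp add: \<pi>_def restrict0_def)
  have \<pi>K: "\<pi> v \<in> K" if v: "v \<in> V" for v
  proof -
    have "(g \<circ> f) ((g \<circ> f) v + \<pi> v) = (g \<circ> f) ((g \<circ> f) v) + (g \<circ> f) (\<pi> v)"
      by (rule lin_mapsD(2)[OF gf(1)]) (use lin_mapsD(1)[OF gf(1) v] lin_mapsD(1)[OF \<pi> v] in auto)
    then have "(g \<circ> f) (\<pi> v) = 0" unfolding sum\<pi>[OF v] bspec[OF gf(3) v] by simp
    then show ?thesis using lin_mapsD(1)[OF \<pi> v] by (simp add: K_def)
  qed
  have \<pi>e: "\<pi> (\<rho> \<sigma> v) = \<rho> \<sigma> (\<pi> v)" if \<sigma>: "\<sigma> permutes S" and v: "v \<in> V" for \<sigma> v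
  proof -
    have "\<rho> \<sigma> ((g \<circ> f) v + \<pi> v) = \<rho> \<sigma> ((g \<circ> f) v) + \<rho> \<sigma> (\<pi> v)"
      by (rule lin_mapsD(2)[OF is_repD(3)[OF V \<sigma>]])
        (use lin_mapsD(1)[OF gf(1) v] lin_mapsD(1)[OF \<pi> v] in auto)
    moreover have "\<rho> \<sigma> ((g \<circ> f) v) = (g \<circ> f) (\<rho> \<sigma> v)"
      using gf(2) \<sigma> v unfolding equivariant_def by auto
    moreover have "(g \<circ> f) (\<rho> \<sigma> v) + \<pi> (\<rho> \<sigma> v) = \<rho> \<sigma> v"
      by (rule sum\<pi>[OF is_repD(6)[OF V \<sigma> v]])
    ultimately show ?thesis unfolding sum\<pi>[OF v] by (metis add_left_cancel)
  qed
  have no_map: "\<forall>v\<in>K. h v = 0"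
    if h: "h \<in> lin_maps K L"
      and he: "equivariant S K (\<lambda>\<sigma>. restrict0 K (\<rho> \<sigma>)) (\<lambda>\<sigma>. restrict0 L (\<rho>' \<sigma>)) h" for h
  proof (rule ccontr)
    assume "\<not> ?thesis"
    then obtain k where k: "k \<in> K" "h k \<noteq> 0" by auto
    have \<pi>l: "\<pi> \<in> lin_maps V K" using \<pi> \<pi>K unfolding lin_maps_def by auto
    have h\<pi>: "(h \<circ> \<pi>) \<in> lin_maps V W"
      using lin_maps_comp[OF \<pi>l h] unfolding lin_maps_def L_def by auto
    \<comment> \<open>A map \<open>h\<close> from \<open>K\<close> to \<open>L\<close> is spread
      over \<open>V\<close> by the projection onto \<open>K\<close>. The new map agrees with
      \<open>f\<close> on the image of \<open>g \<circ> f\<close> and with \<open>h\<close> on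
      \<open>K\<close>, so its image contains that of \<open>f\<close> and also
      \<open>h k\<close>.\<close>
    define f' where "f' = (\<lambda>v. f v + (h \<circ> \<pi>) v)"
    have f': "f' \<in> lin_maps V W" unfolding f'_def by (rule lin_maps_add[OF sW f(1) h\<pi>])
    have "equivariant S V \<rho> \<rho>' f'"
      unfolding equivariant_def
    proof (intro allI impI ballI)
      fix \<sigma> v assume \<sigma>: "\<sigma> permutes S" and v: "v \<in> V"
      have "h (\<rho> \<sigma> (\<pi> v)) = \<rho>' \<sigma> (h (\<pi> v))"
        using he \<sigma> \<pi>K[OF v] lin_mapsD(1)[OF h] unfolding equivariant_def restrict0_def by auto
      then show "f' (\<rho> \<sigma> v) = \<rho>' \<sigma> (f' v)"
        using fe[OF \<sigma> v] \<pi>e[OF \<sigma> v] lin_mapsD(2)[OF is_repD(3)[OF W \<sigma>]] fV[OF v]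
          lin_mapsD(1)[OF h\<pi> v] unfolding f'_def by simp
    qed
    then have "fs.dim (f' ` V) \<le> fs.dim (f ` V)" using max f' by blast
    moreover have "fs.dim (f ` V) < fs.dim (f' ` V)"
    proof (rule dim_strict[OF is_repD(1)[OF W]])
      show "fs.subspace (f ` V)" "fs.subspace (f' ` V)"
        using lin_maps_image_subspace[OF f(1) sV] lin_maps_image_subspace[OF f' sV] by auto
      show "f' ` V \<subseteq> W" using lin_mapsD(1)[OF f'] by auto
      show "f ` V \<subseteq> f' ` V"
      proof
        fix y assume "y \<in> f ` V"
        then obtain v where v: "v \<in> V" "y = f v" by auto
        have gv: "g (f v) \<in> V" using fV gW v by auto
        have "\<pi> (g (f v)) = 0"
          using sum\<pi>[OF gv] g(3)[OF v(1)] by (simp add: \<pi>_def restrict0_def gv)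
        then have "f' (g (f v)) = f v" using g(3)[OF v(1)] lin_maps_zero[OF h] unfolding f'_def by (metis add.right_neutral comp_apply)
        then show "y \<in> f' ` V" using gv v by (metis image_eqI)
      qed
      have kV: "k \<in> V" using k unfolding K_def by simp
      have "\<pi> k = k" using k unfolding \<pi>_def K_def restrict0_def by simp
      then have "f' k = h k" using Kf[OF k(1)] by (simp add: f'_def)
      then have "h k \<in> f' ` V" using kV by (metis image_eqI)
      \<comment> \<open>\<open>f \<circ> g\<close> fixes the image of \<open>f\<close> and kills
        \<open>L\<close>, so the two meet only in zero.\<close>
      moreover have "h k \<notin> f ` V"
      proof
        assume "h k \<in> f ` V"
        then obtain v where v: "v \<in> V" "h k = f v" by auto
        have "f (g (h k)) = 0" using lin_mapsD(1)[OF h k(1)] by (simp add: L_def)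
        then show False using g(3)[OF v(1)] v k(2) by simp
      qed
      ultimately show "f ` V \<noteq> f' ` V" by auto
    qed
    ultimately show False by simp
  qed
  let ?G = "{\<sigma>. \<sigma> permutes S}"
  \<comment> \<open>Because \<open>f\<close> intertwines the actions, the traces over the images of
    \<open>g \<circ> f\<close> and \<open>f \<circ> g\<close> agree by cyclicity; subtracting them
    from the equal characters leaves the kernels.\<close>
  have chi: "tr K (restrict0 K (\<rho> \<sigma>)) = tr L (restrict0 L (\<rho>' \<sigma>))" if \<sigma>: "\<sigma> permutes S" for \<sigma>
  proof -
    have "tr V (\<rho> \<sigma> \<circ> (g \<circ> f)) = tr W (f \<circ> (\<rho> \<sigma> \<circ> g))"
      unfolding o_assoc
      using tr_commute[OF is_repD(1)[OF V] is_repD(1)[OF W] f(1) lin_maps_comp[OF g(1) is_repD(3)[OF V \<sigma>]]]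
      by (simp add: o_assoc)
    also have "\<dots> = tr W (\<rho>' \<sigma> \<circ> (f \<circ> g))"
      by (rule tr_cong[OF is_repD(1)[OF W]]) (use fe[OF \<sigma>] gW in auto)
    finally show ?thesis unfolding K(2)[OF \<sigma>] L(2)[OF \<sigma>] eq[OF \<sigma>] by simp
  qed
  have orth: "(\<Sum>\<sigma>\<in>?G. tr K (restrict0 K (\<rho> (inv \<sigma>))) * tr L (restrict0 L (\<rho>' \<sigma>))) = 0"
    by (rule characters_orthogonal[OF S K(1) L(1) no_map])
  have K0: "K = {0}"
    by (rule rep_norm_zero[OF S K(1)]) (use orth chi in simp)
  have L0: "L = {0}"
    by (rule rep_norm_zero[OF S L(1)]) (use orth chi[OF permutes_inv] in simp)
  have 1: "g (f v) = v" if "v \<in> V" for v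
    using \<pi>K[OF that] sum\<pi>[OF that] K0 by simp
  have 2: "f (g w) = w" if w: "w \<in> W" for w
  proof -
    have m: "- f (g w) \<in> W" "f (g w) \<in> W" using w fV gW fs.subspace_neg[OF sW] by auto
    have "(f \<circ> g) (w + - f (g w)) + (f \<circ> g) (f (g w)) = (f \<circ> g) (w + - f (g w) + f (g w))"
      by (rule lin_mapsD(2)[OF fg(1), symmetric]) (use m w fs.subspace_diff[OF sW] in auto)
    then have "(f \<circ> g) (w + - f (g w)) = 0" using bspec[OF fg(3) w] by simp
    then have "w + - f (g w) \<in> L" using m w fs.subspace_diff[OF sW] by (simp add: L_def)
    then show ?thesis using L0 by simp
  qed
  show ?thesis by (rule that[OF f g(1,2) 1 2])
qed

section \<open>Class functions on symmetric groups\<close>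

text \<open>Forward powers suffice: for a permutation of finite support they run through the whole
  cycle, so lying in an orbit is a symmetric relation.\<close>

definition orb :: "('a \<Rightarrow> 'a) \<Rightarrow> 'a \<Rightarrow> 'a set" where
  "orb \<sigma> i = range (\<lambda>k. (\<sigma> ^^ k) i)"

lemma orb_refl [simp]: "i \<in> orb \<sigma> i"
  unfolding orb_def by (metis funpow_0 rangeI)

lemma orb_eq:
  assumes "permutation \<sigma>" "j \<in> orb \<sigma> i"
  shows "orb \<sigma> j = orb \<sigma> i"
proof -
  have "set (support \<sigma> j) \<inter> set (support \<sigma> i) \<noteq> {}"
    unfolding support_set[OF assms(1)] using assms(2) orb_refl[of j \<sigma>] by (auto simp: orb_def)
  then have "set (support \<sigma> j) = set (support \<sigma> i)"
    using disjoint_support[OF assms(1)] by (meson UNIV_I disjoint_def image_iff)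
  then show ?thesis unfolding support_set[OF assms(1)] orb_def .
qed

lemma card_orb:
  assumes "permutation \<sigma>"
  shows "card (orb \<sigma> i) = least_power \<sigma> i"
  using distinct_card[OF cycle_of_permutation[OF assms, of i]]
  unfolding support_set[OF assms] orb_def by simp

lemma orb_subset:
  assumes "\<sigma> permutes S"
  shows "i \<in> S \<Longrightarrow> orb \<sigma> i \<subseteq> S" and "i \<notin> S \<Longrightarrow> orb \<sigma> i = {i}"
proof -
  have "(\<sigma> ^^ k) permutes S" for k using assms by (rule permutes_funpow)
  note pw = permutes_in_image[OF this] permutes_not_in[OF this]
  show "orb \<sigma> i \<subseteq> S" if "i \<in> S" unfolding orb_def using pw(1) that by blast
  show "orb \<sigma> i = {i}" if "i \<notin> S" unfolding orb_def pw(2)[OF that] by simp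
qed

text \<open>Two powers agree at \<open>r\<close> exactly if the exponents are congruent modulo the
  length of the cycle, and that length depends only on the orbit as a set.\<close>

lemma funpow_eq_transfer:
  assumes "permutation \<sigma>" "permutation \<tau>" "orb \<sigma> r = orb \<tau> r" "(\<sigma> ^^ k) r = (\<sigma> ^^ l) r"
  shows "(\<tau> ^^ k) r = (\<tau> ^^ l) r"
proof -
  have lp: "least_power \<sigma> r = least_power \<tau> r"
    using assms(1-3) card_orb by metis
  have *: "(\<tau> ^^ k) r = (\<tau> ^^ l) r" if "k \<le> l" "(\<sigma> ^^ k) r = (\<sigma> ^^ l) r" for k l
  proof -
    have "(\<sigma> ^^ (l - k)) r = r"
      by (rule funpow_diff[OF _ that]) (use assms(1) in \<open>auto simp: permutation bij_is_inj\<close>)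
    then have "(\<tau> ^^ (l - k)) r = r"
      using least_power_dvd[OF assms(1)] least_power_dvd[OF assms(2)] lp by metis
    then show ?thesis using that(1) by (metis funpow_add le_add_diff_inverse o_apply)
  qed
  show ?thesis using *[of k l] *[of l k] assms(4) by (metis nle_le)
qed

text \<open>In each orbit a representative is fixed, and its \<open>k\<close>th iterate under
  \<open>\<sigma>\<close> is sent to its \<open>k\<close>th iterate under \<open>\<tau>\<close>.
  This maps each orbit onto itself and intertwines the two permutations, so cycle types need not be
  discussed.\<close>

lemma same_orbits_conjugate:
  assumes S: "finite S" and \<sigma>: "\<sigma> permutes S" and \<tau>: "\<tau> permutes S" and eq: "\<And>i. orb \<sigma> i = orb \<tau> i"
  obtains g where "g permutes S" "\<tau> = g \<circ> \<sigma> \<circ> inv g"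
proof -
  have p: "permutation \<sigma>" "permutation \<tau>" using S \<sigma> \<tau> permutation_permutes by blast+
  \<comment> \<open>The choice depends on the orbit only as a set, so all members of an orbit get
    the same representative.\<close>
  define rep where "rep = (\<lambda>i. SOME j. j \<in> orb \<sigma> i)"
  have rep: "rep i \<in> orb \<sigma> i" for i unfolding rep_def by (rule someI[of _ i]) simp
  have rep_eq: "rep j = rep i" if "j \<in> orb \<sigma> i" for i j
    unfolding rep_def orb_eq[OF p(1) that] ..
  define ind where "ind = (\<lambda>i. SOME k. (\<sigma> ^^ k) (rep i) = i)"
  have ind: "(\<sigma> ^^ (ind i)) (rep i) = i" for i
  proof -
    have "i \<in> orb \<sigma> (rep i)" using orb_eq[OF p(1) rep] by simp
    then have "\<exists>k. (\<sigma> ^^ k) (rep i) = i" unfolding orb_def by (metis rangeE)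
    then show ?thesis unfolding ind_def by (rule someI_ex)
  qed
  define g where "g = (\<lambda>i. (\<tau> ^^ (ind i)) (rep i))"
  have g_pow: "g ((\<sigma> ^^ k) i) = (\<tau> ^^ k) (rep i)" if i: "i = rep i" for i k
  proof -
    let ?j = "(\<sigma> ^^ k) i"
    have r: "rep ?j = rep i" by (rule rep_eq) (simp add: orb_def)
    \<comment> \<open>The chosen exponent may differ from \<open>k\<close>, but both give the same
      iterate of \<open>\<sigma>\<close> and hence the same iterate of
      \<open>\<tau>\<close>.\<close>
    have "(\<sigma> ^^ (ind ?j)) (rep i) = (\<sigma> ^^ k) (rep i)" using ind[of ?j] r i by simp
    then show ?thesis
      unfolding g_def r by (rule funpow_eq_transfer[OF p eq])
  qed
  have rep_rep: "rep (rep i) = rep i" for i using rep_eq[OF rep] .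
  have comm: "g (\<sigma> i) = \<tau> (g i)" for i
  proof -
    have "g (\<sigma> i) = g ((\<sigma> ^^ Suc (ind i)) (rep i))" using ind[of i] by simp
    also have "\<dots> = (\<tau> ^^ Suc (ind i)) (rep i)" using g_pow[of "rep i"] rep_rep by metis
    finally show ?thesis by (simp add: g_def)
  qed
  have g_orb: "g i \<in> orb \<sigma> i" for i
  proof -
    have "g i \<in> orb \<tau> (rep i)" by (simp add: g_def orb_def)
    then show ?thesis using orb_eq[OF p(1) rep] eq by metis
  qed
  have surj: "\<exists>i\<in>orb \<sigma> j. g i = j" for j
  proof -
    have "j \<in> orb \<tau> (rep j)" using orb_eq[OF p(1) rep] eq orb_refl by metis
    then obtain k where "j = (\<tau> ^^ k) (rep j)" by (auto simp: orb_def)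
    then have "g ((\<sigma> ^^ k) (rep j)) = j" using g_pow[of "rep j"] rep_rep by metis
    moreover have "(\<sigma> ^^ k) (rep j) \<in> orb \<sigma> j"
      using orb_eq[OF p(1) rep, of j] by (auto simp: orb_def)
    ultimately show ?thesis by blast
  qed
  have "g ` S = S"
  proof
    show "g ` S \<subseteq> S" using g_orb orb_subset(1)[OF \<sigma>] by blast
    show "S \<subseteq> g ` S" using surj orb_subset(1)[OF \<sigma>] by (metis image_eqI subsetD subsetI)
  qed
  then have "bij_betw g S S" using S by (simp add: bij_betw_def eq_card_imp_inj_on)
  moreover have "g i = i" if "i \<notin> S" for i using orb_subset(2)[OF \<sigma> that] g_orb[of i] by simp
  ultimately have g: "g permutes S" by (rule bij_imp_permutes)
  have "\<tau> \<circ> g = g \<circ> \<sigma>" using comm by auto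
  then have "\<tau> = g \<circ> \<sigma> \<circ> inv g" using permutes_inv_o(1)[OF g] by (metis comp_assoc comp_id)
  then show ?thesis using that[OF g] by simp
qed

lemma permute_list_fixed_iff:
  assumes "\<sigma> permutes {..<n}" "length xs = n"
  shows "permute_list \<sigma> xs = xs \<longleftrightarrow> (\<forall>i<n. xs ! \<sigma> i = xs ! i)"
  using assms by (auto simp: list_eq_iff_nth_eq permute_list_nth)

text \<open>The hypothesis sums \<open>d\<close> over the stabilizers of all rearrangements of a
  word. These are conjugate, so the sum over a single stabilizer vanishes as well. The induction is
  on the number of pairs of points in a common orbit of \<open>\<sigma>\<close>.\<close>

lemma class_function_zero:
  fixes d :: "(nat \<Rightarrow> nat) \<Rightarrow> 'k::field_char_0" and letter :: "nat \<Rightarrow> 'a"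
  assumes class_fn: "\<And>g \<sigma>. g permutes {..<n} \<Longrightarrow> \<sigma> permutes {..<n} \<Longrightarrow> d (g \<circ> \<sigma> \<circ> inv g) = d \<sigma>"
    and letter: "inj letter" "range letter \<subseteq> A"
    and zero: "\<And>ds. length ds = n \<Longrightarrow> set ds \<subseteq> A \<Longrightarrow>
      (\<Sum>\<sigma> | \<sigma> permutes {..<n}. d \<sigma> * of_nat (card {ds'. mset ds' = mset ds \<and> permute_list \<sigma> ds' = ds'})) = 0"
    and \<sigma>: "\<sigma> permutes {..<n}"
  shows "d \<sigma> = 0"
proof -
  let ?G = "{\<sigma>. \<sigma> permutes {..<n}}"
  have finG: "finite ?G" by (rule finite_permutations) simp
  have stab_zero: "(\<Sum>\<sigma> | \<sigma> permutes {..<n} \<and> permute_list \<sigma> ds = ds. d \<sigma>) = 0"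
    if ds: "length ds = n" "set ds \<subseteq> A" for ds :: "'a list"
  proof -
    let ?M = "{ds'. mset ds' = mset ds}"
    have "?M \<subseteq> {ds'. set ds' \<subseteq> set ds \<and> length ds' = length ds}"
      using mset_eq_setD mset_eq_length by blast
    then have finM: "finite ?M" by (rule finite_subset) (simp add: finite_lists_length_eq)
    \<comment> \<open>Conjugation by the rearrangement \<open>p\<close> is a bijection between the
      two stabilizers, and \<open>d\<close> is constant along it.\<close>
    have stab_eq: "(\<Sum>\<sigma> | \<sigma> permutes {..<n} \<and> permute_list \<sigma> ds' = ds'. d \<sigma>) =
        (\<Sum>\<sigma> | \<sigma> permutes {..<n} \<and> permute_list \<sigma> ds = ds. d \<sigma>)" if "ds' \<in> ?M" for ds'
    proof -
      have "mset ds' = mset ds" using that by simp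
      then obtain p where p: "p permutes {..<length ds}" "permute_list p ds = ds'"
        by (rule mset_eq_permutation)
      have pn: "p permutes {..<n}" using p ds by simp
      have ip: "inv p permutes {..<n}" using pn by (rule permutes_inv)
      have l': "length ds' = n" using p ds by auto
      have ds'': "permute_list (inv p) ds' = ds"
        using p ip pn permute_list_compose[of "inv p" ds p] permutes_inv_o(1)[OF pn] ds by simp
      show ?thesis
      proof (rule sum.reindex_bij_witness[where i="\<lambda>\<sigma>. inv p \<circ> \<sigma> \<circ> p" and j="\<lambda>\<sigma>. p \<circ> \<sigma> \<circ> inv p"])
        fix \<sigma> assume "\<sigma> \<in> {\<sigma>. \<sigma> permutes {..<n} \<and> permute_list \<sigma> ds' = ds'}"
        then have \<sigma>: "\<sigma> permutes {..<n}" "permute_list \<sigma> ds' = ds'" by auto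
        show "inv p \<circ> (p \<circ> \<sigma> \<circ> inv p) \<circ> p = \<sigma>"
          by (simp add: fun_eq_iff permutes_inverses[OF pn])
        have "p \<circ> \<sigma> permutes {..<n}" by (rule permutes_compose[OF \<sigma>(1) pn])
        then have "p \<circ> \<sigma> \<circ> inv p permutes {..<n}" by (rule permutes_compose[OF ip])
        moreover have "permute_list (p \<circ> \<sigma> \<circ> inv p) ds = ds"
          using permute_list_compose[of "inv p" ds "p \<circ> \<sigma>"] permute_list_compose[of \<sigma> ds p] ip \<sigma> ds p(2) ds''
          by simp
        ultimately show "p \<circ> \<sigma> \<circ> inv p \<in> {\<sigma>. \<sigma> permutes {..<n} \<and> permute_list \<sigma> ds = ds}" by simp
        show "d (p \<circ> \<sigma> \<circ> inv p) = d \<sigma>" by (rule class_fn[OF pn \<sigma>(1)])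
      next
        fix \<sigma> assume "\<sigma> \<in> {\<sigma>. \<sigma> permutes {..<n} \<and> permute_list \<sigma> ds = ds}"
        then have \<sigma>: "\<sigma> permutes {..<n}" "permute_list \<sigma> ds = ds" by auto
        show "p \<circ> (inv p \<circ> \<sigma> \<circ> p) \<circ> inv p = \<sigma>"
          by (simp add: fun_eq_iff permutes_inverses[OF pn])
        have "inv p \<circ> \<sigma> permutes {..<n}" by (rule permutes_compose[OF \<sigma>(1) ip])
        then have "inv p \<circ> \<sigma> \<circ> p permutes {..<n}" by (rule permutes_compose[OF pn])
        moreover have "permute_list (inv p \<circ> \<sigma> \<circ> p) ds' = ds'"
          using permute_list_compose[of p ds' "inv p \<circ> \<sigma>"] permute_list_compose[of \<sigma> ds' "inv p"] pn \<sigma> l' p(2) ds''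
          by simp
        ultimately show "inv p \<circ> \<sigma> \<circ> p \<in> {\<sigma>. \<sigma> permutes {..<n} \<and> permute_list \<sigma> ds' = ds'}" by simp
      qed
    qed
    have "0 = (\<Sum>\<sigma>\<in>?G. d \<sigma> * of_nat (card {ds'. mset ds' = mset ds \<and> permute_list \<sigma> ds' = ds'}))"
      using zero[OF ds] by simp
    also have "\<dots> = (\<Sum>\<sigma>\<in>?G. \<Sum>ds'\<in>?M. if permute_list \<sigma> ds' = ds' then d \<sigma> else 0)"
    proof (rule sum.cong)
      fix \<sigma>
      have "{ds'. mset ds' = mset ds \<and> permute_list \<sigma> ds' = ds'} = ?M \<inter> {ds'. permute_list \<sigma> ds' = ds'}" by auto
      then show "d \<sigma> * of_nat (card {ds'. mset ds' = mset ds \<and> permute_list \<sigma> ds' = ds'}) =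
          (\<Sum>ds'\<in>?M. if permute_list \<sigma> ds' = ds' then d \<sigma> else 0)"
        using sum.inter_restrict[OF finM, of "\<lambda>_. d \<sigma>" "{ds'. permute_list \<sigma> ds' = ds'}"] by (simp add: mult.commute)
    qed simp
    also have "\<dots> = (\<Sum>ds'\<in>?M. \<Sum>\<sigma>\<in>?G. if permute_list \<sigma> ds' = ds' then d \<sigma> else 0)"
      by (rule sum.swap)
    also have "\<dots> = (\<Sum>ds'\<in>?M. \<Sum>\<sigma> | \<sigma> permutes {..<n} \<and> permute_list \<sigma> ds' = ds'. d \<sigma>)"
    proof (rule sum.cong)
      fix ds'
      show "(\<Sum>\<sigma>\<in>?G. if permute_list \<sigma> ds' = ds' then d \<sigma> else 0) =
          (\<Sum>\<sigma> | \<sigma> permutes {..<n} \<and> permute_list \<sigma> ds' = ds'. d \<sigma>)"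
        using sum.inter_restrict[OF finG, of d "{\<sigma>. permute_list \<sigma> ds' = ds'}"]
        by (simp add: Collect_conj_eq[symmetric] Int_def)
    qed simp
    also have "\<dots> = (\<Sum>ds'\<in>?M. \<Sum>\<sigma> | \<sigma> permutes {..<n} \<and> permute_list \<sigma> ds = ds. d \<sigma>)"
      by (rule sum.cong[OF refl stab_eq])
    also have "\<dots> = of_nat (card ?M) * (\<Sum>\<sigma> | \<sigma> permutes {..<n} \<and> permute_list \<sigma> ds = ds. d \<sigma>)"
      by (rule sum_constant)
    finally have "of_nat (card ?M) * (\<Sum>\<sigma> | \<sigma> permutes {..<n} \<and> permute_list \<sigma> ds = ds. d \<sigma>) = 0"
      by (rule sym)
    moreover have "card ?M \<noteq> 0" using finM by (auto simp: card_eq_0_iff)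
    ultimately show ?thesis unfolding mult_eq_0_iff of_nat_eq_0_iff by blast
  qed
  \<comment> \<open>The orbit relation as a finite set of pairs: its inclusions compare orbits, and
    its cardinality is the measure of the induction.\<close>
  define R where "R = (\<lambda>\<sigma>. {(i, j). i < n \<and> j \<in> orb \<sigma> i})"
  have R_sub: "R \<sigma> \<subseteq> {..<n} \<times> {..<n}" if "\<sigma> permutes {..<n}" for \<sigma>
    unfolding R_def using orb_subset(1)[OF that] by auto
  show ?thesis using \<sigma>
  proof (induction \<sigma> rule: measure_induct_rule[of "\<lambda>\<sigma>. card (R \<sigma>)"])
    case (less \<sigma>)
    have per: "permutation \<sigma>" using less(2) permutation_permutes by blast
    \<comment> \<open>The least element names the orbit, so two places carry the same letter exactly
      if they lie in one orbit of \<open>\<sigma>\<close>.\<close>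
    define ds where "ds = map (\<lambda>i. letter (LEAST j. j \<in> orb \<sigma> i)) [0..<n]"
    have ds: "length ds = n" "set ds \<subseteq> A" using letter(2) by (auto simp: ds_def)
    have ds_eq: "ds ! i = ds ! j \<longleftrightarrow> i \<in> orb \<sigma> j" if "i < n" "j < n" for i j
    proof
      assume "ds ! i = ds ! j"
      then have "(LEAST j. j \<in> orb \<sigma> i) = (LEAST k. k \<in> orb \<sigma> j)"
        using that injD[OF letter(1)] by (simp add: ds_def)
      moreover have "(LEAST j. j \<in> orb \<sigma> i) \<in> orb \<sigma> i" "(LEAST k. k \<in> orb \<sigma> j) \<in> orb \<sigma> j"
        by (auto intro: LeastI orb_refl)
      ultimately have "orb \<sigma> i = orb \<sigma> j" using orb_eq[OF per] by metis
      then show "i \<in> orb \<sigma> j" using orb_refl by metis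
    next
      assume "i \<in> orb \<sigma> j"
      then show "ds ! i = ds ! j" using that orb_eq[OF per] by (simp add: ds_def)
    qed
    have stab: "permute_list \<tau> ds = ds \<longleftrightarrow> R \<tau> \<subseteq> R \<sigma>" if \<tau>: "\<tau> permutes {..<n}" for \<tau>
    proof
      assume "permute_list \<tau> ds = ds"
      then have f: "\<forall>i<n. ds ! \<tau> i = ds ! i" using permute_list_fixed_iff[OF \<tau> ds(1)] by simp
      have lt: "(\<tau> ^^ k) i < n" if "i < n" for k i
        using permutes_in_image[OF permutes_funpow[OF \<tau>, of k], of i] that by simp
      have "ds ! ((\<tau> ^^ k) i) = ds ! i" if "i < n" for k i
        by (induction k) (use f lt[OF that] that in auto)
      then show "R \<tau> \<subseteq> R \<sigma>"
        unfolding R_def using ds_eq lt by (auto simp: orb_def[of \<tau>])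
    next
      assume RR: "R \<tau> \<subseteq> R \<sigma>"
      have "ds ! \<tau> i = ds ! i" if "i < n" for i
      proof -
        have "\<tau> i \<in> orb \<tau> i" unfolding orb_def by (rule range_eqI[of _ _ 1]) simp
        then have "\<tau> i \<in> orb \<sigma> i" using RR that unfolding R_def by auto
        then show ?thesis using ds_eq that permutes_in_image[OF \<tau>, of i] by simp
      qed
      then show "permute_list \<tau> ds = ds" using permute_list_fixed_iff[OF \<tau> ds(1)] by simp
    qed
    let ?St = "{\<tau>. \<tau> permutes {..<n} \<and> permute_list \<tau> ds = ds}"
    let ?E = "{\<tau>. \<tau> permutes {..<n} \<and> R \<tau> = R \<sigma>}"
    have finR: "finite (R \<sigma>)" using R_sub[OF less(2)] by (rule finite_subset) simp
    have "(\<Sum>\<tau>\<in>?St. d \<tau>) = (\<Sum>\<tau>\<in>?E. d \<tau>)"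
    proof (rule sum.mono_neutral_right)
      show "finite ?St" using finG by (rule finite_subset[rotated]) auto
      show "?E \<subseteq> ?St" using stab by auto
      show "\<forall>\<tau>\<in>?St - ?E. d \<tau> = 0"
      proof
        fix \<tau> assume "\<tau> \<in> ?St - ?E"
        then have \<tau>: "\<tau> permutes {..<n}" "R \<tau> \<subset> R \<sigma>" using stab by auto
        show "d \<tau> = 0" by (rule less(1)[OF psubset_card_mono[OF finR \<tau>(2)] \<tau>(1)])
      qed
    qed
    also have "\<dots> = (\<Sum>\<tau>\<in>?E. d \<sigma>)"
    proof (rule sum.cong)
      fix \<tau> assume "\<tau> \<in> ?E"
      then have \<tau>: "\<tau> permutes {..<n}" and RR: "R \<tau> = R \<sigma>" by auto
      have "orb \<sigma> i = orb \<tau> i" for i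
      proof (cases "i < n")
        case True
        have "j \<in> orb \<sigma> i \<longleftrightarrow> (i, j) \<in> R \<sigma>" "j \<in> orb \<tau> i \<longleftrightarrow> (i, j) \<in> R \<tau>" for j
          using True by (auto simp: R_def)
        then show ?thesis using RR by auto
      next
        case False
        then show ?thesis using orb_subset(2)[OF less(2)] orb_subset(2)[OF \<tau>] by simp
      qed
      then obtain g where "g permutes {..<n}" "\<tau> = g \<circ> \<sigma> \<circ> inv g"
        using same_orbits_conjugate[of "{..<n}" \<sigma> \<tau>] less(2) \<tau> by auto
      then show "d \<tau> = d \<sigma>" using class_fn less(2) by simp
    qed (rule refl)
    also have "\<dots> = of_nat (card ?E) * d \<sigma>" by (rule sum_constant)
    finally have "of_nat (card ?E) * d \<sigma> = 0" unfolding stab_zero[OF ds] by (rule sym)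
    moreover have "card ?E \<noteq> 0"
    proof -
      have "finite ?E" using finG by (rule finite_subset[rotated]) auto
      then show ?thesis using less(2) by (auto simp: card_eq_0_iff)
    qed
    ultimately have "d \<sigma> = 0" by (metis mult_eq_0_iff of_nat_eq_0_iff)
    then show ?case .
  qed
qed

section \<open>Tensor powers of an object and 2-rig maps\<close>

locale rig =
  fixes C :: "('k::field, 'o, 'a) smlc"
  assumes two_rig: "two_rig C"
begin

lemma linear_category: "is_linear_category C"
  and symmetric_monoidal: "is_symmetric_monoidal C"
  using two_rig unfolding two_rig_def by auto

lemma category: "is_category C"
  using linear_category unfolding is_linear_category_def by (elim conjE) assumption

lemma linear_tensor: "has_linear_tensor C"
  using symmetric_monoidal unfolding is_symmetric_monoidal_def by (elim conjE) assumption

lemma ide_hom: "a \<in> obj C \<Longrightarrow> ide C a \<in> hom C a a"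
  using category unfolding is_category_def by blast

lemma cmp_ide:
  assumes "a \<in> obj C" "b \<in> obj C" "f \<in> hom C a b"
  shows "cmp C f (ide C a) = f" "cmp C (ide C b) f = f"
  using category assms unfolding is_category_def by blast+

lemma cmp_hom:
  assumes "a \<in> obj C" "b \<in> obj C" "c \<in> obj C" "f \<in> hom C a b" "g \<in> hom C b c"
  shows "cmp C g f \<in> hom C a c"
  using category assms unfolding is_category_def by blast

lemma cmp_assoc:
  assumes "a \<in> obj C" "b \<in> obj C" "c \<in> obj C" "d \<in> obj C"
    "f \<in> hom C a b" "g \<in> hom C b c" "h \<in> hom C c d"
  shows "cmp C h (cmp C g f) = cmp C (cmp C h g) f"
  using category assms unfolding is_category_def by blast

lemma ten_obj: "a \<in> obj C \<Longrightarrow> b \<in> obj C \<Longrightarrow> ten C a b \<in> obj C"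
  and tena_ide: "a \<in> obj C \<Longrightarrow> b \<in> obj C \<Longrightarrow> tena C (ide C a) (ide C b) = ide C (ten C a b)"
  and unit_obj: "unit C \<in> obj C"
  using linear_tensor unfolding has_linear_tensor_def by blast+

lemma tena_hom:
  assumes "a \<in> obj C" "a' \<in> obj C" "b \<in> obj C" "b' \<in> obj C" "f \<in> hom C a a'" "g \<in> hom C b b'"
  shows "tena C f g \<in> hom C (ten C a b) (ten C a' b')"
  using linear_tensor assms unfolding has_linear_tensor_def by blast

lemma interchange:
  assumes "a \<in> obj C" "a' \<in> obj C" "a'' \<in> obj C" "b \<in> obj C" "b' \<in> obj C" "b'' \<in> obj C"
    "f \<in> hom C a a'" "f' \<in> hom C a' a''" "g \<in> hom C b b'" "g' \<in> hom C b' b''"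
  shows "tena C (cmp C f' f) (cmp C g' g) = cmp C (tena C f' g') (tena C f g)"
  using linear_tensor assms unfolding has_linear_tensor_def by blast

lemma assoc_iso:
  assumes "a \<in> obj C" "b \<in> obj C" "c \<in> obj C"
  shows "iso_arrow C (ten C (ten C a b) c) (ten C a (ten C b c)) (assoc C a b c)"
  using symmetric_monoidal[unfolded is_symmetric_monoidal_def, THEN conjunct2, THEN conjunct1] assms by blast

lemma braid_hom: "a \<in> obj C \<Longrightarrow> b \<in> obj C \<Longrightarrow> braid C a b \<in> hom C (ten C a b) (ten C b a)"
  using symmetric_monoidal[unfolded is_symmetric_monoidal_def, THEN conjunct2, THEN conjunct2, THEN conjunct2, THEN conjunct1] by blast

lemma natural:
  assumes "a \<in> obj C" "a' \<in> obj C" "b \<in> obj C" "b' \<in> obj C" "c \<in> obj C" "c' \<in> obj C"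
    "f \<in> hom C a a'" "g \<in> hom C b b'" "h \<in> hom C c c'"
  shows "cmp C (assoc C a' b' c') (tena C (tena C f g) h) =
      cmp C (tena C f (tena C g h)) (assoc C a b c)"
    and "cmp C (braid C a' b') (tena C f g) = cmp C (tena C g f) (braid C a b)"
  using symmetric_monoidal[unfolded is_symmetric_monoidal_def, THEN conjunct2, THEN conjunct2, THEN conjunct2, THEN conjunct2, THEN conjunct1] assms by blast+

lemma iso_cmp:
  assumes o: "a \<in> obj C" "b \<in> obj C" "c \<in> obj C" and f: "iso_arrow C a b f" and g: "iso_arrow C b c g"
  shows "iso_arrow C a c (cmp C g f)"
proof -
  obtain f' where f': "f \<in> hom C a b" "f' \<in> hom C b a" "cmp C f' f = ide C a" "cmp C f f' = ide C b"
    using f unfolding iso_arrow_def by blast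
  obtain g' where g': "g \<in> hom C b c" "g' \<in> hom C c b" "cmp C g' g = ide C b" "cmp C g g' = ide C c"
    using g unfolding iso_arrow_def by blast
  have gf: "cmp C g f \<in> hom C a c" by (rule cmp_hom[OF o f'(1) g'(1)])
  have fg: "cmp C f' g' \<in> hom C c a" by (rule cmp_hom[OF o(3,2,1) g'(2) f'(2)])
  have "cmp C (cmp C f' g') (cmp C g f) = cmp C f' (cmp C g' (cmp C g f))"
    by (rule cmp_assoc[OF o(1,3,2,1) gf g'(2) f'(2), symmetric])
  also have "cmp C g' (cmp C g f) = f"
    using cmp_assoc[OF o(1,2,3,2) f'(1) g'(1,2)] g'(3) cmp_ide(2)[OF o(1,2) f'(1)] by simp
  finally have 1: "cmp C (cmp C f' g') (cmp C g f) = ide C a" using f' by simp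
  have "cmp C (cmp C g f) (cmp C f' g') = cmp C g (cmp C f (cmp C f' g'))"
    by (rule cmp_assoc[OF o(3,1,2,3) fg f'(1) g'(1), symmetric])
  also have "cmp C f (cmp C f' g') = g'"
    using cmp_assoc[OF o(3,2,1,2) g'(2) f'(2,1)] f'(4) cmp_ide(2)[OF o(3,2) g'(2)] by simp
  finally have 2: "cmp C (cmp C g f) (cmp C f' g') = ide C c" using g' by simp
  show ?thesis unfolding iso_arrow_def using gf fg 1 2 by blast
qed

lemma iso_tena:
  assumes o: "a \<in> obj C" "b \<in> obj C" "c \<in> obj C" "d \<in> obj C"
    and f: "iso_arrow C a b f" and g: "iso_arrow C c d g"
  shows "iso_arrow C (ten C a c) (ten C b d) (tena C f g)"
proof -
  obtain f' where f': "f \<in> hom C a b" "f' \<in> hom C b a" "cmp C f' f = ide C a" "cmp C f f' = ide C b"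
    using f unfolding iso_arrow_def by blast
  obtain g' where g': "g \<in> hom C c d" "g' \<in> hom C d c" "cmp C g' g = ide C c" "cmp C g g' = ide C d"
    using g unfolding iso_arrow_def by blast
  show ?thesis unfolding iso_arrow_def
    using tena_hom[OF o f'(1) g'(1)] tena_hom[OF o(2,1,4,3) f'(2) g'(2)]
      interchange[OF o(1,2,1,3,4,3) f'(1,2) g'(1,2)] interchange[OF o(2,1,2,4,3,4) f'(2,1) g'(2,1)]
      tena_ide o f' g' by metis
qed

end

primrec tpow :: "('k, 'o, 'a) smlc \<Rightarrow> 'o \<Rightarrow> nat \<Rightarrow> 'o" where
  "tpow C r 0 = unit C"
| "tpow C r (Suc n) = ten C r (tpow C r n)"

text \<open>An arrow \<open>f\<close> exchanging the first two factors of \<open>r \<otimes> (r \<otimes> c)\<close>; the equation avoids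
  the inverse of the associator.\<close>

definition is_swap :: "('k, 'o, 'a) smlc \<Rightarrow> 'o \<Rightarrow> 'o \<Rightarrow> 'a \<Rightarrow> bool" where
  "is_swap C r c f \<longleftrightarrow> f \<in> hom C (ten C r (ten C r c)) (ten C r (ten C r c)) \<and>
     cmp C f (assoc C r r c) = cmp C (assoc C r r c) (tena C (braid C r r) (ide C c))"

context rig
begin

lemma tpow_obj: "r \<in> obj C \<Longrightarrow> tpow C r n \<in> obj C"
  by (induction n) (auto simp: unit_obj ten_obj)

text \<open>The braiding of the first two factors, conjugated by the associator.\<close>

lemma swap_exists:
  assumes r: "r \<in> obj C" and c: "c \<in> obj C"
  obtains f where "is_swap C r c f"
proof -
  let ?a = "ten C (ten C r r) c" and ?b = "ten C r (ten C r c)"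
  have o: "?a \<in> obj C" "?b \<in> obj C" using r c ten_obj by auto
  obtain i where i: "assoc C r r c \<in> hom C ?a ?b" "i \<in> hom C ?b ?a" "cmp C i (assoc C r r c) = ide C ?a"
    using assoc_iso[OF r r c] unfolding iso_arrow_def by blast
  have t: "tena C (braid C r r) (ide C c) \<in> hom C ?a ?a"
    by (rule tena_hom) (use r c ten_obj braid_hom ide_hom in auto)
  let ?h = "cmp C (assoc C r r c) (tena C (braid C r r) (ide C c))"
  have h: "?h \<in> hom C ?a ?b" by (rule cmp_hom[OF o(1,1,2) t i(1)])
  have "cmp C (cmp C ?h i) (assoc C r r c) = ?h"
    using cmp_assoc[OF o(1,2,1,2) i(1,2) h] i(3) cmp_ide(1)[OF o h] by simp
  then have "is_swap C r c (cmp C ?h i)"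
    unfolding is_swap_def using cmp_hom[OF o(2,1,2) i(2) h] by simp
  then show ?thesis by (rule that)
qed

end

text \<open>\<open>assoc_all\<close> demands associativity without composability. It holds in the
  intended target, where composition is composition of functions, and lets long composites be
  rebracketed by rewriting. The object \<open>s\<close> is tied to the image of \<open>x\<close>
  only by the isomorphism \<open>u\<close>.\<close>

locale rig_map =
  fixes C :: "('k::field, 'o, 'a) smlc" and D :: "('k, 'p, 'b) smlc" and F and x and s and u
  assumes map: "two_rig_map C D F"
    and assoc_all: "\<And>f g h. cmp D h (cmp D g f) = cmp D (cmp D h g) f"
    and x: "x \<in> obj C" and s: "s \<in> obj D" and u: "iso_arrow D s (fo F x) u"
begin

sublocale C: rig C by standard (use map in \<open>simp add: two_rig_map_def\<close>)
sublocale D: rig D by standard (use map in \<open>simp add: two_rig_map_def\<close>)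

lemma linear_functor: "is_linear_functor C D F"
  using map unfolding two_rig_map_def by blast

lemma fo_obj: "a \<in> obj C \<Longrightarrow> fo F a \<in> obj D"
  and fa_ide: "a \<in> obj C \<Longrightarrow> fa F (ide C a) = ide D (fo F a)"
  using linear_functor unfolding is_linear_functor_def by blast+

lemma fa_hom: "a \<in> obj C \<Longrightarrow> b \<in> obj C \<Longrightarrow> f \<in> hom C a b \<Longrightarrow> fa F f \<in> hom D (fo F a) (fo F b)"
  using linear_functor unfolding is_linear_functor_def by blast

lemma fa_cmp:
  assumes "a \<in> obj C" "b \<in> obj C" "c \<in> obj C" "f \<in> hom C a b" "g \<in> hom C b c"
  shows "fa F (cmp C g f) = cmp D (fa F g) (fa F f)"
  using linear_functor assms unfolding is_linear_functor_def by blast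

lemma fa_add:
  assumes "a \<in> obj C" "b \<in> obj C" "f \<in> hom C a b" "g \<in> hom C a b"
  shows "fa F (add C f g) = add D (fa F f) (fa F g)"
  using linear_functor assms unfolding is_linear_functor_def by blast

lemma fa_scl:
  assumes "a \<in> obj C" "b \<in> obj C" "f \<in> hom C a b"
  shows "fa F (scl C c f) = scl D c (fa F f)"
  using linear_functor assms unfolding is_linear_functor_def by blast

lemma mu_iso:
  assumes "a \<in> obj C" "b \<in> obj C"
  shows "iso_arrow D (ten D (fo F a) (fo F b)) (fo F (ten C a b)) (mu F a b)"
  using map assms unfolding two_rig_map_def by blast

lemma mu_natural:
  assumes "a \<in> obj C" "a' \<in> obj C" "b \<in> obj C" "b' \<in> obj C" "f \<in> hom C a a'" "g \<in> hom C b b'"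
  shows "cmp D (mu F a' b') (tena D (fa F f) (fa F g)) = cmp D (fa F (tena C f g)) (mu F a b)"
  using map assms unfolding two_rig_map_def by blast

lemma mu_assoc:
  assumes "a \<in> obj C" "b \<in> obj C" "c \<in> obj C"
  shows "cmp D (fa F (assoc C a b c))
      (cmp D (mu F (ten C a b) c) (tena D (mu F a b) (ide D (fo F c)))) =
    cmp D (mu F a (ten C b c))
      (cmp D (tena D (ide D (fo F a)) (mu F b c)) (assoc D (fo F a) (fo F b) (fo F c)))"
  using map assms unfolding two_rig_map_def by blast

lemma mu_braid:
  assumes "a \<in> obj C" "b \<in> obj C"
  shows "cmp D (fa F (braid C a b)) (mu F a b) = cmp D (mu F b a) (braid D (fo F a) (fo F b))"
  using map assms unfolding two_rig_map_def by blast

text \<open>Follows the right-nested bracketing of \<open>tpow\<close>; its source is a power of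
  \<open>s\<close> and its target the image of the same power of \<open>x\<close>.\<close>

primrec power_iso :: "nat \<Rightarrow> 'b" where
  "power_iso 0 = eps F"
| "power_iso (Suc n) = cmp D (mu F x (tpow C x n)) (tena D u (power_iso n))"

lemma power_iso_iso: "iso_arrow D (tpow D s n) (fo F (tpow C x n)) (power_iso n)"
proof (induction n)
  case 0
  then show ?case using map unfolding two_rig_map_def by simp
next
  case (Suc n)
  note o = C.tpow_obj[OF x, of n] D.tpow_obj[OF s, of n]
  have t: "iso_arrow D (ten D s (tpow D s n)) (ten D (fo F x) (fo F (tpow C x n))) (tena D u (power_iso n))"
    by (rule D.iso_tena[OF s fo_obj[OF x] o(2) fo_obj[OF o(1)] u Suc])
  show ?case unfolding tpow.simps power_iso.simps
    by (rule D.iso_cmp[OF _ _ _ t mu_iso[OF x o(1)]])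
      (use o s x in \<open>auto intro: D.ten_obj C.ten_obj fo_obj\<close>)
qed

text \<open>Says that \<open>g\<close> is the conjugate of \<open>F f\<close> by
  \<open>power_iso n\<close>; the square avoids naming an inverse.\<close>

definition transports :: "nat \<Rightarrow> 'a \<Rightarrow> 'b \<Rightarrow> bool" where
  "transports n f g \<longleftrightarrow> f \<in> hom C (tpow C x n) (tpow C x n) \<and> g \<in> hom D (tpow D s n) (tpow D s n) \<and>
     cmp D (fa F f) (power_iso n) = cmp D (power_iso n) g"

lemma power_iso_hom: "power_iso n \<in> hom D (tpow D s n) (fo F (tpow C x n))"
  using power_iso_iso unfolding iso_arrow_def by blast

lemma u_hom: "u \<in> hom D s (fo F x)"
  using u unfolding iso_arrow_def by blast

lemma mu_hom: "a \<in> obj C \<Longrightarrow> b \<in> obj C \<Longrightarrow> mu F a b \<in> hom D (ten D (fo F a) (fo F b)) (fo F (ten C a b))"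
  using mu_iso unfolding iso_arrow_def by blast

lemma transports_ide: "transports n (ide C (tpow C x n)) (ide D (tpow D s n))"
  using D.cmp_ide[OF D.tpow_obj[OF s] fo_obj[OF C.tpow_obj[OF x]] power_iso_hom]
  unfolding transports_def
  by (simp add: C.ide_hom[OF C.tpow_obj[OF x]] D.ide_hom[OF D.tpow_obj[OF s]] fa_ide[OF C.tpow_obj[OF x]])

lemma transports_cmp:
  assumes "transports n f g" "transports n f' g'"
  shows "transports n (cmp C f' f) (cmp D g' g)"
proof -
  note o = C.tpow_obj[OF x, of n] D.tpow_obj[OF s, of n]
  have h: "f \<in> hom C (tpow C x n) (tpow C x n)" "g \<in> hom D (tpow D s n) (tpow D s n)"
    "f' \<in> hom C (tpow C x n) (tpow C x n)" "g' \<in> hom D (tpow D s n) (tpow D s n)"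
    and e: "cmp D (fa F f) (power_iso n) = cmp D (power_iso n) g"
    "cmp D (fa F f') (power_iso n) = cmp D (power_iso n) g'"
    using assms unfolding transports_def by auto
  have "cmp D (fa F (cmp C f' f)) (power_iso n) = cmp D (fa F f') (cmp D (fa F f) (power_iso n))"
    using fa_cmp[OF o(1,1,1) h(1,3)] assoc_all by simp
  also have "\<dots> = cmp D (cmp D (fa F f') (power_iso n)) g" unfolding e(1) by (rule assoc_all)
  also have "\<dots> = cmp D (power_iso n) (cmp D g' g)" unfolding e(2) by (rule assoc_all[symmetric])
  finally show ?thesis unfolding transports_def
    using C.cmp_hom[OF o(1,1,1) h(1,3)] D.cmp_hom[OF o(2,2,2) h(2,4)] by blast
qed

text \<open>Naturality moves \<open>F\<close> of the tensor product through \<open>mu\<close> onto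
  the separate factors, and the interchange law then applies the hypothesis in the second
  factor.\<close>

lemma transports_tena:
  assumes "transports n f g"
  shows "transports (Suc n) (tena C (ide C x) f) (tena D (ide D s) g)"
proof -
  let ?T = "tpow C x n" and ?S = "tpow D s n"
  note o = C.tpow_obj[OF x, of n] D.tpow_obj[OF s, of n]
  note Fo = fo_obj[OF o(1)] fo_obj[OF x]
  have h: "f \<in> hom C ?T ?T" "g \<in> hom D ?S ?S"
    and e: "cmp D (fa F f) (power_iso n) = cmp D (power_iso n) g"
    using assms unfolding transports_def by auto
  have "cmp D (fa F (tena C (ide C x) f)) (power_iso (Suc n)) =
      cmp D (cmp D (fa F (tena C (ide C x) f)) (mu F x ?T)) (tena D u (power_iso n))"
    by (simp add: assoc_all)
  also have "\<dots> = cmp D (mu F x ?T) (cmp D (tena D (ide D (fo F x)) (fa F f)) (tena D u (power_iso n)))"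
    using mu_natural[OF x x o(1,1) C.ide_hom[OF x] h(1)] fa_ide[OF x] by (simp add: assoc_all)
  also have "cmp D (tena D (ide D (fo F x)) (fa F f)) (tena D u (power_iso n)) =
      tena D (cmp D (ide D (fo F x)) u) (cmp D (fa F f) (power_iso n))"
    by (rule D.interchange[OF s Fo(2,2) o(2) Fo(1,1) u_hom D.ide_hom[OF Fo(2)] power_iso_hom
          fa_hom[OF o(1,1) h(1)], symmetric])
  also have "\<dots> = tena D (cmp D u (ide D s)) (cmp D (power_iso n) g)"
    unfolding e using D.cmp_ide[OF s Fo(2) u_hom] by simp
  also have "\<dots> = cmp D (tena D u (power_iso n)) (tena D (ide D s) g)"
    by (rule D.interchange[OF s s Fo(2) o(2,2) Fo(1) D.ide_hom[OF s] u_hom h(2) power_iso_hom])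
  finally have "cmp D (fa F (tena C (ide C x) f)) (power_iso (Suc n)) =
      cmp D (power_iso (Suc n)) (tena D (ide D s) g)"
    by (simp add: assoc_all)
  then show ?thesis unfolding transports_def
    using C.tena_hom[OF x x o(1,1) C.ide_hom[OF x] h(1)] D.tena_hom[OF s s o(2,2) D.ide_hom[OF s] h(2)]
    by simp
qed

text \<open>A swap is known only after composition with the associator, where it becomes a braiding.
  So the square is first proved behind the associator of the \<open>s\<close> side, using
  compatibility of \<open>mu\<close> with associators and braidings, and the associator is then
  cancelled by an inverse.\<close>

lemma transports_swap:
  assumes f: "is_swap C x (tpow C x n) f" and g: "is_swap D s (tpow D s n) g"
  shows "transports (Suc (Suc n)) f g"
proof -
  let ?T = "tpow C x n" and ?S = "tpow D s n" and ?X = "fo F x" and ?\<kappa> = "power_iso n"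
  let ?FT = "fo F ?T" and ?I = "ide D (fo F ?T)"
  let ?\<alpha> = "assoc C x x ?T" and ?\<beta> = "tena C (braid C x x) (ide C ?T)"
  let ?\<alpha>' = "assoc D s s ?S" and ?\<beta>' = "tena D (braid D s s) (ide D ?S)"
  let ?uu = "tena D u u"
  note T = C.tpow_obj[OF x, of n] and S = D.tpow_obj[OF s, of n]
  note X = fo_obj[OF x] and FT = fo_obj[OF T]
  note xx = C.ten_obj[OF x x] and xT = C.ten_obj[OF x T]
  note XX = D.ten_obj[OF X X] and ss = D.ten_obj[OF s s]
  have fh: "f \<in> hom C (ten C x (ten C x ?T)) (ten C x (ten C x ?T))"
    and fe: "cmp C f ?\<alpha> = cmp C ?\<alpha> ?\<beta>" using f unfolding is_swap_def by auto
  have gh: "g \<in> hom D (ten D s (ten D s ?S)) (ten D s (ten D s ?S))"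
    and ge: "cmp D g ?\<alpha>' = cmp D ?\<alpha>' ?\<beta>'" using g unfolding is_swap_def by auto
  note k = power_iso_hom[of n]
  have uu: "?uu \<in> hom D (ten D s s) (ten D ?X ?X)" by (rule D.tena_hom[OF s X s X u_hom u_hom])
  have uk: "tena D u ?\<kappa> \<in> hom D (ten D s ?S) (ten D ?X ?FT)" by (rule D.tena_hom[OF s X S FT u_hom k])
  have muxx: "mu F x x \<in> hom D (ten D ?X ?X) (fo F (ten C x x))" by (rule mu_hom[OF x x])
  have bx: "braid C x x \<in> hom C (ten C x x) (ten C x x)" by (rule C.braid_hom[OF x x])
  have \<alpha>: "?\<alpha> \<in> hom C (ten C (ten C x x) ?T) (ten C x (ten C x ?T))"
    using C.assoc_iso[OF x x T] unfolding iso_arrow_def by blast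
  have \<beta>: "?\<beta> \<in> hom C (ten C (ten C x x) ?T) (ten C (ten C x x) ?T)"
    by (rule C.tena_hom[OF xx xx T T bx C.ide_hom[OF T]])
  have E1: "tena D u (cmp D (mu F x ?T) (tena D u ?\<kappa>)) =
      cmp D (tena D (ide D ?X) (mu F x ?T)) (tena D u (tena D u ?\<kappa>))"
    using D.interchange[OF s X X D.ten_obj[OF s S] D.ten_obj[OF X FT] fo_obj[OF xT] u_hom
        D.ide_hom[OF X] uk mu_hom[OF x T]] D.cmp_ide(2)[OF s X u_hom] by simp
  \<comment> \<open>The comparison arrow for the left-nested bracketing of the same factors.\<close>
  define R where "R = cmp D (mu F (ten C x x) ?T) (cmp D (tena D (mu F x x) ?I) (tena D ?uu ?\<kappa>))"
  have E4: "cmp D (power_iso (Suc (Suc n))) ?\<alpha>' = cmp D (fa F ?\<alpha>) R"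
  proof -
    have "cmp D (power_iso (Suc (Suc n))) ?\<alpha>' =
        cmp D (mu F x (ten C x ?T)) (cmp D (tena D (ide D ?X) (mu F x ?T))
          (cmp D (tena D u (tena D u ?\<kappa>)) ?\<alpha>'))"
      by (simp add: E1 assoc_all)
    also have "cmp D (tena D u (tena D u ?\<kappa>)) ?\<alpha>' = cmp D (assoc D ?X ?X ?FT) (tena D ?uu ?\<kappa>)"
      by (rule D.natural(1)[OF s X s X S FT u_hom u_hom k, symmetric])
    also have "cmp D (mu F x (ten C x ?T)) (cmp D (tena D (ide D ?X) (mu F x ?T))
          (cmp D (assoc D ?X ?X ?FT) (tena D ?uu ?\<kappa>))) =
        cmp D (cmp D (mu F x (ten C x ?T)) (cmp D (tena D (ide D ?X) (mu F x ?T))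
          (assoc D ?X ?X ?FT))) (tena D ?uu ?\<kappa>)"
      by (simp add: assoc_all)
    also have "\<dots> = cmp D (fa F ?\<alpha>) R"
      unfolding mu_assoc[OF x x T, symmetric] R_def by (simp add: assoc_all)
    finally show ?thesis .
  qed
  have E5: "cmp D (fa F ?\<beta>) R = cmp D R ?\<beta>'"
  proof -
    have bX: "braid D ?X ?X \<in> hom D (ten D ?X ?X) (ten D ?X ?X)" by (rule D.braid_hom[OF X X])
    have bs: "braid D s s \<in> hom D (ten D s s) (ten D s s)" by (rule D.braid_hom[OF s s])
    note Fxx = fo_obj[OF xx] and Fb = fa_hom[OF xx xx bx]
    note I = D.ide_hom[OF FT]
    have I2: "cmp D ?I ?I = ?I" by (rule D.cmp_ide[OF FT FT I])
    have "cmp D (fa F ?\<beta>) R = cmp D (cmp D (fa F ?\<beta>) (mu F (ten C x x) ?T))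
        (cmp D (tena D (mu F x x) ?I) (tena D ?uu ?\<kappa>))"
      unfolding R_def by (simp add: assoc_all)
    also have "\<dots> = cmp D (mu F (ten C x x) ?T)
        (cmp D (cmp D (tena D (fa F (braid C x x)) ?I) (tena D (mu F x x) ?I)) (tena D ?uu ?\<kappa>))"
      using mu_natural[OF xx xx T T bx C.ide_hom[OF T]] fa_ide[OF T] by (simp add: assoc_all)
    also have "cmp D (tena D (fa F (braid C x x)) ?I) (tena D (mu F x x) ?I) =
        tena D (cmp D (fa F (braid C x x)) (mu F x x)) (cmp D ?I ?I)"
      by (rule D.interchange[OF XX Fxx Fxx FT FT FT muxx Fb I I, symmetric])
    also have "\<dots> = tena D (cmp D (mu F x x) (braid D ?X ?X)) (cmp D ?I ?I)"
      unfolding mu_braid[OF x x] ..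
    also have "\<dots> = cmp D (tena D (mu F x x) ?I) (tena D (braid D ?X ?X) ?I)"
      by (rule D.interchange[OF XX XX Fxx FT FT FT bX muxx I I])
    also have "cmp D (cmp D (tena D (mu F x x) ?I) (tena D (braid D ?X ?X) ?I)) (tena D ?uu ?\<kappa>) =
        cmp D (tena D (mu F x x) ?I) (cmp D (tena D (braid D ?X ?X) ?I) (tena D ?uu ?\<kappa>))"
      by (simp add: assoc_all)
    also have "cmp D (tena D (braid D ?X ?X) ?I) (tena D ?uu ?\<kappa>) =
        tena D (cmp D (braid D ?X ?X) ?uu) (cmp D ?I ?\<kappa>)"
      by (rule D.interchange[OF ss XX XX S FT FT uu bX k I, symmetric])
    also have "\<dots> = tena D (cmp D ?uu (braid D s s)) (cmp D ?\<kappa> (ide D ?S))"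
      using D.natural(2)[OF s X s X S FT u_hom u_hom k] D.cmp_ide[OF S FT k] by simp
    also have "\<dots> = cmp D (tena D ?uu ?\<kappa>) ?\<beta>'"
      by (rule D.interchange[OF ss ss XX S S FT bs uu D.ide_hom[OF S] k])
    finally show ?thesis unfolding R_def by (simp add: assoc_all)
  qed
  have key: "cmp D (cmp D (fa F f) (power_iso (Suc (Suc n)))) ?\<alpha>' =
      cmp D (cmp D (power_iso (Suc (Suc n))) g) ?\<alpha>'"
  proof -
    note o3 = C.ten_obj[OF xx T] C.ten_obj[OF x xT]
    have "cmp D (cmp D (fa F f) (power_iso (Suc (Suc n)))) ?\<alpha>' = cmp D (cmp D (fa F f) (fa F ?\<alpha>)) R"
      using E4 by (simp only: assoc_all[symmetric])
    also have "cmp D (fa F f) (fa F ?\<alpha>) = cmp D (fa F ?\<alpha>) (fa F ?\<beta>)"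
      using fa_cmp[OF o3(1,2,2) \<alpha> fh] fa_cmp[OF o3(1,1,2) \<beta> \<alpha>] fe by simp
    also have "cmp D (cmp D (fa F ?\<alpha>) (fa F ?\<beta>)) R = cmp D (cmp D (fa F ?\<alpha>) R) ?\<beta>'"
      using E5 by (simp only: assoc_all[symmetric])
    also have "\<dots> = cmp D (cmp D (power_iso (Suc (Suc n))) g) ?\<alpha>'"
      unfolding E4[symmetric] using ge by (simp only: assoc_all[symmetric])
    finally show ?thesis .
  qed
  obtain i where i: "cmp D ?\<alpha>' i = ide D (ten D s (ten D s ?S))"
    using D.assoc_iso[OF s s S] unfolding iso_arrow_def by blast
  note k2 = power_iso_hom[of "Suc (Suc n)", simplified tpow.simps]
  have o4: "ten D s (ten D s ?S) \<in> obj D" "fo F (ten C x (ten C x ?T)) \<in> obj D"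
    using s S x T D.ten_obj C.ten_obj fo_obj by auto
  have c: "cmp D (fa F f) (power_iso (Suc (Suc n))) \<in> hom D (ten D s (ten D s ?S)) (fo F (ten C x (ten C x ?T)))"
    by (rule D.cmp_hom[OF o4(1,2,2) k2]) (use fh C.ten_obj x T fa_hom in auto)
  have c': "cmp D (power_iso (Suc (Suc n))) g \<in> hom D (ten D s (ten D s ?S)) (fo F (ten C x (ten C x ?T)))"
    by (rule D.cmp_hom[OF o4(1,1,2) gh k2])
  have "cmp D (fa F f) (power_iso (Suc (Suc n))) =
      cmp D (cmp D (cmp D (fa F f) (power_iso (Suc (Suc n)))) ?\<alpha>') i"
    using D.cmp_ide(1)[OF o4 c] i by (simp only: assoc_all[symmetric])
  also have "\<dots> = cmp D (power_iso (Suc (Suc n))) g"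
    unfolding key using D.cmp_ide(1)[OF o4 c'] i by (simp only: assoc_all[symmetric])
  finally show ?thesis unfolding transports_def using fh gh by simp
qed

end

section \<open>Convolution powers and words\<close>

definition ev :: "'i \<Rightarrow> 'i \<Rightarrow> 'k::field" where
  "ev i = (\<lambda>j. if j = i then 1 else 0)"

text \<open>Covers the units and the generators of both categories: \<open>Q\<close> is neutrality,
  having one element, or having weight one.\<close>

definition lines :: "('d \<Rightarrow> bool) \<Rightarrow> 'd \<Rightarrow> ('d, 'k::field) vec set" where
  "lines Q x = (if Q x then line else {0})"

lemma line_ev: "line = fs.span {ev Pt}"
  unfolding line_def ev_def ..

lemma lines_span: "lines Q x = fs.span (if Q x then {ev Pt} else {})"
  by (simp add: lines_def line_ev)

lemma ev_Ten: "ev (Ten a i b j) = pure a (ev i) b (ev j)"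
  by (auto simp: ev_def pure_def fun_eq_iff split: ix.split)

lemma pure_linear:
  "pure a (v + v') b w = pure a v b w + pure a v' b w"
  "pure a (fscale c v) b w = fscale c (pure a v b w)"
  "pure a v b (w + w') = pure a v b w + pure a v b w'"
  "pure a v b (fscale c w) = fscale c (pure a v b w)"
  "pure a 0 b w = 0" "pure a v b 0 = 0"
  by (auto simp: pure_def fscale_def fun_eq_iff algebra_simps split: ix.split)

lemma conv_sp_subspace: "fs.subspace (conv_sp P V W x)"
  unfolding conv_sp_def by simp

lemma pure_in_conv_sp:
  "(a, b) \<in> decomp P x \<Longrightarrow> v \<in> V a \<Longrightarrow> w \<in> W b \<Longrightarrow> pure a v b w \<in> conv_sp P V W x"
  unfolding conv_sp_def by (rule fs.span_base) blast

text \<open>By bilinearity of \<open>pure\<close>, spanning sets of the factors suffice.\<close>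

lemma conv_sp_span:
  assumes V: "\<And>a. V a = fs.span (SV a)" and W: "\<And>b. W b = fs.span (SW b)"
  shows "conv_sp P V W x = fs.span {pure a v b w | a b v w. (a, b) \<in> decomp P x \<and> v \<in> SV a \<and> w \<in> SW b}"
    (is "_ = fs.span ?R")
proof
  have "pure a v b w \<in> fs.span ?R" if ab: "(a, b) \<in> decomp P x" and v: "v \<in> V a" and w: "w \<in> W b" for a b v w
    using v unfolding V
  proof (induction rule: fs.span_induct_alt)
    case base
    show ?case unfolding pure_linear by (rule fs.span_zero)
  next
    case (step c v' v)
    have "pure a v' b w \<in> fs.span ?R"
      using w unfolding W
    proof (induction rule: fs.span_induct_alt)
      case base
      show ?case unfolding pure_linear by (rule fs.span_zero)
    next
      case (step d w' w)
      have "pure a v' b w' \<in> ?R" using \<open>v' \<in> SV a\<close> \<open>w' \<in> SW b\<close> ab by blast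
      from fs.span_add[OF fs.span_scale[OF fs.span_base[OF this]] \<open>pure a v' b w \<in> fs.span ?R\<close>]
      show ?case unfolding pure_linear .
    qed
    then show ?case using step unfolding pure_linear by (intro fs.span_add fs.span_scale)
  qed
  then show "conv_sp P V W x \<subseteq> fs.span ?R"
    unfolding conv_sp_def by (intro fs.span_minimal) auto
  show "fs.span ?R \<subseteq> conv_sp P V W x"
    unfolding conv_sp_def using V W fs.span_base by (intro fs.span_mono) blast
qed

section \<open>Words, and the vectors they index in a tensor power\<close>

definition joins :: "'d pcm \<Rightarrow> 'd list \<Rightarrow> 'd" where
  "joins P ds = foldr (join P) ds (neutral P)"

text \<open>For finite sets this means that the letters are pairwise disjoint; for sequences it is
  no condition.\<close>

fun compats :: "'d pcm \<Rightarrow> 'd list \<Rightarrow> bool" where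
  "compats P [] \<longleftrightarrow> True"
| "compats P (d # ds) \<longleftrightarrow> compatible P d (joins P ds) \<and> compats P ds"

text \<open>The coordinate of the power that belongs to a word. The label of each second factor is
  the join of the letters still to come, as convolution prescribes.\<close>

fun wd :: "'d pcm \<Rightarrow> 'd list \<Rightarrow> 'd ix" where
  "wd P [] = Pt"
| "wd P (d # ds) = Ten d Pt (joins P ds) (wd P ds)"

definition words :: "'d pcm \<Rightarrow> ('d \<Rightarrow> bool) \<Rightarrow> nat \<Rightarrow> 'd \<Rightarrow> 'd list set" where
  "words P Q n x = {ds. length ds = n \<and> (\<forall>d\<in>set ds. Q d) \<and> compats P ds \<and> joins P ds = x}"

primrec powsp :: "'d pcm \<Rightarrow> ('d \<Rightarrow> bool) \<Rightarrow> nat \<Rightarrow> 'd \<Rightarrow> ('d, 'k::field) vec set" where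
  "powsp P Q 0 = lines (\<lambda>x. x = neutral P)"
| "powsp P Q (Suc n) = conv_sp P (lines Q) (powsp P Q n)"

lemma joins_simps [simp]: "joins P [] = neutral P" "joins P (d # ds) = join P d (joins P ds)"
  by (simp_all add: joins_def)

lemma wd_inject: "wd P ds = wd P ds' \<longleftrightarrow> ds = ds'"
proof (induction ds arbitrary: ds')
  case Nil
  then show ?case by (cases ds') auto
next
  case (Cons d ds)
  then show ?case by (cases ds') auto
qed

lemma words_0: "words P Q 0 x = (if x = neutral P then {[]} else {})"
  by (auto simp: words_def)

lemma words_Suc: "words P Q (Suc n) x =
    {d # ds | d ds. Q d \<and> ds \<in> words P Q n (joins P ds) \<and> (d, joins P ds) \<in> decomp P x}"
  by (auto simp: words_def decomp_def length_Suc_conv)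

text \<open>The tensor of two coordinate vectors is again a coordinate vector, so convolving with a
  line at each letter prepends that letter to the words.\<close>

lemma powsp_span:
  fixes P :: "'d pcm"
  shows "(powsp P Q n x :: ('d, 'k::field) vec set) = fs.span ((\<lambda>ds. ev (wd P ds)) ` words P Q n x)"
proof (induction n arbitrary: x)
  case 0
  then show ?case by (simp add: words_0 lines_span)
next
  case (Suc n)
  have "{pure a v b w | a b v w. (a, b) \<in> decomp P x \<and> v \<in> (if Q a then {ev Pt} else {}) \<and>
      w \<in> (\<lambda>ds. ev (wd P ds)) ` words P Q n b} =
      ((\<lambda>ds. ev (wd P ds)) ` words P Q (Suc n) x :: ('d, 'k) vec set)"
    unfolding words_Suc
  proof (intro set_eqI iffI)
    fix t :: "('d, 'k) vec" assume "t \<in> {pure a v b w | a b v w. (a, b) \<in> decomp P x \<and> v \<in> (if Q a then {ev Pt} else {}) \<and>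
      w \<in> (\<lambda>ds. ev (wd P ds)) ` words P Q n b}"
    then obtain a b ds where "t = pure a (ev Pt) b (ev (wd P ds))" "(a, b) \<in> decomp P x" "Q a" "ds \<in> words P Q n b"
      by (auto split: if_splits)
    moreover have "b = joins P ds" using calculation by (simp add: words_def)
    ultimately show "t \<in> (\<lambda>ds. ev (wd P ds)) ` {d # ds | d ds. Q d \<and> ds \<in> words P Q n (joins P ds) \<and> (d, joins P ds) \<in> decomp P x}"
      by (intro image_eqI[of _ _ "a # ds"]) (auto simp: ev_Ten)
  next
    fix t :: "('d, 'k) vec"
    assume "t \<in> (\<lambda>ds. ev (wd P ds)) ` {d # ds | d ds. Q d \<and> ds \<in> words P Q n (joins P ds) \<and> (d, joins P ds) \<in> decomp P x}"
    then obtain d ds where "t = ev (wd P (d # ds))" "Q d" "ds \<in> words P Q n (joins P ds)" "(d, joins P ds) \<in> decomp P x"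
      by auto
    then show "t \<in> {pure a v b w | a b v w. (a, b) \<in> decomp P x \<and> v \<in> (if Q a then {ev Pt} else {}) \<and>
      w \<in> (\<lambda>ds. ev (wd P ds)) ` words P Q n b}"
      by (force simp: ev_Ten)
  qed
  then show ?case
    unfolding powsp.simps conv_sp_span[of "lines Q" _ "powsp P Q n", OF lines_span Suc] by (rule arg_cong)
qed

lemma ev_word_in_powsp: "ds \<in> words P Q n x \<Longrightarrow> ev (wd P ds) \<in> powsp P Q n x"
  unfolding powsp_span by (rule fs.span_base) blast

text \<open>With one coordinate fixed, a pure tensor is a multiple of \<open>v\<close> or of
  \<open>w\<close>, so homogeneity at these vectors evaluates \<open>tensor_map\<close>. The values
  at zero take care of the other labels.\<close>

lemma conv_map_pure:
  assumes "\<And>c. f a (fscale c v) = fscale c (f a v)" "\<And>c. g b (fscale c w) = fscale c (g b w)"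
    "\<And>a. f a 0 = 0" "\<And>b. g b 0 = 0"
  shows "conv_map f g (pure a v b w) = pure a (f a v) b (g b w)"
proof
  fix l show "conv_map f g (pure a v b w) l = pure a (f a v) b (g b w) l"
  proof (cases l)
    case Pt
    then show ?thesis by (simp add: conv_map_def pure_def)
  next
    case (Ten a' i b' j)
    show ?thesis
    proof (cases "a' = a \<and> b' = b")
      case True
      have "(\<lambda>i'. v i' * w j') = fscale (w j') v" for j' by (auto simp: fscale_def)
      then have "f a (\<lambda>i'. v i' * w j') i = f a v i * w j'" for j'
        using assms(1)[of "w j'"] by (simp add: fscale_def mult.commute[of _ "w j'"])
      moreover have "(\<lambda>j'. f a v i * w j') = fscale (f a v i) w" by (simp add: fscale_def)
      ultimately show ?thesis
        using Ten True assms(2) by (simp add: conv_map_def tensor_map_def pure_def fscale_def)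
    next
      case False
      then have "(\<lambda>i' j'. pure a v b w (Ten a' i' b' j')) = (\<lambda>i' j'. 0)" by (auto simp: pure_def)
      then show ?thesis
        using Ten False assms(3,4)[unfolded zero_fun_def] by (auto simp: conv_map_def tensor_map_def pure_def)
    qed
  qed
qed

lemma conv_braid_pure: "conv_braid (pure a v b w) = pure b w a v"
  by (auto simp: conv_braid_def pure_def fun_eq_iff mult.commute split: ix.split)

lemma conv_assoc_pure:
  "conv_assoc P (pure (join P a b) (pure a u b v) c w) = pure a u (join P b c) (pure b v c w)"
proof
  fix l show "conv_assoc P (pure (join P a b) (pure a u b v) c w) l = pure a u (join P b c) (pure b v c w) l"
  proof (cases l)
    case (Ten a' i p m)
    then show ?thesis by (cases m) (auto simp: conv_assoc_def pure_def)
  qed (simp add: conv_assoc_def pure_def)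
qed

lemma conv_braid_linear: "conv_braid (fscale c t) = fscale c (conv_braid t)" "conv_braid 0 = 0"
  by (auto simp: conv_braid_def fscale_def fun_eq_iff split: ix.split)

subsection \<open>The action of permutations on words\<close>

text \<open>The permutation of places that corresponds to tensoring with an identity on the
  left.\<close>

definition lift_perm :: "(nat \<Rightarrow> nat) \<Rightarrow> nat \<Rightarrow> nat" where
  "lift_perm \<sigma> i = (case i of 0 \<Rightarrow> 0 | Suc j \<Rightarrow> Suc (\<sigma> j))"

lemma permute_list_lift: "permute_list (lift_perm \<sigma>) (d # ds) = d # permute_list \<sigma> ds"
  unfolding permute_list_def lift_perm_def
  by (simp add: map_upt_Suc del: upt_Suc)

lemma permute_list_swap: "permute_list (transpose 0 1) (d # d' # ds) = d' # d # ds"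
  unfolding permute_list_def
  by (simp add: map_upt_Suc transpose_def map_nth del: upt_Suc)

text \<open>Shared by both categories, so that the effect of permutations on words is computed once.
  \<open>Q\<close> selects the letters at which \<open>r\<close> has a line.
  \<open>compat_assoc\<close> states one direction of associativity of compatibility; symmetry and
  commutativity give the other.\<close>

locale word_rig =
  fixes P :: "'d pcm" and U :: "'o \<Rightarrow> 'd \<Rightarrow> ('d, 'k::field) vec set"
    and Obs Maps I T Q r
    and C :: "('k, 'o, ('o, 'd, 'k) arrow) smlc"
  assumes C_def: "C = conv_rig P U Obs Maps I T"
    and sym: "\<And>a b. compatible P a b \<Longrightarrow> compatible P b a"
    and join_comm: "\<And>a b. join P a b = join P b a"
    and join_assoc: "\<And>a b c. join P (join P a b) c = join P a (join P b c)"
    and compat_assoc: "\<And>a b c. compatible P b c \<Longrightarrow> compatible P a (join P b c) \<Longrightarrow>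
      compatible P a b \<and> compatible P (join P a b) c"
    and U_unit: "U I = lines (\<lambda>x. x = neutral P)"
    and U_gen: "U r = lines Q"
    and U_ten: "\<And>V W. U (T V W) = conv_sp P (U V) (U W)"
    and maps: "\<And>V W h x. h \<in> Maps V W \<Longrightarrow> h x \<in> lin_maps (U V x) (U W x)"
    and r_obj: "r \<in> Obs"
    and two_rig_C: "two_rig C"
begin

sublocale rig C by standard (rule two_rig_C)

lemma C_simps [simp]:
  "obj C = Obs" "unit C = I" "ten C = T"
  "f \<in> hom C V W \<longleftrightarrow> src f = V \<and> tgt f = W \<and> comp_at f \<in> Maps V W"
  "comp_at (cmp C g f) = (\<lambda>x. comp_at g x \<circ> comp_at f x)"
  "src (cmp C g f) = src f" "tgt (cmp C g f) = tgt g"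
  "comp_at (ide C V) = (\<lambda>x. restrict0 (U V x) (\<lambda>v. v))"
  by (simp_all add: C_def conv_rig_def)

lemma comp_at_tena: "src f = V \<Longrightarrow> src g = W \<Longrightarrow>
    comp_at (tena C f g) x = restrict0 (conv_sp P (U V) (U W) x) (conv_map (comp_at f) (comp_at g))"
  by (simp add: C_def conv_rig_def U_ten)

lemma comp_at_assoc: "comp_at (assoc C V W Z) x = restrict0 (U (T (T V W) Z) x) (conv_assoc P)"
  by (simp add: C_def conv_rig_def)

lemma comp_at_braid: "comp_at (braid C V W) x = restrict0 (conv_sp P (U V) (U W) x) conv_braid"
  by (simp add: C_def conv_rig_def U_ten)

lemma src_simps [simp]: "src (ide C V) = V" "src (braid C V W) = T V W"
  by (simp_all add: C_def conv_rig_def)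

lemma hom_lin: "f \<in> hom C V W \<Longrightarrow> comp_at f x \<in> lin_maps (U V x) (U W x)"
  using maps by simp

lemma U_tpow: "U (tpow C r n) = powsp P Q n"
  by (induction n) (simp_all add: U_unit U_ten U_gen)

text \<open>Only the basis vectors of words are mentioned; by linearity they determine the
  components of \<open>f\<close> on the power.\<close>

definition permutes_words :: "nat \<Rightarrow> (nat \<Rightarrow> nat) \<Rightarrow> ('o, 'd, 'k) arrow \<Rightarrow> bool" where
  "permutes_words n \<sigma> f \<longleftrightarrow> (\<forall>x. \<forall>ds\<in>words P Q n x. permute_list \<sigma> ds \<in> words P Q n x \<and>
     comp_at f x (ev (wd P ds)) = ev (wd P (permute_list \<sigma> ds)))"

lemma permutes_words_ide: "permutes_words n id (ide C (tpow C r n))"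
  unfolding permutes_words_def U_tpow C_simps restrict0_def by (auto simp: ev_word_in_powsp)

text \<open>The order is reversed because \<open>permute_list (\<sigma> \<circ> \<tau>)\<close>
  applies \<open>\<sigma>\<close> first: places carry a right action.\<close>

lemma permutes_words_cmp:
  assumes "permutes_words n \<sigma> f" "permutes_words n \<tau> g" "\<tau> permutes {..<n}"
  shows "permutes_words n (\<sigma> \<circ> \<tau>) (cmp C g f)"
  unfolding permutes_words_def
proof (intro allI ballI)
  fix x ds assume ds: "ds \<in> words P Q n x"
  then have "length ds = n" by (simp add: words_def)
  then have "permute_list (\<sigma> \<circ> \<tau>) ds = permute_list \<tau> (permute_list \<sigma> ds)"
    using permute_list_compose assms(3) by blast
  then show "permute_list (\<sigma> \<circ> \<tau>) ds \<in> words P Q n x \<and>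
      comp_at (cmp C g f) x (ev (wd P ds)) = ev (wd P (permute_list (\<sigma> \<circ> \<tau>) ds))"
    using assms(1,2) ds unfolding permutes_words_def by simp
qed

lemma permutes_words_tena:
  assumes f: "f \<in> hom C (tpow C r n) (tpow C r n)" and p: "permutes_words n \<sigma> f"
  shows "permutes_words (Suc n) (lift_perm \<sigma>) (tena C (ide C r) f)"
  unfolding permutes_words_def
proof (intro allI ballI)
  fix x es assume "es \<in> words P Q (Suc n) x"
  then obtain d ds where es: "es = d # ds" "Q d" "ds \<in> words P Q n (joins P ds)" "(d, joins P ds) \<in> decomp P x"
    unfolding words_Suc by blast
  have p': "permute_list \<sigma> ds \<in> words P Q n (joins P ds)"
    "comp_at f (joins P ds) (ev (wd P ds)) = ev (wd P (permute_list \<sigma> ds))"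
    using p es(3) unfolding permutes_words_def by blast+
  \<comment> \<open>Rearranging the letters keeps their join, so the label of the second factor does
    not change.\<close>
  have j: "joins P (permute_list \<sigma> ds) = joins P ds" using p'(1) by (simp add: words_def)
  have r: "ev Pt \<in> U r d" using es(2) by (simp add: U_gen lines_span fs.span_base)
  have sr: "fs.subspace (U r y)" for y by (simp add: U_gen lines_span)
  have w: "ev (wd P ds) \<in> U (tpow C r n) (joins P ds)"
    unfolding U_tpow by (rule ev_word_in_powsp[OF es(3)])
  have "comp_at (tena C (ide C r) f) x (ev (wd P es)) =
      conv_map (comp_at (ide C r)) (comp_at f) (pure d (ev Pt) (joins P ds) (ev (wd P ds)))"
    using pure_in_conv_sp[of d "joins P ds" P x "ev Pt" "U r" "ev (wd P ds)" "U (tpow C r n)", OF es(4) r w] f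
    by (simp add: comp_at_tena[of _ r _ "tpow C r n"] restrict0_def es(1) ev_Ten)
  also have "\<dots> = pure d (comp_at (ide C r) d (ev Pt)) (joins P ds) (comp_at f (joins P ds) (ev (wd P ds)))"
    by (rule conv_map_pure)
      (use lin_mapsD(3)[OF hom_lin[OF f] w] lin_maps_zero[OF hom_lin[OF f]] r sr
        in \<open>auto simp: restrict0_def fs.subspace_scale\<close>)
  also have "\<dots> = ev (wd P (d # permute_list \<sigma> ds))"
    using r p'(2) j by (simp add: restrict0_def ev_Ten)
  finally have "comp_at (tena C (ide C r) f) x (ev (wd P es)) = ev (wd P (d # permute_list \<sigma> ds))" .
  moreover have "d # permute_list \<sigma> ds \<in> words P Q (Suc n) x"
    unfolding words_Suc using es p'(1) j by auto
  ultimately show "permute_list (lift_perm \<sigma>) es \<in> words P Q (Suc n) x \<and>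
      comp_at (tena C (ide C r) f) x (ev (wd P es)) = ev (wd P (permute_list (lift_perm \<sigma>) es))"
    by (simp add: es(1) permute_list_lift)
qed

text \<open>The equation in \<open>is_swap\<close> controls \<open>f\<close> only behind the
  associator, so the vector of the word is first exhibited as the associator applied to a
  left-nested pure tensor.\<close>

lemma permutes_words_swap:
  assumes f: "is_swap C r (tpow C r n) f"
  shows "permutes_words (Suc (Suc n)) (transpose 0 1) f"
  unfolding permutes_words_def
proof (intro allI ballI)
  fix x es assume "es \<in> words P Q (Suc (Suc n)) x"
  then obtain d fs where "es = d # fs" "Q d" "fs \<in> words P Q (Suc n) (joins P fs)" "(d, joins P fs) \<in> decomp P x"
    unfolding words_Suc[of P Q "Suc n"] by blast
  moreover from this(3) obtain d' ds where "fs = d' # ds" "Q d'" "ds \<in> words P Q n (joins P ds)"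
    "(d', joins P ds) \<in> decomp P (joins P fs)"
    unfolding words_Suc by blast
  ultimately have es: "es = d # d' # ds" and Q: "Q d" "Q d'"
    and ds: "ds \<in> words P Q n (joins P ds)"
    and c: "compatible P d' (joins P ds)" "compatible P d (join P d' (joins P ds))"
    and x: "x = join P d (join P d' (joins P ds))"
    by (simp_all add: decomp_def)
  let ?j = "joins P ds" and ?w = "ev (wd P ds) :: ('d, 'k) vec" and ?p = "ev Pt :: ('d, 'k) vec"
  have c': "compatible P d d'" "compatible P (join P d d') ?j"
    using compat_assoc[OF c] by auto
  \<comment> \<open>The exchanged word needs its compatibilities in the new order; a second use of
    the associativity law, with the tail moved to the front, provides them.\<close>
  have c3: "compatible P ?j d \<and> compatible P (join P ?j d) d'"
    by (rule compat_assoc[OF c'(1) sym[OF c'(2)]])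
  have c'': "compatible P d' d" "compatible P (join P d' d) ?j" "compatible P d ?j"
      "compatible P d' (join P d ?j)"
    using sym[OF c'(1)] c'(2) sym[OF conjunct1[OF c3]] sym[OF conjunct2[OF c3]]
    by (simp_all only: join_comm[of d' d] join_comm[of d ?j])
  have x': "x = join P d' (join P d ?j)" unfolding x by (simp only: join_assoc[symmetric] join_comm[of d' d])
  have p: "?p \<in> U r d" "?p \<in> U r d'" using Q by (simp_all add: U_gen lines_span fs.span_base)
  have w: "?w \<in> U (tpow C r n) ?j" unfolding U_tpow by (rule ev_word_in_powsp[OF ds])
  define e where "e a b = pure (join P a b) (pure a ?p b ?p) ?j ?w" for a b
  have in1: "pure d ?p d' ?p \<in> U (T r r) (join P d d')"
    unfolding U_ten by (rule pure_in_conv_sp) (simp_all add: decomp_def c' p)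
  have in2: "pure d' ?p d ?p \<in> U (T r r) (join P d d')"
    unfolding U_ten by (rule pure_in_conv_sp) (simp_all add: decomp_def c'' p join_comm[of d' d])
  have dec: "(join P d d', ?j) \<in> decomp P x"
    by (simp add: decomp_def c' x join_assoc)
  have e1: "e d d' \<in> U (T (T r r) (tpow C r n)) x"
    unfolding U_ten[of "T r r"] e_def by (rule pure_in_conv_sp, rule dec, rule in1, rule w)
  have e2: "e d' d \<in> U (T (T r r) (tpow C r n)) x"
    unfolding U_ten[of "T r r"] e_def join_comm[of d' d] by (rule pure_in_conv_sp, rule dec, rule in2, rule w)
  have a1: "comp_at (assoc C r r (tpow C r n)) x (e d d') = ev (wd P es)"
    using e1 by (simp add: comp_at_assoc restrict0_def e_def conv_assoc_pure es ev_Ten)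
  have a2: "comp_at (assoc C r r (tpow C r n)) x (e d' d) = ev (wd P (d' # d # ds))"
    using e2 by (simp add: comp_at_assoc restrict0_def e_def conv_assoc_pure ev_Ten)
  have b: "comp_at (tena C (braid C r r) (ide C (tpow C r n))) x (e d d') = e d' d"
  proof -
    have "comp_at (tena C (braid C r r) (ide C (tpow C r n))) x (e d d') =
        conv_map (comp_at (braid C r r)) (comp_at (ide C (tpow C r n))) (e d d')"
      using e1 by (simp add: comp_at_tena[of _ "T r r" _ "tpow C r n"] restrict0_def U_ten[of "T r r"])
    also have "\<dots> = pure (join P d d') (comp_at (braid C r r) (join P d d') (pure d ?p d' ?p))
        ?j (comp_at (ide C (tpow C r n)) ?j ?w)"
      unfolding e_def
      by (rule conv_map_pure)
        (use in1 w in \<open>auto simp: comp_at_braid restrict0_def U_ten conv_braid_linear U_tpow powsp_span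
            fs.subspace_scale[OF conv_sp_subspace] fs.span_scale\<close>)
    also have "\<dots> = e d' d"
      using in1 w by (simp add: e_def comp_at_braid restrict0_def U_ten conv_braid_pure join_comm[of d' d])
    finally show ?thesis .
  qed
  have "comp_at f x (ev (wd P es)) = comp_at (cmp C f (assoc C r r (tpow C r n))) x (e d d')"
    by (simp add: a1)
  also have "\<dots> = comp_at (assoc C r r (tpow C r n)) x (comp_at (tena C (braid C r r) (ide C (tpow C r n))) x (e d d'))"
    using f unfolding is_swap_def by simp
  also have "\<dots> = ev (wd P (d' # d # ds))" using a2 b by simp
  finally have "comp_at f x (ev (wd P es)) = ev (wd P (d' # d # ds))" .
  moreover have "d' # d # ds \<in> words P Q (Suc (Suc n)) x"
    using Q ds c'' x' by (auto simp: words_def)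
  ultimately show "permute_list (transpose 0 1) es \<in> words P Q (Suc (Suc n)) x \<and>
      comp_at f x (ev (wd P es)) = ev (wd P (permute_list (transpose 0 1) es))"
    unfolding es permute_list_swap by simp
qed

end

section \<open>Species and representations of symmetric groups\<close>

text \<open>One representative of each isomorphism class of finite sets; arrows of species are
  determined by their values there.\<close>

definition std :: "nat \<Rightarrow> nat fset" where
  "std n = fset_of_list [0..<n]"

lemma fset_std [simp]: "fset (std n) = {..<n}"
  by (auto simp: std_def fset_of_list.rep_eq)

lemma fcard_std [simp]: "fcard (std n) = n"
  by (simp add: fcard.rep_eq)

section \<open>Bijections of finite sets and permutations of standard sets\<close>

lemma bijections_compose:
  assumes "s \<in> bijections X Y" "t \<in> bijections Y Z"
  shows "compose (fset X) t s \<in> bijections X Z"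
proof -
  have "bij_betw (t \<circ> s) (fset X) (fset Z)"
    using assms bij_betw_trans unfolding bijections_def by blast
  then have "bij_betw (compose (fset X) t s) (fset X) (fset Z)"
    by (subst bij_betw_cong[of _ _ "t \<circ> s"]) (auto simp: compose_def)
  then show ?thesis unfolding bijections_def by simp
qed

lemma bijections_inverse:
  assumes "s \<in> bijections X Y"
  obtains t where "t \<in> bijections Y X" "compose (fset X) t s = restrict id (fset X)"
    "compose (fset Y) s t = restrict id (fset Y)"
proof -
  have b: "bij_betw s (fset X) (fset Y)" using assms unfolding bijections_def by simp
  let ?t = "restrict (inv_into (fset X) s) (fset Y)"
  have "bij_betw ?t (fset Y) (fset X)"
    by (subst bij_betw_cong[of _ _ "inv_into (fset X) s"]) (auto simp: bij_betw_inv_into[OF b])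
  then have "?t \<in> bijections Y X" unfolding bijections_def by simp
  moreover have "compose (fset X) ?t s = restrict id (fset X)"
    using bij_betwE[OF b] bij_betw_inv_into_left[OF b] by (auto simp: compose_def restrict_def fun_eq_iff)
  moreover have "compose (fset Y) s ?t = restrict id (fset Y)"
    using bij_betw_inv_into_right[OF b] by (auto simp: compose_def restrict_def fun_eq_iff)
  ultimately show ?thesis by (rule that)
qed

lemma bijections_fcard: "s \<in> bijections X Y \<Longrightarrow> fcard X = fcard Y"
  unfolding bijections_def fcard.rep_eq using bij_betw_same_card by blast

lemma bijections_from_std:
  obtains b where "b \<in> bijections (std (fcard X)) X"
proof -
  obtain h where "bij_betw h {0..<card (fset X)} (fset X)"
    using ex_bij_betw_nat_finite[OF finite_fset] by blast
  then have h: "bij_betw h {..<fcard X} (fset X)" by (simp add: fcard.rep_eq atLeast0LessThan)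
  then have "bij_betw (restrict h {..<fcard X}) {..<fcard X} (fset X)"
    by (subst bij_betw_cong[of _ _ h]) auto
  then have "restrict h {..<fcard X} \<in> bijections (std (fcard X)) X" unfolding bijections_def by simp
  then show ?thesis by (rule that)
qed

lemma permutes_bijections: "\<sigma> permutes {..<n} \<Longrightarrow> restrict \<sigma> {..<n} \<in> bijections (std n) (std n)"
  unfolding bijections_def
  by (simp add: permutes_imp_bij bij_betw_cong[of "{..<n}" "restrict \<sigma> {..<n}" \<sigma>])

text \<open>Translates between two conventions: an arrow of the groupoid is undefined off its
  domain, whereas a permutation is the identity there.\<close>

lemma bijections_permutes:
  assumes "s \<in> bijections (std n) (std n)"
  obtains \<sigma> where "\<sigma> permutes {..<n}" "s = restrict \<sigma> {..<n}"
proof -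
  let ?\<sigma> = "\<lambda>i. if i < n then s i else i"
  have "bij_betw ?\<sigma> {..<n} {..<n}"
    using assms unfolding bijections_def by (subst bij_betw_cong[of _ _ s]) auto
  then have "?\<sigma> permutes {..<n}" by (rule bij_imp_permutes) simp
  moreover have "s = restrict ?\<sigma> {..<n}"
    using assms unfolding bijections_def by (auto simp: fun_eq_iff restrict_def extensional_def)
  ultimately show ?thesis by (rule that)
qed

section \<open>Species and their arrows on standard sets\<close>

lemma species_objD:
  assumes "V \<in> species_obj"
  shows "fin_space (sp V X)" "s \<in> bijections X Y \<Longrightarrow> act V X Y s \<in> lin_maps (sp V X) (sp V Y)"
    "act V X X (restrict id (fset X)) = restrict0 (sp V X) (\<lambda>v. v)"
    "s \<in> bijections X Y \<Longrightarrow> t \<in> bijections Y Z \<Longrightarrow>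
      act V X Z (compose (fset X) t s) = act V Y Z t \<circ> act V X Y s"
    "\<exists>N. \<forall>X. N \<le> fcard X \<longrightarrow> sp V X = {0}"
    "fs.subspace (sp V X)"
  using assms fin_space_subspace unfolding species_obj_def by blast+

definition sact :: "'k::field species \<Rightarrow> nat \<Rightarrow> (nat \<Rightarrow> nat) \<Rightarrow> (nat fset, 'k) vec \<Rightarrow> (nat fset, 'k) vec" where
  "sact V n \<sigma> = act V (std n) (std n) (restrict \<sigma> {..<n})"

lemma sact_rep:
  assumes V: "V \<in> species_obj"
  shows "is_rep {..<n} (sp V (std n)) (sact V n)"
  unfolding is_rep_def
proof (intro conjI allI impI ballI)
  show "fin_space (sp V (std n))" by (rule species_objD(1)[OF V])
  show "sact V n \<sigma> \<in> lin_maps (sp V (std n)) (sp V (std n))" if "\<sigma> permutes {..<n}" for \<sigma>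
    unfolding sact_def by (rule species_objD(2)[OF V permutes_bijections[OF that]])
  show "sact V n id v = v" if "v \<in> sp V (std n)" for v
    using species_objD(3)[OF V, of "std n"] that by (simp add: sact_def restrict0_def)
  show "sact V n (\<sigma> \<circ> \<tau>) v = sact V n \<sigma> (sact V n \<tau> v)"
    if "\<sigma> permutes {..<n}" "\<tau> permutes {..<n}" for \<sigma> \<tau> v
  proof -
    have "compose {..<n} (restrict \<sigma> {..<n}) (restrict \<tau> {..<n}) = restrict (\<sigma> \<circ> \<tau>) {..<n}"
      using permutes_in_image[OF that(2)] by (auto simp: compose_def restrict_def fun_eq_iff)
    then show ?thesis
      using species_objD(4)[OF V permutes_bijections[OF that(2)] permutes_bijections[OF that(1)]]
      by (simp add: sact_def)
  qed
qed

lemma act_inverse: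
  assumes V: "V \<in> species_obj" and b: "b \<in> bijections X Y" "c \<in> bijections Y X"
    and i: "compose (fset X) c b = restrict id (fset X)" and v: "v \<in> sp V X"
  shows "act V Y X c (act V X Y b v) = v"
  using fun_cong[OF species_objD(4)[OF V b, unfolded i species_objD(3)[OF V]], of v] v
  by (simp add: restrict0_def)

text \<open>Every set is reached from a standard one by a bijection, and naturality along it fixes
  the value.\<close>

lemma species_map_unique:
  assumes V: "V \<in> species_obj" and f: "f \<in> species_maps V W" and g: "g \<in> species_maps V W"
    and eq: "\<And>n v. v \<in> sp V (std n) \<Longrightarrow> f (std n) v = g (std n) v"
  shows "f = g"
proof (rule ext, rule ext)
  fix X v
  have lf: "f X \<in> lin_maps (sp V X) (sp W X)" and lg: "g X \<in> lin_maps (sp V X) (sp W X)"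
    using f g unfolding species_maps_def by auto
  show "f X v = g X v"
  proof (cases "v \<in> sp V X")
    case True
    let ?S = "std (fcard X)"
    obtain b where b: "b \<in> bijections ?S X" using bijections_from_std .
    obtain c where c: "c \<in> bijections X ?S" "compose (fset X) b c = restrict id (fset X)"
      using bijections_inverse[OF b] by metis
    let ?w = "act V X ?S c v"
    have w: "?w \<in> sp V ?S" using lin_mapsD(1)[OF species_objD(2)[OF V c(1)] True] .
    have v: "v = act V ?S X b ?w" using act_inverse[OF V c(1) b c(2) True] by simp
    have "f X (act V ?S X b ?w) = act W ?S X b (f ?S ?w)" "g X (act V ?S X b ?w) = act W ?S X b (g ?S ?w)"
      using f g b unfolding species_maps_def by (auto simp: fun_eq_iff)
    then show ?thesis using v eq[OF w] by simp
  next
    case False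
    then show ?thesis using lin_mapsD(4)[OF lf] lin_mapsD(4)[OF lg] by simp
  qed
qed

text \<open>\<open>h\<close> is carried to an arbitrary set along a chosen bijection from the
  standard set. Naturality involves two such choices, whose discrepancy is a permutation of the
  standard set and is absorbed by equivariance. Together with \<open>species_map_unique\<close> this
  describes arrows of species by equivariant maps.\<close>

lemma species_map_extend:
  assumes V: "V \<in> species_obj" and W: "W \<in> species_obj"
    and h: "\<And>n. h n \<in> lin_maps (sp V (std n)) (sp W (std n))"
    and eq: "\<And>n. equivariant {..<n} (sp V (std n)) (sact V n) (sact W n) (h n)"
  obtains f where "f \<in> species_maps V W" "\<And>n v. v \<in> sp V (std n) \<Longrightarrow> f (std n) v = h n v"
proof -
  have "\<forall>X. \<exists>b c. b \<in> bijections (std (fcard X)) X \<and> c \<in> bijections X (std (fcard X)) \<and>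
      compose {..<fcard X} c b = restrict id {..<fcard X} \<and> compose (fset X) b c = restrict id (fset X)"
    using bijections_from_std bijections_inverse fset_std by metis
  then obtain b c where b: "\<And>X. b X \<in> bijections (std (fcard X)) X"
    and c: "\<And>X. c X \<in> bijections X (std (fcard X))"
    and cb: "\<And>X. compose (fset (std (fcard X))) (c X) (b X) = restrict id (fset (std (fcard X)))"
    and bc: "\<And>X. compose (fset X) (b X) (c X) = restrict id (fset X)"
    unfolding fset_std by metis
  have hs: "h n (act V (std n) (std n) s v) = act W (std n) (std n) s (h n v)"
    if s: "s \<in> bijections (std n) (std n)" and v: "v \<in> sp V (std n)" for n s v
  proof -
    obtain \<sigma> where "\<sigma> permutes {..<n}" "s = restrict \<sigma> {..<n}" using bijections_permutes[OF s] .
    then show ?thesis using eq[of n] v unfolding equivariant_def sact_def by blast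
  qed
  define f where "f X = act W (std (fcard X)) X (b X) \<circ> (h (fcard X) \<circ> act V X (std (fcard X)) (c X))" for X
  have fl: "f X \<in> lin_maps (sp V X) (sp W X)" for X
    unfolding f_def
    by (rule lin_maps_comp[OF lin_maps_comp[OF species_objD(2)[OF V c] h] species_objD(2)[OF W b]])
  have nat: "f Y (act V X Y s v) = act W X Y s (f X v)" if s: "s \<in> bijections X Y" and v: "v \<in> sp V X" for X Y s v
  proof -
    let ?n = "fcard X" and ?S = "std (fcard X)"
    have n: "fcard Y = ?n" using bijections_fcard[OF s] by simp
    note bY = b[of Y, unfolded n] and cY = c[of Y, unfolded n]
    have cs: "compose (fset X) (c Y) s \<in> bijections X ?S" by (rule bijections_compose[OF s cY])
    \<comment> \<open>\<open>s\<close> expressed through the chosen identifications of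
      \<open>X\<close> and \<open>Y\<close> with the standard set.\<close>
    let ?t = "compose (fset ?S) (compose (fset X) (c Y) s) (b X)"
    have t: "?t \<in> bijections ?S ?S" by (rule bijections_compose[OF b cs])
    have at: "act Z ?S ?S ?t u = act Z Y ?S (c Y) (act Z X Y s (act Z ?S X (b X) u))" if "Z \<in> species_obj" for Z u
      using species_objD(4)[OF that b cs] species_objD(4)[OF that s cY] by simp
    let ?u = "act V X ?S (c X) v"
    have u: "?u \<in> sp V ?S" using lin_mapsD(1)[OF species_objD(2)[OF V c] v] .
    have "act V Y ?S (c Y) (act V X Y s v) = act V ?S ?S ?t ?u"
      unfolding at[OF V] using act_inverse[OF V c b bc v] by simp
    then have "f Y (act V X Y s v) = act W ?S Y (b Y) (act W ?S ?S ?t (h ?n ?u))"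
      using hs[OF t u] by (simp add: f_def n)
    also have "\<dots> = act W X Y s (act W ?S X (b X) (h ?n ?u))"
    proof -
      have "act W ?S X (b X) (h ?n ?u) \<in> sp W X"
        using lin_mapsD(1)[OF species_objD(2)[OF W b]] lin_mapsD(1)[OF h u] by blast
      then have "act W X Y s (act W ?S X (b X) (h ?n ?u)) \<in> sp W Y"
        using lin_mapsD(1)[OF species_objD(2)[OF W s]] by blast
      then show ?thesis unfolding at[OF W] using act_inverse[OF W cY bY] bc[of Y] by simp
    qed
    finally show ?thesis by (simp add: f_def)
  qed
  have "f \<in> species_maps V W"
    unfolding species_maps_def
  proof (intro CollectI conjI allI ballI fl, rule ext)
    fix X Y s v assume s: "s \<in> bijections X Y"
    show "(f Y \<circ> act V X Y s) v = (act W X Y s \<circ> f X) v"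
    proof (cases "v \<in> sp V X")
      case True
      then show ?thesis using nat[OF s] by simp
    next
      case False
      then show ?thesis
        using lin_mapsD(4)[OF fl False] lin_mapsD(4)[OF species_objD(2)[OF V s] False]
          lin_maps_zero[OF fl] lin_maps_zero[OF species_objD(2)[OF W s]] by simp
    qed
  qed
  \<comment> \<open>The bijection chosen for \<open>std n\<close> may be a nontrivial permutation;
    equivariance of \<open>h\<close> cancels it.\<close>
  moreover have "f (std n) v = h n v" if v: "v \<in> sp V (std n)" for n v
  proof -
    let ?c = "c (std n)" and ?b = "b (std n)"
    have c': "?c \<in> bijections (std n) (std n)" and b': "?b \<in> bijections (std n) (std n)"
      and bc': "compose (fset (std n)) ?b ?c = restrict id (fset (std n))"
      using c[of "std n"] b[of "std n"] bc[of "std n"] by simp_all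
    have "h n v \<in> sp W (std n)" using lin_mapsD(1)[OF h v] .
    then show ?thesis
      using hs[OF c' v] act_inverse[OF W c' b' bc'] by (simp add: f_def)
  qed
  ultimately show ?thesis by (rule that)
qed

lemma lin_maps_eq_on_span:
  assumes f: "f \<in> lin_maps V W" and g: "g \<in> lin_maps V W" and V: "V = fs.span G"
    and eq: "\<And>x. x \<in> G \<Longrightarrow> f x = g x" and v: "v \<in> V"
  shows "f v = g v"
proof -
  have "fs.subspace {v \<in> V. f v = g v}"
    using lin_mapsD(2,3)[OF f] lin_mapsD(2,3)[OF g] lin_maps_zero[OF f] lin_maps_zero[OF g]
    unfolding fs.subspace_def V by (auto simp: fs.span_zero fs.span_add fs.span_scale)
  moreover have "G \<subseteq> {v \<in> V. f v = g v}" using eq unfolding V by (auto intro: fs.span_base)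
  ultimately have "V \<subseteq> {v \<in> V. f v = g v}" unfolding V by (intro fs.span_minimal)
  then show ?thesis using v by blast
qed

subsection \<open>Words of finite sets\<close>

abbreviation "fwords \<equiv> words finset_pcm (\<lambda>X :: nat fset. fcard X = 1)"

lemma finset_simps [simp]:
  "compatible finset_pcm A B \<longleftrightarrow> A |\<inter>| B = {||}" "join finset_pcm A B = A |\<union>| B"
  "neutral finset_pcm = {||}"
  by (simp_all add: finset_pcm_def)

lemma joins_finset: "fset (joins finset_pcm ds) = (\<Union>d\<in>set ds. fset d)"
  by (induction ds) auto

lemma fcard_1_singleton: "fcard X = 1 \<longleftrightarrow> (\<exists>x. X = {|x|})"
proof
  assume "fcard X = 1"
  then obtain x where "fset X = {x}" unfolding fcard.rep_eq using card_1_singletonE by metis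
  then have "X = {|x|}" by (metis bot_fset.rep_eq finsert.rep_eq fset_inject)
  then show "\<exists>x. X = {|x|}" ..
qed (auto simp: fcard.rep_eq)

text \<open>Letters are singletons and compatibility is disjointness, so words are enumerations
  without repetition.\<close>

lemma fwords_iff:
  "ds \<in> fwords n X \<longleftrightarrow> (\<exists>xs. ds = map (\<lambda>x. {|x|}) xs \<and> distinct xs \<and> set xs = fset X \<and> length xs = n)"
proof (induction ds arbitrary: n X)
  case Nil
  then show ?case by (auto simp: words_def fset_inject[symmetric])
next
  case (Cons d ds)
  show ?case
  proof
    assume "d # ds \<in> fwords n X"
    then have d1: "fcard d = 1" and ds: "ds \<in> fwords (length ds) (joins finset_pcm ds)"
      and n: "n = Suc (length ds)" and X': "X = d |\<union>| joins finset_pcm ds" and dj': "d |\<inter>| joins finset_pcm ds = {||}"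
      by (auto simp: words_def)
    obtain x where d: "d = {|x|}" using iffD1[OF fcard_1_singleton d1] ..
    have X: "X = {|x|} |\<union>| joins finset_pcm ds" and dj: "x |\<notin>| joins finset_pcm ds"
      using X' dj' unfolding d by auto
    obtain xs where xs: "ds = map (\<lambda>x. {|x|}) xs" "distinct xs" "set xs = fset (joins finset_pcm ds)"
      using iffD1[OF Cons.IH ds] by blast
    show "\<exists>xs. d # ds = map (\<lambda>x. {|x|}) xs \<and> distinct xs \<and> set xs = fset X \<and> length xs = n"
      using xs dj by (intro exI[of _ "x # xs"]) (auto simp: d n X)
  next
    assume "\<exists>xs. d # ds = map (\<lambda>x. {|x|}) xs \<and> distinct xs \<and> set xs = fset X \<and> length xs = n"
    then obtain x xs where x: "d = {|x|}" "ds = map (\<lambda>x. {|x|}) xs" "distinct (x # xs)" "set (x # xs) = fset X" "length (x # xs) = n"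
      by (auto simp: Cons_eq_map_conv)
    have j: "fset (joins finset_pcm ds) = set xs" by (simp add: joins_finset x(2))
    have "ds \<in> fwords (length xs) (joins finset_pcm ds)"
      by (rule iffD2[OF Cons.IH]) (use x j in auto)
    then show "d # ds \<in> fwords n X"
      using x j by (auto simp: words_def fset_inject[symmetric] fcard.rep_eq)
  qed
qed

text \<open>The one-line notation of a permutation, written with singletons.\<close>

definition lt :: "nat \<Rightarrow> (nat \<Rightarrow> nat) \<Rightarrow> nat fset list" where
  "lt n \<sigma> = map (\<lambda>i. {|\<sigma> i|}) [0..<n]"

lemma fwords_std: "fwords n (std n) = lt n ` {\<sigma>. \<sigma> permutes {..<n}}"
proof (intro set_eqI iffI)
  fix ds assume "ds \<in> fwords n (std n)"
  then obtain xs where xs: "ds = map (\<lambda>x. {|x|}) xs" "distinct xs" "set xs = {..<n}" "length xs = n"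
    unfolding fwords_iff by auto
  let ?\<sigma> = "\<lambda>i. if i < n then xs ! i else i"
  have "bij_betw ((!) xs) {..<n} {..<n}" using xs by (intro bij_betw_nth) auto
  then have "bij_betw ?\<sigma> {..<n} {..<n}" by (subst bij_betw_cong[of _ _ "(!) xs"]) auto
  then have "?\<sigma> permutes {..<n}" by (rule bij_imp_permutes) simp
  moreover have "ds = lt n ?\<sigma>"
    unfolding lt_def xs(1) using xs(4) by (auto simp: list_eq_iff_nth_eq)
  ultimately show "ds \<in> lt n ` {\<sigma>. \<sigma> permutes {..<n}}" by blast
next
  fix ds assume "ds \<in> lt n ` {\<sigma>. \<sigma> permutes {..<n}}"
  then obtain \<sigma> where \<sigma>: "\<sigma> permutes {..<n}" "ds = lt n \<sigma>" by blast
  have "ds = map (\<lambda>x. {|x|}) (map \<sigma> [0..<n])" using \<sigma>(2) by (simp add: lt_def)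
  moreover have "distinct (map \<sigma> [0..<n])"
    using permutes_inj[OF \<sigma>(1)] by (auto simp: distinct_map intro: inj_on_subset)
  moreover have "set (map \<sigma> [0..<n]) = fset (std n)"
    using permutes_image[OF \<sigma>(1)] by (auto simp: atLeast0LessThan)
  ultimately show "ds \<in> fwords n (std n)" unfolding fwords_iff by force
qed

lemma fwords_other:
  assumes "m \<noteq> n"
  shows "fwords m (std n) = {}"
proof -
  have "m = n" if ds: "ds \<in> fwords m (std n)" for ds
  proof -
    obtain xs where "distinct xs" "set xs = {..<n}" "length xs = m"
      using iffD1[OF fwords_iff ds] by auto
    then show ?thesis using distinct_card[of xs] by simp
  qed
  then show ?thesis using assms by blast
qed

lemma lt_inject:
  assumes "\<sigma> permutes {..<n}" "\<tau> permutes {..<n}"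
  shows "lt n \<sigma> = lt n \<tau> \<longleftrightarrow> \<sigma> = \<tau>"
proof
  assume "lt n \<sigma> = lt n \<tau>"
  then have "\<sigma> i = \<tau> i" if "i < n" for i using that by (simp add: lt_def)
  moreover have "\<sigma> i = \<tau> i" if "\<not> i < n" for i
    using permutes_not_in[OF assms(1)] permutes_not_in[OF assms(2)] that by simp
  ultimately show "\<sigma> = \<tau>" by blast
qed simp

text \<open>Permuting the places multiplies on the right, while relabelling the letters multiplies
  on the left (\<open>sact_e\<close>); hence the two actions commute.\<close>

lemma permute_list_lt: "\<rho> permutes {..<n} \<Longrightarrow> permute_list \<rho> (lt n \<sigma>) = lt n (\<sigma> \<circ> \<rho>)"
  unfolding lt_def using permutes_in_image[of \<rho> "{..<n}"]
  by (auto simp: permute_list_def list_eq_iff_nth_eq)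

subsection \<open>The action on tensor products\<close>

lemma restrict_bijections:
  assumes s: "s \<in> bijections X Y" and A: "A |\<subseteq>| X"
  shows "restrict s (fset A) \<in> bijections A (s |`| A)"
proof -
  have "inj_on s (fset X)" using s unfolding bijections_def bij_betw_def by simp
  then have "inj_on s (fset A)" using A unfolding less_eq_fset.rep_eq by (rule inj_on_subset)
  then have "bij_betw s (fset A) (fset (s |`| A))" by (simp add: bij_betw_def)
  then have "bij_betw (restrict s (fset A)) (fset A) (fset (s |`| A))"
    by (subst bij_betw_cong[of _ _ s]) auto
  then show ?thesis unfolding bijections_def by simp
qed

lemma preimage_image:
  assumes s: "s \<in> bijections X Y" and A: "A |\<subseteq>| X"
  shows "ffilter (\<lambda>x. s x |\<in>| s |`| A) X = A"
proof -
  have "inj_on s (fset X)" using s unfolding bijections_def bij_betw_def by simp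
  then have "{x \<in> fset X. s x \<in> s ` fset A} = fset A"
    using A unfolding less_eq_fset.rep_eq by (auto simp: inj_on_def subset_iff)
  then show ?thesis unfolding fset_inject[symmetric] by (simp add: ffilter.rep_eq Int_def conj_commute)
qed

lemma image_preimage:
  assumes s: "s \<in> bijections X Y" and A: "A |\<subseteq>| Y"
  shows "s |`| ffilter (\<lambda>x. s x |\<in>| A) X = A"
proof -
  have "s ` fset X = fset Y" using s unfolding bijections_def bij_betw_def by simp
  then have "fset A \<subseteq> s ` fset X" using A unfolding less_eq_fset.rep_eq by simp
  then have "s ` {x \<in> fset X. s x \<in> fset A} = fset A" by auto
  then show ?thesis unfolding fset_inject[symmetric] by (simp add: ffilter.rep_eq Int_def conj_commute)
qed

text \<open>The action looks up each target summand at the preimages of its two parts. On a pure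
  tensor only the summand at the images of \<open>A\<close> and \<open>B\<close> is nonzero, and
  there homogeneity evaluates \<open>tensor_map\<close>.\<close>

lemma act_species_ten_pure:
  assumes V: "V \<in> species_obj" and W: "W \<in> species_obj" and s: "s \<in> bijections X Y"
    and AB: "(A, B) \<in> decomp finset_pcm X" and v: "v \<in> sp V A" and w: "w \<in> sp W B"
  shows "act (species_ten V W) X Y s (pure A v B w) =
    pure (s |`| A) (act V A (s |`| A) (restrict s (fset A)) v)
      (s |`| B) (act W B (s |`| B) (restrict s (fset B)) w)"
proof
  fix l
  have m: "pure A v B w \<in> conv_sp finset_pcm (sp V) (sp W) X" by (rule pure_in_conv_sp[where V="sp V" and W="sp W", OF AB v w])
  have sub: "A |\<subseteq>| X" "B |\<subseteq>| X" and X: "X = A |\<union>| B" and disj: "A |\<inter>| B = {||}"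
    using AB by (auto simp: decomp_def)
  have inj: "inj_on s (fset X)" and Y: "Y = s |`| X"
    using s unfolding bijections_def bij_betw_def by (auto simp: fset_inject[symmetric])
  have dec: "(s |`| A, s |`| B) \<in> decomp finset_pcm Y"
    using disj inj by (auto simp: decomp_def Y X fset_inject[symmetric] inj_on_def)
  show "act (species_ten V W) X Y s (pure A v B w) l = pure (s |`| A) (act V A (s |`| A) (restrict s (fset A)) v)
      (s |`| B) (act W B (s |`| B) (restrict s (fset B)) w) l"
  proof (cases l)
    case Pt
    then show ?thesis using m by (simp add: species_ten_def restrict0_def pure_def)
  next
    case (Ten A' i B' j)
    show ?thesis
    proof (cases "A' = s |`| A \<and> B' = s |`| B")
      case True
      let ?a = "act V A (s |`| A) (restrict s (fset A))" and ?b = "act W B (s |`| B) (restrict s (fset B))"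
      have la: "?a \<in> lin_maps (sp V A) (sp V (s |`| A))"
        by (rule species_objD(2)[OF V restrict_bijections[OF s sub(1)]])
      have lb: "?b \<in> lin_maps (sp W B) (sp W (s |`| B))"
        by (rule species_objD(2)[OF W restrict_bijections[OF s sub(2)]])
      have "(\<lambda>i'. v i' * w j') = fscale (w j') v" for j' by (auto simp: fscale_def)
      then have "?a (\<lambda>i'. v i' * w j') i = ?a v i * w j'" for j'
        using lin_mapsD(3)[OF la v, of "w j'"] by (simp add: fscale_def mult.commute[of _ "w j'"])
      moreover have "(\<lambda>j'. ?a v i * w j') = fscale (?a v i) w" by (simp add: fscale_def)
      ultimately show ?thesis
        using m Ten True dec lin_mapsD(3)[OF lb w]
        by (simp add: species_ten_def restrict0_def Let_def tensor_map_def pure_def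
            preimage_image[OF s sub(1), simplified] preimage_image[OF s sub(2), simplified] fscale_def)
    next
      case False
      have "act (species_ten V W) X Y s (pure A v B w) l = 0"
      proof (cases "(A', B') \<in> decomp finset_pcm Y")
        case True
        let ?A = "ffilter (\<lambda>x. s x |\<in>| A') X" and ?B = "ffilter (\<lambda>x. s x |\<in>| B') X"
        have AY: "A' |\<subseteq>| Y" "B' |\<subseteq>| Y" using True by (auto simp: decomp_def)
        have ia: "s |`| ?A = A'" and ib: "s |`| ?B = B'"
          by (rule image_preimage[OF s AY(1)], rule image_preimage[OF s AY(2)])
        \<comment> \<open>If the preimages of \<open>A'\<close> and \<open>B'\<close> were
          \<open>A\<close> and \<open>B\<close>, then \<open>A'\<close> and \<open>B'\<close> would
          be the images excluded in this case.\<close>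
        then have neg: "(?A = A \<and> ?B = B) = False" using False by metis
        have z: "pure A v B w (Ten ?A i' ?B j') = 0" for i' j'
          unfolding pure_def ix.case neg by simp
        have subAB: "?A |\<subseteq>| X" "?B |\<subseteq>| X" unfolding less_eq_fset.rep_eq by auto
        have la: "act V ?A A' (restrict s (fset ?A)) \<in> lin_maps (sp V ?A) (sp V A')"
          by (rule species_objD(2)[OF V restrict_bijections[OF s subAB(1)], unfolded ia])
        have lb: "act W ?B B' (restrict s (fset ?B)) \<in> lin_maps (sp W ?B) (sp W B')"
          by (rule species_objD(2)[OF W restrict_bijections[OF s subAB(2)], unfolded ib])
        have "tensor_map (act V ?A A' (restrict s (fset ?A))) (act W ?B B' (restrict s (fset ?B))) (\<lambda>i' j'. 0) i j = 0"
          using lin_maps_zero[OF la] lin_maps_zero[OF lb] unfolding zero_fun_def tensor_map_def by simp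
        then show ?thesis
          using m Ten True z by (simp add: species_ten_def restrict0_def Let_def del: ffilter.rep_eq)
      next
        case False
        then show ?thesis using m Ten by (simp add: species_ten_def restrict0_def)
      qed
      then show ?thesis using False unfolding Ten by (auto simp: pure_def)
    qed
  qed
qed

section \<open>The tensor powers of the generator of the free 2-rig\<close>

lemma fin_space_lines: "fin_space (lines Q x)"
  unfolding fin_space_def lines_span by (rule exI[of _ "if Q x then {ev Pt} else {}"]) auto

lemma sp_const_species: "sp (const_species Q) = lines Q"
  by (auto simp: const_species_def lines_def fun_eq_iff)

lemma act_const_species: "act (const_species Q) X Y s = restrict0 (lines Q X) (\<lambda>v. v)"
  by (auto simp: const_species_def lines_def fun_eq_iff)

lemma species_gen_obj: "species_gen \<in> species_obj"
proof -
  have sub: "fs.subspace (lines Q x)" for Q and x :: "nat fset" by (simp add: lines_span)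
  have e: "lines (\<lambda>X. fcard X = 1) Y = (lines (\<lambda>X. fcard X = 1) X :: (nat fset, 'a) vec set)"
    if "s \<in> bijections X Y" for X Y s
    unfolding lines_def bijections_fcard[OF that] ..
  have 1: "restrict0 (lines (\<lambda>X. fcard X = 1) X) (\<lambda>v. v)
      \<in> lin_maps (lines (\<lambda>X. fcard X = 1) X) (lines (\<lambda>X. fcard X = 1) Y :: (nat fset, 'a) vec set)"
    if "s \<in> bijections X Y" for X Y s
    unfolding e[OF that] by (rule restrict0_id_lin_maps[OF sub])
  have 2: "restrict0 (lines (\<lambda>X. fcard X = 1) X) (\<lambda>v. v :: (nat fset, 'a) vec) =
      restrict0 (lines (\<lambda>X. fcard X = 1) Y) (\<lambda>v. v) \<circ> restrict0 (lines (\<lambda>X. fcard X = 1) X) (\<lambda>v. v)"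
    if "s \<in> bijections X Y" for X Y s
    unfolding e[OF that] by (auto simp: restrict0_def fun_eq_iff)
  have 3: "\<exists>N. \<forall>X. N \<le> fcard X \<longrightarrow> lines (\<lambda>X. fcard X = 1) X = {0 :: (nat fset, 'a) vec}"
    by (rule exI[of _ 2]) (auto simp: lines_def)
  show ?thesis
    unfolding species_gen_def species_obj_def sp_const_species act_const_species mem_Collect_eq
    by (intro conjI allI ballI 3) (rule fin_space_lines refl 1 2 | assumption)+
qed

lemma joins_image: "joins finset_pcm (map (fimage s) ds) = s |`| joins finset_pcm ds"
  unfolding fset_inject[symmetric] by (simp add: joins_finset image_UN)

locale free_rig =
  assumes two_rig_kS: "two_rig (kS_bar :: ('k::field_char_0, 'k species, ('k species, nat fset, 'k) arrow) smlc)"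
begin

sublocale W: word_rig finset_pcm "sp :: 'k species \<Rightarrow> _" species_obj species_maps species_unit species_ten
  "\<lambda>X. fcard X = 1" species_gen "kS_bar :: ('k, 'k species, ('k species, nat fset, 'k) arrow) smlc"
proof (unfold_locales)
  show "kS_bar = conv_rig finset_pcm (sp :: 'k species \<Rightarrow> _) species_obj species_maps species_unit species_ten"
    by (simp add: kS_bar_def)
  show "\<And>A B. compatible finset_pcm A B \<Longrightarrow> compatible finset_pcm B A" by auto
  show "\<And>A B. join finset_pcm A B = join finset_pcm B A" by auto
  show "\<And>A B C. join finset_pcm (join finset_pcm A B) C = join finset_pcm A (join finset_pcm B C)" by auto
  show "\<And>A B C. compatible finset_pcm B C \<Longrightarrow> compatible finset_pcm A (join finset_pcm B C) \<Longrightarrow>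
      compatible finset_pcm A B \<and> compatible finset_pcm (join finset_pcm A B) C"
    by (auto simp: inf_sup_distrib1 inf_sup_distrib2)
  show "sp (species_unit :: 'k species) = lines (\<lambda>x. x = neutral finset_pcm)"
    by (simp add: species_unit_def sp_const_species)
  show "sp (species_gen :: 'k species) = lines (\<lambda>X. fcard X = 1)"
    by (simp add: species_gen_def sp_const_species)
  show "sp (species_ten V W) = conv_sp finset_pcm (sp V) (sp W)" for V W :: "'k species"
    by (simp add: species_ten_def)
  show "h x \<in> lin_maps (sp V x) (sp W x)" if "h \<in> species_maps V W" for V W :: "'k species" and h x
    using that by (simp add: species_maps_def)
  show "species_gen \<in> (species_obj :: 'k species set)" by (rule species_gen_obj)
  show "two_rig (kS_bar :: ('k, 'k species, ('k species, nat fset, 'k) arrow) smlc)" by (rule two_rig_kS)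
qed

abbreviation T :: "nat \<Rightarrow> 'k species" where
  "T n \<equiv> tpow kS_bar species_gen n"

text \<open>The words of \<open>std n\<close> are the permutations, so these vectors form the
  standard basis of the regular representation.\<close>

definition e :: "nat \<Rightarrow> (nat \<Rightarrow> nat) \<Rightarrow> (nat fset, 'k) vec" where
  "e n \<sigma> = ev (wd finset_pcm (lt n \<sigma>))"

lemma T_obj: "T n \<in> species_obj"
  using W.tpow_obj[of species_gen n] species_gen_obj by simp

text \<open>The generator acts by identities, so a bijection changes only the labels of a pure
  tensor.\<close>

lemma act_word:
  "s \<in> bijections X Y \<Longrightarrow> ds \<in> fwords n X \<Longrightarrow>
    act (T n) X Y s (ev (wd finset_pcm ds)) = ev (wd finset_pcm (map (fimage s) ds))"
proof (induction n arbitrary: X Y s ds)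
  case 0
  then have "ds = []" "X = {||}" by (auto simp: words_def)
  then show ?case
    by (simp add: species_unit_def act_const_species restrict0_def lines_span fs.span_base)
next
  case (Suc n)
  obtain d es where ds: "ds = d # es" and d: "fcard d = 1" and es: "es \<in> fwords n (joins finset_pcm es)"
    and dec: "(d, joins finset_pcm es) \<in> decomp finset_pcm X"
    using Suc.prems(2) unfolding words_Suc by blast
  let ?B = "joins finset_pcm es"
  have sub: "d |\<subseteq>| X" "?B |\<subseteq>| X" using dec by (auto simp: decomp_def)
  have "act (T (Suc n)) X Y s (ev (wd finset_pcm ds)) =
      act (species_ten species_gen (T n)) X Y s (pure d (ev Pt) ?B (ev (wd finset_pcm es)))"
    by (simp add: ds ev_Ten)
  also have "\<dots> = pure (s |`| d) (act species_gen d (s |`| d) (restrict s (fset d)) (ev Pt))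
      (s |`| ?B) (act (T n) ?B (s |`| ?B) (restrict s (fset ?B)) (ev (wd finset_pcm es)))"
  proof (rule act_species_ten_pure[OF species_gen_obj T_obj Suc.prems(1) dec])
    show "ev Pt \<in> sp species_gen d"
      using d by (simp add: species_gen_def sp_const_species lines_span fs.span_base)
    show "ev (wd finset_pcm es) \<in> sp (T n) ?B"
      unfolding W.U_tpow by (rule ev_word_in_powsp[OF es])
  qed
  also have "act species_gen d (s |`| d) (restrict s (fset d)) (ev Pt) = ev Pt"
    using d by (simp add: species_gen_def act_const_species restrict0_def lines_span fs.span_base)
  also have "act (T n) ?B (s |`| ?B) (restrict s (fset ?B)) (ev (wd finset_pcm es)) =
      ev (wd finset_pcm (map (fimage (restrict s (fset ?B))) es))"
    by (rule Suc.IH[OF restrict_bijections[OF Suc.prems(1) sub(2)] es])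
  also have "map (fimage (restrict s (fset ?B))) es = map (fimage s) es"
    unfolding map_eq_conv
  proof
    fix A assume "A \<in> set es"
    then have "fset A \<subseteq> fset ?B" unfolding joins_finset by blast
    then show "restrict s (fset ?B) |`| A = s |`| A"
      unfolding fset_inject[symmetric] by (auto simp: image_iff subset_iff)
  qed
  finally show ?case by (simp add: ds ev_Ten joins_image)
qed

lemma sp_T: "sp (T n) (std n) = fs.span (e n ` {\<sigma>. \<sigma> permutes {..<n}})"
  unfolding W.U_tpow powsp_span fwords_std image_image e_def ..

lemma sp_T_other:
  assumes "m \<noteq> n"
  shows "sp (T m) (std n) = {0}"
  unfolding W.U_tpow powsp_span fwords_other[OF assms] by simp

lemma e_in_T: "\<sigma> permutes {..<n} \<Longrightarrow> e n \<sigma> \<in> sp (T n) (std n)"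
  unfolding sp_T by (rule fs.span_base) blast

lemma e_coord:
  "\<sigma> permutes {..<n} \<Longrightarrow> \<tau> permutes {..<n} \<Longrightarrow>
    e n \<sigma> (wd finset_pcm (lt n \<tau>)) = (if \<sigma> = \<tau> then 1 else 0)"
  unfolding e_def ev_def wd_inject using lt_inject[of \<sigma> n \<tau>] by auto

lemma sact_e:
  assumes "\<tau> permutes {..<n}" "\<sigma> permutes {..<n}"
  shows "sact (T n) n \<tau> (e n \<sigma>) = e n (\<tau> \<circ> \<sigma>)"
proof -
  have m: "lt n \<sigma> \<in> fwords n (std n)" unfolding fwords_std using assms(2) by blast
  have "map (fimage (restrict \<tau> {..<n})) (lt n \<sigma>) = lt n (\<tau> \<circ> \<sigma>)"
    unfolding lt_def using permutes_in_image[OF assms(2)] by simp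
  then show ?thesis
    unfolding sact_def e_def using act_word[OF permutes_bijections[OF assms(1)] m] by simp
qed

section \<open>Arrows out of and into the tensor powers\<close>

lemma zero_equivariant:
  assumes "V \<in> species_obj" "W \<in> species_obj"
  shows "equivariant {..<n} (sp V (std n)) (sact V n) (sact W n) (\<lambda>v. 0)"
  unfolding equivariant_def using lin_maps_zero[OF is_repD(3)[OF sact_rep[OF assms(2)]]] by auto

lemma zero_lin_maps: "fs.subspace W \<Longrightarrow> (\<lambda>v. 0) \<in> lin_maps V W"
  unfolding lin_maps_def using fs.subspace_0 by auto

text \<open>The regular representation is free on \<open>e n id\<close>, so this vector can be sent
  to any \<open>v\<close>.\<close>

lemma theta_exists:
  assumes V: "V \<in> species_obj" and v: "v \<in> sp V (std n)"
  obtains \<theta> where "\<theta> \<in> species_maps (T n) V"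
    "\<And>\<sigma>. \<sigma> permutes {..<n} \<Longrightarrow> \<theta> (std n) (e n \<sigma>) = sact V n \<sigma> v"
proof -
  let ?G = "{\<sigma>. \<sigma> permutes {..<n}}"
  have finG: "finite ?G" by (rule finite_permutations) simp
  note rV = sact_rep[OF V, of n] and rT = sact_rep[OF T_obj[of n], of n]
  note sV = is_repD(2)[OF rV] and sT = is_repD(2)[OF rT]
  \<comment> \<open>The coordinates of a vector in the basis \<open>e n \<sigma>\<close> are its
    values at the words, so this is the linear extension of the wanted values.\<close>
  define h0 where "h0 = restrict0 (sp (T n) (std n))
    (\<lambda>t. \<Sum>\<sigma>\<in>?G. fscale (t (wd finset_pcm (lt n \<sigma>))) (sact V n \<sigma> v))"
  have h0: "h0 \<in> lin_maps (sp (T n) (std n)) (sp V (std n))"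
  proof -
    have "(\<Sum>\<sigma>\<in>?G. fscale (t (wd finset_pcm (lt n \<sigma>))) (sact V n \<sigma> v)) \<in> sp V (std n)" for t
      using is_repD(6)[OF rV _ v] sV by (intro fs.subspace_sum) (auto intro: fs.subspace_scale)
    then show ?thesis
      unfolding h0_def lin_maps_def restrict0_def
      using fs.subspace_add[OF sT] fs.subspace_scale[OF sT]
      by (auto simp: fs.scale_left_distrib sum.distrib fs.scale_sum_right fscale_def[of _ "_ :: (nat fset, 'k) vec", THEN fun_cong])
  qed
  have he: "h0 (e n \<sigma>) = sact V n \<sigma> v" if \<sigma>: "\<sigma> permutes {..<n}" for \<sigma>
  proof -
    have "h0 (e n \<sigma>) = (\<Sum>\<tau>\<in>?G. fscale (if \<sigma> = \<tau> then 1 else 0) (sact V n \<tau> v))"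
      using e_in_T[OF \<sigma>] e_coord[OF \<sigma>] by (simp add: h0_def restrict0_def)
    also have "\<dots> = (\<Sum>\<tau>\<in>?G. if \<sigma> = \<tau> then sact V n \<tau> v else 0)"
      by (rule sum.cong) auto
    also have "\<dots> = sact V n \<sigma> v" using \<sigma> finG by simp
    finally show ?thesis .
  qed
  have h0e: "equivariant {..<n} (sp (T n) (std n)) (sact (T n) n) (sact V n) h0"
    unfolding equivariant_def
  proof (intro allI impI ballI)
    fix \<tau> t assume \<tau>: "\<tau> permutes {..<n}" and t: "t \<in> sp (T n) (std n)"
    have "(h0 \<circ> sact (T n) n \<tau>) t = (sact V n \<tau> \<circ> h0) t"
    proof (rule lin_maps_eq_on_span[OF lin_maps_comp[OF is_repD(3)[OF rT \<tau>] h0]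
          lin_maps_comp[OF h0 is_repD(3)[OF rV \<tau>]] sp_T _ t])
      fix x assume "x \<in> e n ` ?G"
      then obtain \<sigma> where \<sigma>: "\<sigma> permutes {..<n}" "x = e n \<sigma>" by blast
      show "(h0 \<circ> sact (T n) n \<tau>) x = (sact V n \<tau> \<circ> h0) x"
        using he[OF \<sigma>(1)] he[OF permutes_compose[OF \<sigma>(1) \<tau>]] is_repD(5)[OF rV \<tau> \<sigma>(1) v]
        by (simp add: \<sigma>(2) sact_e[OF \<tau> \<sigma>(1)])
    qed
    then show "h0 (sact (T n) n \<tau> t) = sact V n \<tau> (h0 t)" by simp
  qed
  \<comment> \<open>The power vanishes at all other standard sets, which leaves no choice
    there.\<close>
  define h where "h m = (if m = n then h0 else (\<lambda>v. 0))" for m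
  have "h m \<in> lin_maps (sp (T n) (std m)) (sp V (std m))" for m
    by (simp add: h_def h0 zero_lin_maps[OF species_objD(6)[OF V]])
  moreover have "equivariant {..<m} (sp (T n) (std m)) (sact (T n) m) (sact V m) (h m)" for m
    using h0e zero_equivariant[OF T_obj V] by (simp add: h_def)
  ultimately obtain \<theta> where \<theta>: "\<theta> \<in> species_maps (T n) V"
    "\<And>m t. t \<in> sp (T n) (std m) \<Longrightarrow> \<theta> (std m) t = h m t"
    using species_map_extend[OF T_obj V, of h] by metis
  show ?thesis
    by (rule that[OF \<theta>(1)]) (simp add: \<theta>(2) e_in_T h_def he)
qed

text \<open>The regular representation is also coinduced from the trivial group: a functional
  extends to an equivariant map whose coefficient at \<open>\<sigma>\<close> is the functional after
  the action of \<open>inv \<sigma>\<close>.\<close>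

lemma psi_exists:
  assumes V: "V \<in> species_obj" and \<xi>: "functional (sp V (std n)) \<xi>"
  obtains \<psi> where "\<psi> \<in> species_maps V (T n)"
    "\<And>w. w \<in> sp V (std n) \<Longrightarrow> \<psi> (std n) w = (\<Sum>\<sigma> | \<sigma> permutes {..<n}. fscale (\<xi> (sact V n (inv \<sigma>) w)) (e n \<sigma>))"
proof -
  let ?G = "{\<sigma>. \<sigma> permutes {..<n}}"
  note rV = sact_rep[OF V, of n] and rT = sact_rep[OF T_obj[of n], of n]
  note sV = is_repD(2)[OF rV] and sT = is_repD(2)[OF rT]
  define h0 where "h0 = restrict0 (sp V (std n)) (\<lambda>w. \<Sum>\<sigma>\<in>?G. fscale (\<xi> (sact V n (inv \<sigma>) w)) (e n \<sigma>))"
  have add: "\<xi> (sact V n (inv \<sigma>) (u + w)) = \<xi> (sact V n (inv \<sigma>) u) + \<xi> (sact V n (inv \<sigma>) w)"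
    and scale: "\<xi> (sact V n (inv \<sigma>) (fscale c w)) = c * \<xi> (sact V n (inv \<sigma>) w)"
    if "\<sigma> permutes {..<n}" "u \<in> sp V (std n)" "w \<in> sp V (std n)" for \<sigma> u w c
    using functional_comp[OF \<xi> is_repD(3)[OF rV permutes_inv[OF that(1)]]] that(2,3)
    unfolding functional_def by auto
  have h0: "h0 \<in> lin_maps (sp V (std n)) (sp (T n) (std n))"
  proof -
    have "(\<Sum>\<sigma>\<in>?G. fscale (\<xi> (sact V n (inv \<sigma>) w)) (e n \<sigma>)) \<in> sp (T n) (std n)" for w
      using e_in_T sT by (intro fs.subspace_sum) (auto intro: fs.subspace_scale)
    then show ?thesis
      unfolding h0_def lin_maps_def restrict0_def
      using fs.subspace_add[OF sV] fs.subspace_scale[OF sV]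
      by (auto simp: add scale fs.scale_left_distrib sum.distrib fs.scale_sum_right)
  qed
  have h0e: "equivariant {..<n} (sp V (std n)) (sact V n) (sact (T n) n) h0"
    unfolding equivariant_def
  proof (intro allI impI ballI)
    fix \<tau> w assume \<tau>: "\<tau> permutes {..<n}" and w: "w \<in> sp V (std n)"
    have "h0 (sact V n \<tau> w) = (\<Sum>\<sigma>\<in>?G. fscale (\<xi> (sact V n (inv \<sigma>) (sact V n \<tau> w))) (e n \<sigma>))"
      using is_repD(6)[OF rV \<tau> w] by (simp add: h0_def restrict0_def)
    also have "\<dots> = (\<Sum>\<sigma>\<in>?G. fscale (\<xi> (sact V n (inv (\<tau> \<circ> \<sigma>)) (sact V n \<tau> w))) (e n (\<tau> \<circ> \<sigma>)))"
      by (rule setum_permutations_compose_left[OF \<tau>])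
    also have "\<dots> = (\<Sum>\<sigma>\<in>?G. fscale (\<xi> (sact V n (inv \<sigma>) w)) (sact (T n) n \<tau> (e n \<sigma>)))"
    proof (rule sum.cong)
      fix \<sigma> assume "\<sigma> \<in> ?G"
      then have \<sigma>: "\<sigma> permutes {..<n}" by simp
      have i: "inv (\<tau> \<circ> \<sigma>) = inv \<sigma> \<circ> inv \<tau>"
        by (rule o_inv_distrib) (use \<sigma> \<tau> permutes_bij in auto)
      have "sact V n (inv (\<tau> \<circ> \<sigma>)) (sact V n \<tau> w) = sact V n (inv \<sigma>) w"
        unfolding i is_repD(5)[OF rV permutes_inv[OF \<sigma>] permutes_inv[OF \<tau>] is_repD(6)[OF rV \<tau> w]]
          is_repD(8)[OF rV \<tau> w] ..
      then show "fscale (\<xi> (sact V n (inv (\<tau> \<circ> \<sigma>)) (sact V n \<tau> w))) (e n (\<tau> \<circ> \<sigma>)) =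
          fscale (\<xi> (sact V n (inv \<sigma>) w)) (sact (T n) n \<tau> (e n \<sigma>))"
        using sact_e[OF \<tau> \<sigma>] by simp
    qed simp
    also have "\<dots> = sact (T n) n \<tau> (h0 w)"
      unfolding h0_def restrict0_def if_P[OF w]
      by (rule lin_map_sum[OF is_repD(3)[OF rT \<tau>] sT, symmetric]) (simp add: e_in_T)
    finally show "h0 (sact V n \<tau> w) = sact (T n) n \<tau> (h0 w)" .
  qed
  define h where "h m = (if m = n then h0 else (\<lambda>v. 0))" for m
  have "h m \<in> lin_maps (sp V (std m)) (sp (T n) (std m))" for m
    by (simp add: h_def h0 zero_lin_maps[OF species_objD(6)[OF T_obj]])
  moreover have "equivariant {..<m} (sp V (std m)) (sact V m) (sact (T n) m) (h m)" for m
    using h0e zero_equivariant[OF V T_obj] by (simp add: h_def)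
  ultimately obtain \<psi> where \<psi>: "\<psi> \<in> species_maps V (T n)"
    "\<And>m t. t \<in> sp V (std m) \<Longrightarrow> \<psi> (std m) t = h m t"
    using species_map_extend[OF V T_obj, of h] by metis
  show ?thesis
    by (rule that[OF \<psi>(1)]) (simp add: \<psi>(2) h_def h0_def restrict0_def)
qed

lemma T_map_unique:
  assumes V: "V \<in> species_obj" and f: "f \<in> species_maps (T n) V" and g: "g \<in> species_maps (T n) V"
    and eq: "\<And>\<sigma>. \<sigma> permutes {..<n} \<Longrightarrow> f (std n) (e n \<sigma>) = g (std n) (e n \<sigma>)"
  shows "f = g"
proof (rule species_map_unique[OF T_obj f g])
  fix m t assume t: "t \<in> sp (T n) (std m)"
  have lf: "f (std m) \<in> lin_maps (sp (T n) (std m)) (sp V (std m))"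
    and lg: "g (std m) \<in> lin_maps (sp (T n) (std m)) (sp V (std m))"
    using f g unfolding species_maps_def by auto
  show "f (std m) t = g (std m) t"
  proof (cases "m = n")
    case True
    show ?thesis
      using lin_maps_eq_on_span[OF lf[unfolded True] lg[unfolded True] sp_T _ t[unfolded True]] eq True by blast
  next
    case False
    then have "t = 0" using t sp_T_other[of n m] by simp
    then show ?thesis using lin_maps_zero[OF lf] lin_maps_zero[OF lg] by simp
  qed
qed

lemma species_map_equivariant:
  assumes "f \<in> species_maps V W" "\<sigma> permutes {..<n}"
  shows "f (std n) (sact V n \<sigma> v) = sact W n \<sigma> (f (std n) v)"
  using assms(1) permutes_bijections[OF assms(2)] unfolding species_maps_def sact_def
  by (auto simp: fun_eq_iff)

end

section \<open>Sequences\<close>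

lemma seq_simps [simp]: "compatible seq_pcm a b" "join seq_pcm a b = a + b" "neutral seq_pcm = 0"
  by (simp_all add: seq_pcm_def)

lemma weight_superset:
  "finite S \<Longrightarrow> Poly_Mapping.keys a \<subseteq> S \<Longrightarrow> weight a = (\<Sum>i\<in>S. Poly_Mapping.lookup a i)"
  unfolding weight_def by (rule sum.mono_neutral_left) (auto simp: in_keys_iff)

lemma weight_add: "weight (a + b) = weight a + weight b"
proof -
  let ?S = "Poly_Mapping.keys a \<union> Poly_Mapping.keys b"
  have "Poly_Mapping.keys (a + b) \<subseteq> ?S" by (rule Poly_Mapping.keys_add)
  then show ?thesis
    using weight_superset[of ?S a] weight_superset[of ?S b] weight_superset[of ?S "a + b"]
    by (simp add: lookup_add sum.distrib)
qed

lemma weight_1_iff: "weight a = Suc 0 \<longleftrightarrow> (\<exists>i. a = Poly_Mapping.single i 1)"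
proof
  assume w: "weight a = Suc 0"
  then obtain i where i: "i \<in> Poly_Mapping.keys a" "Poly_Mapping.lookup a i = 1"
    "\<forall>j\<in>Poly_Mapping.keys a. i \<noteq> j \<longrightarrow> Poly_Mapping.lookup a j = 0"
    unfolding weight_def using sum_eq_1_iff[OF finite_keys, of "Poly_Mapping.lookup a" a] by auto
  have "a = Poly_Mapping.single i 1"
  proof (rule poly_mapping_eqI)
    fix j show "Poly_Mapping.lookup a j = Poly_Mapping.lookup (Poly_Mapping.single i 1) j"
      using i by (cases "j \<in> Poly_Mapping.keys a") (auto simp: lookup_single when_def in_keys_iff)
  qed
  then show "\<exists>i. a = Poly_Mapping.single i 1" ..
qed (auto simp: weight_def)

abbreviation "swords \<equiv> words seq_pcm (\<lambda>a. weight a = Suc 0)"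

lemma compats_seq [simp]: "compats seq_pcm ds"
  by (induction ds) auto

lemma joins_seq: "joins seq_pcm ds = sum_list ds"
  by (induction ds) auto

lemma swords_iff: "ds \<in> swords n a \<longleftrightarrow> length ds = n \<and> (\<forall>d\<in>set ds. weight d = Suc 0) \<and> sum_list ds = a"
  by (simp add: words_def joins_seq)

text \<open>Keeps the powers of \<open>s\<close> apart: a given degree contains words of one length
  only.\<close>

lemma swords_weight: "ds \<in> swords n a \<Longrightarrow> weight a = n"
proof (induction ds arbitrary: n a)
  case Nil
  then show ?case by (simp add: swords_iff) (simp add: weight_def)
next
  case (Cons d ds)
  then have "ds \<in> swords (length ds) (sum_list ds)" "weight d = Suc 0" "a = d + sum_list ds" "n = Suc (length ds)"
    by (auto simp: swords_iff)
  then show ?case using Cons.IH[of "length ds" "sum_list ds"] by (simp only: weight_add)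
qed

lemma count_letters:
  "\<forall>d\<in>set ds. weight d = Suc 0 \<Longrightarrow>
    count (mset ds) (Poly_Mapping.single i 1) = Poly_Mapping.lookup (sum_list ds) i"
proof (induction ds)
  case (Cons d ds)
  obtain j where j: "d = Poly_Mapping.single j 1" using Cons.prems weight_1_iff[of d] by auto
  have "d = Poly_Mapping.single i 1 \<longleftrightarrow> i = j"
    unfolding j by (metis lookup_single_eq lookup_single_not_eq one_neq_zero)
  then show ?case
    using Cons j by (auto simp: lookup_add lookup_single when_def)
qed simp

text \<open>Letters are unit sequences, so the sum of a word records how often each letter
  occurs.\<close>

lemma swords_mset:
  assumes "ds \<in> swords n a"
  shows "ds' \<in> swords n a \<longleftrightarrow> mset ds' = mset ds"
proof
  assume ds': "ds' \<in> swords n a"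
  show "mset ds' = mset ds"
  proof (rule multiset_eqI)
    fix d
    show "count (mset ds') d = count (mset ds) d"
    proof (cases "weight d = Suc 0")
      case True
      then obtain i where "d = Poly_Mapping.single i 1" using weight_1_iff by blast
      then show ?thesis using count_letters[of ds i] count_letters[of ds' i] assms ds' by (simp add: swords_iff)
    next
      case False
      then have "d \<notin> set ds" "d \<notin> set ds'" using assms ds' by (auto simp: swords_iff)
      then show ?thesis using count_mset_0_iff by metis
    qed
  qed
next
  assume m: "mset ds' = mset ds"
  then have "sum_list ds' = sum_list ds" by (metis sum_mset_sum_list)
  then show "ds' \<in> swords n a"
    using assms mset_eq_setD[OF m] mset_eq_length[OF m] by (simp add: swords_iff)
qed

lemma finite_swords: "finite (swords n a)"
proof (cases "swords n a = {}")
  case False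
  then obtain ds where ds: "ds \<in> swords n a" by blast
  have "swords n a \<subseteq> {ds'. set ds' \<subseteq> set ds \<and> length ds' = length ds}"
  proof
    fix ds' assume "ds' \<in> swords n a"
    then have m: "mset ds' = mset ds" using swords_mset[OF ds] by simp
    show "ds' \<in> {ds'. set ds' \<subseteq> set ds \<and> length ds' = length ds}"
      using mset_eq_setD[OF m] mset_eq_length[OF m] by simp
  qed
  then show ?thesis by (rule finite_subset) (simp add: finite_lists_length_eq)
qed simp

section \<open>Generation of permutations by adjacent swaps\<close>

lemma permutes_fixing_0:
  assumes \<tau>: "\<tau> permutes {..<Suc n}" and 0: "\<tau> 0 = 0"
  obtains \<tau>' where "\<tau>' permutes {..<n}" "lift_perm \<tau>' = \<tau>"
proof -
  have inj: "inj \<tau>" by (rule permutes_inj[OF \<tau>])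
  define \<tau>' where "\<tau>' i = \<tau> (Suc i) - 1" for i
  have s: "\<tau> (Suc i) = Suc (\<tau>' i)" for i
    using injD[OF inj, of "Suc i" 0] 0 by (cases "\<tau> (Suc i)") (auto simp: \<tau>'_def)
  have "inj \<tau>'" using s injD[OF inj] by (metis injI nat.inject)
  then have i: "inj_on \<tau>' {..<n}" by (rule inj_on_subset) simp
  have "\<tau>' ` {..<n} \<subseteq> {..<n}"
    using s permutes_in_image[OF \<tau>, of "Suc _"] by (auto simp: image_subset_iff)
  then have "\<tau>' ` {..<n} = {..<n}" by (rule endo_inj_surj[OF finite_lessThan _ i])
  then have "bij_betw \<tau>' {..<n} {..<n}" using i by (simp add: bij_betw_def)
  moreover have "\<tau>' j = j" if "j \<notin> {..<n}" for j
    using s[of j] permutes_not_in[OF \<tau>, of "Suc j"] that by simp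
  ultimately have "\<tau>' permutes {..<n}" by (rule bij_imp_permutes)
  moreover have "lift_perm \<tau>' = \<tau>"
    by (rule ext) (simp add: lift_perm_def 0 s split: nat.split)
  ultimately show ?thesis by (rule that)
qed

text \<open>Adapted to right-nested powers, where only exchanging the first two factors and
  tensoring with an identity on the left are available. Permutations fixing \<open>0\<close> come
  from the shorter power, and a transposition with \<open>0\<close> splits off the rest.\<close>

lemma perm_generation:
  assumes id: "\<And>n. H n id"
    and cmp: "\<And>n \<sigma> \<tau>. \<sigma> permutes {..<n} \<Longrightarrow> \<tau> permutes {..<n} \<Longrightarrow> H n \<sigma> \<Longrightarrow> H n \<tau> \<Longrightarrow> H n (\<sigma> \<circ> \<tau>)"
    and lift: "\<And>n \<sigma>. \<sigma> permutes {..<n} \<Longrightarrow> H n \<sigma> \<Longrightarrow> H (Suc n) (lift_perm \<sigma>)"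
    and swap: "\<And>n. H (Suc (Suc n)) (transpose 0 1)"
  shows "\<sigma> permutes {..<n} \<Longrightarrow> H n \<sigma>"
proof (induction n arbitrary: \<sigma>)
  case 0
  then have "\<sigma> = id" by simp
  then show ?case using id by (simp only:)
next
  case (Suc n)
  have fixed: "H (Suc n) \<tau>" if \<tau>: "\<tau> permutes {..<Suc n}" "\<tau> 0 = 0" for \<tau>
  proof -
    obtain \<tau>' where "\<tau>' permutes {..<n}" "lift_perm \<tau>' = \<tau>" using permutes_fixing_0[OF \<tau>] .
    then show ?thesis using lift Suc.IH by blast
  qed
  have transp: "H (Suc n) (transpose 0 (Suc j))" if j: "j < n" for j
  proof -
    obtain m where m: "n = Suc m" using j by (cases n) auto
    have 01: "transpose 0 1 permutes {..<Suc n}" by (rule permutes_swap_id) (auto simp: m)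
    show ?thesis
    proof (cases "j = 0")
      case True
      then show ?thesis using swap m by simp
    next
      case False
      have t: "transpose 1 (Suc j) permutes {..<Suc n}" by (rule permutes_swap_id) (use j m in auto)
      have "H (Suc n) (transpose 1 (Suc j))" by (rule fixed[OF t]) simp
      \<comment> \<open>Conjugating the basic swap by a transposition that fixes \<open>0\<close>
        turns it into the exchange of \<open>0\<close> and \<open>Suc j\<close>.\<close>
      then have "H (Suc n) (transpose 1 (Suc j) \<circ> (transpose 0 1 \<circ> transpose 1 (Suc j)))"
        using cmp t 01 permutes_compose[OF t 01] swap m by simp
      also have "transpose 1 (Suc j) \<circ> (transpose 0 1 \<circ> transpose 1 (Suc j)) = transpose 0 (Suc j)"
        using False by (auto simp: fun_eq_iff transpose_def)
      finally show ?thesis .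
    qed
  qed
  show ?case
  proof (cases "\<sigma> 0")
    case 0
    then show ?thesis using fixed Suc.prems by blast
  next
    case (Suc j)
    have j: "j < n" using permutes_in_image[OF Suc.prems, of 0] Suc by simp
    let ?t = "transpose 0 (Suc j)"
    have t: "?t permutes {..<Suc n}" by (rule permutes_swap_id) (use j in auto)
    have t\<sigma>: "?t \<circ> \<sigma> permutes {..<Suc n}" by (rule permutes_compose[OF Suc.prems t])
    \<comment> \<open>\<open>?t\<close> takes \<open>\<sigma> 0\<close> back to \<open>0\<close>, so
      \<open>?t \<circ> \<sigma>\<close> is covered by \<open>fixed\<close>, and \<open>?t\<close>
      is its own inverse.\<close>
    have "H (Suc n) (?t \<circ> (?t \<circ> \<sigma>))"
      using cmp[OF t t\<sigma> transp[OF j] fixed[OF t\<sigma>]] Suc by simp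
    then show ?thesis by (simp add: o_assoc)
  qed
qed

section \<open>Linear combinations of arrows\<close>

context rig
begin

lemma zer_hom: "a \<in> obj C \<Longrightarrow> b \<in> obj C \<Longrightarrow> zer C a b \<in> hom C a b"
  and scl_0: "a \<in> obj C \<Longrightarrow> b \<in> obj C \<Longrightarrow> f \<in> hom C a b \<Longrightarrow> scl C 0 f = zer C a b"
  and add_hom: "a \<in> obj C \<Longrightarrow> b \<in> obj C \<Longrightarrow> f \<in> hom C a b \<Longrightarrow> g \<in> hom C a b \<Longrightarrow> add C f g \<in> hom C a b"
  and scl_hom: "a \<in> obj C \<Longrightarrow> b \<in> obj C \<Longrightarrow> f \<in> hom C a b \<Longrightarrow> scl C c f \<in> hom C a b"
  using linear_category[unfolded is_linear_category_def, THEN conjunct2, THEN conjunct1] by blast+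

end

lemma (in word_rig) comp_at_linear:
  "comp_at (zer C V W) x v = 0"
  "comp_at (add C f g) x v = comp_at f x v + comp_at g x v"
  "comp_at (scl C c f) x v = fscale c (comp_at f x v)"
  by (simp_all add: C_def conv_rig_def)

lemma arrow_eqI: "src f = src g \<Longrightarrow> tgt f = tgt g \<Longrightarrow> comp_at f = comp_at g \<Longrightarrow> f = (g :: ('o, 'd, 'k) arrow)"
  by simp

lemma s_sum_lines: "s_sum = lines (\<lambda>a. weight a = Suc 0)"
  by (auto simp: s_sum_def lines_def fun_eq_iff)

section \<open>The extension theorem\<close>

locale ext_setup =
  fixes F :: "('k::field_char_0 species, ('k species, nat fset, 'k) arrow,
                'k family, ('k family, nat \<Rightarrow>\<^sub>0 nat, 'k) arrow) smfun" and u
  assumes map: "two_rig_map kS_bar A_infinity F"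
    and u: "iso_arrow A_infinity s_sum (fo F species_gen) u"
begin

sublocale free_rig
  by standard (use map in \<open>simp add: two_rig_map_def\<close>)

sublocale A: word_rig seq_pcm "\<lambda>V :: 'k family. V" family_obj family_maps family_unit "conv_sp seq_pcm"
  "\<lambda>a. weight a = Suc 0" s_sum "A_infinity :: ('k, 'k family, ('k family, nat \<Rightarrow>\<^sub>0 nat, 'k) arrow) smlc"
proof (unfold_locales)
  show "(A_infinity :: ('k, 'k family, ('k family, nat \<Rightarrow>\<^sub>0 nat, 'k) arrow) smlc) =
      conv_rig seq_pcm (\<lambda>V. V) family_obj family_maps family_unit (conv_sp seq_pcm)"
    by (simp add: A_infinity_def)
  show "join seq_pcm a b = join seq_pcm b a" for a b by (simp add: add.commute)
  show "join seq_pcm (join seq_pcm a b) c = join seq_pcm a (join seq_pcm b c)" for a b c by (simp add: add.assoc)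
  show "(family_unit :: 'k family) = lines (\<lambda>x. x = neutral seq_pcm)"
    by (auto simp: family_unit_def lines_def fun_eq_iff)
  show "(s_sum :: 'k family) = lines (\<lambda>a. weight a = Suc 0)" by (rule s_sum_lines)
  show "h x \<in> lin_maps (V x) (W x)" if "h \<in> family_maps V W" for V W :: "'k family" and h x
    using that by (simp add: family_maps_def)
  show "(s_sum :: 'k family) \<in> family_obj"
    unfolding family_obj_def s_sum_lines mem_Collect_eq
    by (intro conjI allI fin_space_lines exI[of _ 2]) (auto simp: lines_def)
  show "two_rig (A_infinity :: ('k, 'k family, ('k family, nat \<Rightarrow>\<^sub>0 nat, 'k) arrow) smlc)"
    using map by (simp add: two_rig_map_def)
qed simp_all

sublocale R: rig_map kS_bar A_infinity F species_gen s_sum u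
proof
  show "two_rig_map kS_bar A_infinity F" by (rule map)
  show "cmp A_infinity h (cmp A_infinity g f) = cmp A_infinity (cmp A_infinity h g) f" for f g h :: "('k family, nat \<Rightarrow>\<^sub>0 nat, 'k) arrow"
    by (simp add: A_infinity_def conv_rig_def o_assoc)
  show "species_gen \<in> obj (kS_bar :: ('k, 'k species, ('k species, nat fset, 'k) arrow) smlc)"
    by (simp add: species_gen_obj)
  show "s_sum \<in> obj (A_infinity :: ('k, 'k family, ('k family, nat \<Rightarrow>\<^sub>0 nat, 'k) arrow) smlc)"
    using A.r_obj by simp
  show "iso_arrow A_infinity s_sum (fo F species_gen) u" by (rule u)
qed

abbreviation "KS \<equiv> kS_bar :: ('k, 'k species, ('k species, nat fset, 'k) arrow) smlc"
abbreviation "AI \<equiv> A_infinity :: ('k, 'k family, ('k family, nat \<Rightarrow>\<^sub>0 nat, 'k) arrow) smlc"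

definition Fa :: "('k species, nat fset, 'k) arrow \<Rightarrow> (nat \<Rightarrow>\<^sub>0 nat) \<Rightarrow> (nat \<Rightarrow>\<^sub>0 nat, 'k) vec \<Rightarrow> (nat \<Rightarrow>\<^sub>0 nat, 'k) vec" where
  "Fa f = comp_at (fa F f)"

lemma Fa_lin:
  assumes "V \<in> species_obj" "W \<in> species_obj" "f \<in> hom KS V W"
  shows "Fa f a \<in> lin_maps (fo F V a) (fo F W a)"
  unfolding Fa_def by (rule A.hom_lin[OF R.fa_hom]) (use assms in \<open>simp_all del: W.C_simps(4)\<close>)

lemma Fa_cmp:
  assumes "V \<in> species_obj" "W \<in> species_obj" "X \<in> species_obj" "f \<in> hom KS V W" "g \<in> hom KS W X"
  shows "Fa (cmp KS g f) a = Fa g a \<circ> Fa f a"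
  unfolding Fa_def using R.fa_cmp[of V W X f g] assms by (simp del: W.C_simps(4))

lemma Fa_ide: "V \<in> species_obj \<Longrightarrow> Fa (ide KS V) a = restrict0 (fo F V a) (\<lambda>v. v)"
  unfolding Fa_def using R.fa_ide[of V] by simp

lemma F_fin_space: "V \<in> species_obj \<Longrightarrow> fin_space (fo F V a)"
  using R.fo_obj[of V] by (simp add: family_obj_def)

text \<open>Records the components of the combination both before and after applying
  \<open>F\<close>, so that later arguments deal with sums of functions rather than with abstract
  operations on arrows.\<close>

lemma lin_comb:
  assumes "finite I" and V: "V \<in> species_obj" and W: "W \<in> species_obj"
    and "\<forall>i\<in>I. f i \<in> hom KS V W"
  shows "\<exists>g. g \<in> hom KS V W \<and> (\<forall>X v. comp_at g X v = (\<Sum>i\<in>I. fscale (c i) (comp_at (f i) X v))) \<and>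
    (\<forall>a t. Fa g a t = (\<Sum>i\<in>I. fscale (c i) (Fa (f i) a t)))"
  using assms(1,4)
proof (induction I rule: finite_induct)
  case empty
  have o: "V \<in> obj KS" "W \<in> obj KS" using V W by simp_all
  have z: "zer KS V W \<in> hom KS V W" by (rule W.zer_hom[OF o])
  \<comment> \<open>The zero arrow is \<open>0\<close> times itself, and \<open>F\<close> respects
    scalars.\<close>
  have "Fa (zer KS V W) a t = 0" for a t
    using R.fa_scl[OF o z, of 0] W.scl_0[OF o z] A.comp_at_linear(3)[of 0 "fa F (zer KS V W)" a t]
    by (simp add: Fa_def)
  then show ?case using z W.comp_at_linear(1)[of V W] by (intro exI[of _ "zer KS V W"]) (simp del: W.C_simps(4))
next
  case (insert i I)
  have "\<forall>j\<in>I. f j \<in> hom KS V W" using insert.prems by blast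
  from insert.IH[OF this] obtain g where g: "g \<in> hom KS V W"
    and "\<forall>X v. comp_at g X v = (\<Sum>i\<in>I. fscale (c i) (comp_at (f i) X v))"
    and "\<forall>a t. Fa g a t = (\<Sum>i\<in>I. fscale (c i) (Fa (f i) a t))"
    by (elim exE conjE)
  note g = g this(2,3)[rule_format]
  have o: "V \<in> obj KS" "W \<in> obj KS" using V W by simp_all
  have fi: "f i \<in> hom KS V W" using insert.prems by blast
  have s: "scl KS (c i) (f i) \<in> hom KS V W" by (rule W.scl_hom[OF o fi])
  let ?g = "add KS (scl KS (c i) (f i)) g"
  have h: "?g \<in> hom KS V W" by (rule W.add_hom[OF o s g(1)])
  have "comp_at ?g X v = (\<Sum>i\<in>insert i I. fscale (c i) (comp_at (f i) X v))" for X v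
    unfolding sum.insert[OF insert.hyps] W.comp_at_linear g(2) ..
  moreover have "Fa ?g a t = (\<Sum>i\<in>insert i I. fscale (c i) (Fa (f i) a t))" for a t
    unfolding sum.insert[OF insert.hyps] Fa_def R.fa_add[OF o s g(1)] R.fa_scl[OF o fi]
      A.comp_at_linear g(3)[unfolded Fa_def] ..
  ultimately show ?case using h by blast
qed

subsection \<open>Permutations\<close>

text \<open>The arrows of both categories are built in parallel along
  \<open>perm_generation\<close>, so that \<open>F\<close> matches them by construction and no
  coherence theorem is required.\<close>

definition perm_pair :: "nat \<Rightarrow> (nat \<Rightarrow> nat) \<Rightarrow> ('k species, nat fset, 'k) arrow \<times> ('k family, nat \<Rightarrow>\<^sub>0 nat, 'k) arrow \<Rightarrow> bool" where
  "perm_pair n \<sigma> fg \<longleftrightarrow> R.transports n (fst fg) (snd fg) \<and>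
     W.permutes_words n \<sigma> (fst fg) \<and> A.permutes_words n \<sigma> (snd fg)"

lemma perm_pair_exists: "\<sigma> permutes {..<n} \<Longrightarrow> \<exists>fg. perm_pair n \<sigma> fg"
proof (rule perm_generation[where H="\<lambda>n \<sigma>. \<exists>fg. perm_pair n \<sigma> fg"])
  show "\<exists>fg. perm_pair n id fg" for n
    unfolding perm_pair_def using R.transports_ide W.permutes_words_ide A.permutes_words_ide
    by (intro exI[of _ "(ide KS (T n), ide AI (tpow AI s_sum n))"]) simp
next
  fix n \<sigma> \<tau> assume \<sigma>: "\<sigma> permutes {..<n}" "\<tau> permutes {..<n}"
    and "\<exists>fg. perm_pair n \<sigma> fg" "\<exists>fg. perm_pair n \<tau> fg"
  then obtain f g f' g' where "perm_pair n \<sigma> (f, g)" "perm_pair n \<tau> (f', g')" by auto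
  then show "\<exists>fg. perm_pair n (\<sigma> \<circ> \<tau>) fg"
    using R.transports_cmp[of n f g f' g'] W.permutes_words_cmp[OF _ _ \<sigma>(2), of \<sigma> f f']
      A.permutes_words_cmp[OF _ _ \<sigma>(2), of \<sigma> g g']
    unfolding perm_pair_def by (intro exI[of _ "(cmp KS f' f, cmp AI g' g)"]) simp
next
  fix n \<sigma> assume "\<exists>fg. perm_pair n \<sigma> fg"
  then obtain f g where fg: "R.transports n f g" "W.permutes_words n \<sigma> f" "A.permutes_words n \<sigma> g"
    unfolding perm_pair_def by auto
  have "f \<in> hom KS (T n) (T n)" "g \<in> hom AI (tpow AI s_sum n) (tpow AI s_sum n)"
    using fg(1) unfolding R.transports_def by auto
  then show "\<exists>fg. perm_pair (Suc n) (lift_perm \<sigma>) fg"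
    using R.transports_tena[OF fg(1)] W.permutes_words_tena[OF _ fg(2)] A.permutes_words_tena[OF _ fg(3)]
    unfolding perm_pair_def
    by (intro exI[of _ "(tena KS (ide KS species_gen) f, tena AI (ide AI s_sum) g)"]) (simp del: W.C_simps A.C_simps)
next
  fix n
  obtain f where f: "is_swap KS species_gen (T n) f"
    using W.swap_exists[of species_gen "T n"] species_gen_obj T_obj by auto
  obtain g where g: "is_swap AI s_sum (tpow AI s_sum n) g"
    using A.swap_exists[of s_sum "tpow AI s_sum n"] A.tpow_obj[of s_sum n] A.r_obj by auto
  show "\<exists>fg. perm_pair (Suc (Suc n)) (transpose 0 1) fg"
    unfolding perm_pair_def
    using R.transports_swap[OF f g] W.permutes_words_swap[OF f] A.permutes_words_swap[OF g]
    by (intro exI[of _ "(f, g)"]) simp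
qed

definition pC :: "nat \<Rightarrow> (nat \<Rightarrow> nat) \<Rightarrow> ('k species, nat fset, 'k) arrow" where
  "pC n \<sigma> = fst (SOME fg. perm_pair n \<sigma> fg)"

definition pA :: "nat \<Rightarrow> (nat \<Rightarrow> nat) \<Rightarrow> ('k family, nat \<Rightarrow>\<^sub>0 nat, 'k) arrow" where
  "pA n \<sigma> = snd (SOME fg. perm_pair n \<sigma> fg)"

lemma perm_arrows:
  assumes "\<sigma> permutes {..<n}"
  shows "R.transports n (pC n \<sigma>) (pA n \<sigma>)" "W.permutes_words n \<sigma> (pC n \<sigma>)" "A.permutes_words n \<sigma> (pA n \<sigma>)"
    "pC n \<sigma> \<in> hom KS (T n) (T n)" "pA n \<sigma> \<in> hom AI (tpow AI s_sum n) (tpow AI s_sum n)"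
proof -
  have *: "perm_pair n \<sigma> (SOME fg. perm_pair n \<sigma> fg)"
    by (rule someI_ex[OF perm_pair_exists[OF assms]])
  show 1: "R.transports n (pC n \<sigma>) (pA n \<sigma>)" "W.permutes_words n \<sigma> (pC n \<sigma>)" "A.permutes_words n \<sigma> (pA n \<sigma>)"
    using * unfolding pC_def pA_def perm_pair_def by blast+
  show "pC n \<sigma> \<in> hom KS (T n) (T n)" "pA n \<sigma> \<in> hom AI (tpow AI s_sum n) (tpow AI s_sum n)"
    using 1(1) unfolding R.transports_def by blast+
qed

lemma pC_e:
  assumes "\<rho> permutes {..<n}" "\<sigma> permutes {..<n}"
  shows "comp_at (pC n \<rho>) (std n) (e n \<sigma>) = e n (\<sigma> \<circ> \<rho>)"
proof -
  have "lt n \<sigma> \<in> fwords n (std n)" unfolding fwords_std using assms(2) by blast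
  then show ?thesis
    using perm_arrows(2)[OF assms(1)] permute_list_lt[OF assms(1), of \<sigma>]
    unfolding W.permutes_words_def e_def by metis
qed

abbreviation \<kappa> :: "nat \<Rightarrow> (nat \<Rightarrow>\<^sub>0 nat) \<Rightarrow> (nat \<Rightarrow>\<^sub>0 nat, 'k) vec \<Rightarrow> (nat \<Rightarrow>\<^sub>0 nat, 'k) vec" where
  "\<kappa> n a \<equiv> comp_at (R.power_iso n) a"

abbreviation S :: "nat \<Rightarrow> 'k family" where
  "S n \<equiv> tpow AI s_sum n"

lemma S_span: "S n a = fs.span ((\<lambda>j i. if i = j then 1 else 0) ` wd seq_pcm ` swords n a)"
  using A.U_tpow[of n] powsp_span[of seq_pcm _ n a] unfolding ev_def by (simp add: image_image)

lemma S_obj: "S n \<in> family_obj"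
  using A.tpow_obj[of s_sum n] A.r_obj by simp

lemma S_fin: "fin_space (S n a)"
  using S_obj by (simp add: family_obj_def)

lemma \<kappa>_lin: "\<kappa> n a \<in> lin_maps (S n a) (fo F (T n) a)"
  by (rule A.hom_lin[OF R.power_iso_hom])

lemma \<kappa>_inverse: "\<exists>\<kappa>'\<in>lin_maps (fo F (T n) a) (S n a).
    (\<forall>t\<in>S n a. \<kappa>' (\<kappa> n a t) = t) \<and> (\<forall>t\<in>fo F (T n) a. \<kappa> n a (\<kappa>' t) = t)"
proof -
  obtain i where i: "R.power_iso n \<in> hom AI (S n) (fo F (T n))" "i \<in> hom AI (fo F (T n)) (S n)"
    "cmp AI i (R.power_iso n) = ide AI (S n)" "cmp AI (R.power_iso n) i = ide AI (fo F (T n))"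
    using R.power_iso_iso[of n] unfolding iso_arrow_def by blast
  have 1: "comp_at i a (\<kappa> n a t) = t" if "t \<in> S n a" for t
    using arg_cong[OF i(3), of "\<lambda>f. comp_at f a t"] that by (simp add: restrict0_def)
  have 2: "\<kappa> n a (comp_at i a t) = t" if "t \<in> fo F (T n) a" for t
    using arg_cong[OF i(4), of "\<lambda>f. comp_at f a t"] that by (simp add: restrict0_def)
  show ?thesis using A.hom_lin[OF i(2)] 1 2 by blast
qed

lemma Fa_pC_\<kappa>:
  assumes "\<sigma> permutes {..<n}"
  shows "Fa (pC n \<sigma>) a (\<kappa> n a t) = \<kappa> n a (comp_at (pA n \<sigma>) a t)"
proof -
  have "cmp AI (fa F (pC n \<sigma>)) (R.power_iso n) = cmp AI (R.power_iso n) (pA n \<sigma>)"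
    using perm_arrows(1)[OF assms] unfolding R.transports_def by blast
  from arg_cong[OF this, of "\<lambda>f. comp_at f a t"] show ?thesis by (simp add: Fa_def)
qed

text \<open>The character of the place permutations on the words of content
  \<open>a\<close>.\<close>

definition fixed_words :: "nat \<Rightarrow> (nat \<Rightarrow>\<^sub>0 nat) \<Rightarrow> (nat \<Rightarrow> nat) \<Rightarrow> nat" where
  "fixed_words n a \<sigma> = card {ds \<in> swords n a. permute_list \<sigma> ds = ds}"

lemma trace_pC:
  assumes \<sigma>: "\<sigma> permutes {..<n}"
  shows "tr (fo F (T n) a) (Fa (pC n \<sigma>) a) = of_nat (fixed_words n a \<sigma>)"
proof -
  obtain \<kappa>' where \<kappa>': "\<kappa>' \<in> lin_maps (fo F (T n) a) (S n a)"
    "\<forall>t\<in>S n a. \<kappa>' (\<kappa> n a t) = t" "\<forall>t\<in>fo F (T n) a. \<kappa> n a (\<kappa>' t) = t"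
    using \<kappa>_inverse[of n a] by (elim bexE conjE)
  note \<kappa> = \<kappa>_lin \<kappa>'(1) \<kappa>'(2,3)[rule_format]
  let ?g = "comp_at (pA n \<sigma>) a"
  have g: "?g \<in> lin_maps (S n a) (S n a)" by (rule A.hom_lin[OF perm_arrows(5)[OF \<sigma>]])
  have fT: "fin_space (fo F (T n) a)" by (rule F_fin_space[OF T_obj])
  \<comment> \<open>Transport along \<open>power_iso\<close> replaces the unknown space by the power
    of \<open>s\<close>, where the arrow permutes the words.\<close>
  have "tr (fo F (T n) a) (Fa (pC n \<sigma>) a) = tr (fo F (T n) a) ((\<kappa> n a \<circ> ?g) \<circ> \<kappa>')"
    by (rule tr_cong[OF fT]) (metis Fa_pC_\<kappa>[OF \<sigma>] \<kappa>(4) comp_apply)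
  also have "\<dots> = tr (S n a) (\<kappa>' \<circ> (\<kappa> n a \<circ> ?g))"
    by (rule tr_commute[OF fT S_fin \<kappa>(2) lin_maps_comp[OF g \<kappa>(1)]])
  also have "\<dots> = tr (S n a) ?g"
    by (rule tr_cong[OF S_fin]) (simp add: \<kappa>(3) lin_mapsD(1)[OF g])
  also have "\<dots> = (\<Sum>j\<in>wd seq_pcm ` swords n a. ?g (\<lambda>i. if i = j then 1 else 0) j)"
    by (rule tr_coordinates[OF finite_imageI[OF finite_swords] S_span g])
  also have "\<dots> = (\<Sum>ds\<in>swords n a. ?g (ev (wd seq_pcm ds)) (wd seq_pcm ds))"
    by (subst sum.reindex) (auto simp: inj_on_def wd_inject ev_def)
  also have "\<dots> = (\<Sum>ds\<in>swords n a. if permute_list \<sigma> ds = ds then 1 else 0)"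
    using perm_arrows(3)[OF \<sigma>] unfolding A.permutes_words_def
    by (intro sum.cong) (auto simp: ev_def wd_inject)
  also have "\<dots> = of_nat (fixed_words n a \<sigma>)"
    by (simp add: fixed_words_def sum.inter_filter[OF finite_swords, symmetric])
  finally show ?thesis .
qed

subsection \<open>Arrows through tensor powers\<close>

text \<open>An endomorphism of the regular representation is determined by the image of
  \<open>e n id\<close>, and the arrows \<open>pC n \<rho>\<close> act as right translations, so
  they realize every possible image.\<close>

lemma end_decomposition:
  assumes h: "h \<in> hom KS (T n) (T n)"
    and he: "comp_at h (std n) (e n id) = (\<Sum>\<rho> | \<rho> permutes {..<n}. fscale (c \<rho>) (e n \<rho>))"
  shows "Fa h a t = (\<Sum>\<rho> | \<rho> permutes {..<n}. fscale (c \<rho>) (Fa (pC n \<rho>) a t))"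
proof -
  let ?G = "{\<rho>. \<rho> permutes {..<n}}"
  have finG: "finite ?G" by (rule finite_permutations) simp
  obtain g where g: "g \<in> hom KS (T n) (T n)" "\<And>X v. comp_at g X v = (\<Sum>\<rho>\<in>?G. fscale (c \<rho>) (comp_at (pC n \<rho>) X v))"
    "\<And>a t. Fa g a t = (\<Sum>\<rho>\<in>?G. fscale (c \<rho>) (Fa (pC n \<rho>) a t))"
    using lin_comb[OF finG T_obj T_obj, of "pC n" n n c] perm_arrows(4) by blast
  have hm: "comp_at h \<in> species_maps (T n) (T n)" and gm: "comp_at g \<in> species_maps (T n) (T n)"
    using h g(1) by simp_all
  note rT = sact_rep[OF T_obj[of n], of n]
  have "comp_at h = comp_at g"
  proof (rule T_map_unique[OF T_obj hm gm])
    fix \<sigma> assume \<sigma>: "\<sigma> permutes {..<n}"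
    have "comp_at h (std n) (e n \<sigma>) = comp_at h (std n) (sact (T n) n \<sigma> (e n id))"
      using sact_e[OF \<sigma> permutes_id] by simp
    also have "\<dots> = sact (T n) n \<sigma> (\<Sum>\<rho>\<in>?G. fscale (c \<rho>) (e n \<rho>))"
      unfolding species_map_equivariant[OF hm \<sigma>] he ..
    also have "\<dots> = (\<Sum>\<rho>\<in>?G. fscale (c \<rho>) (sact (T n) n \<sigma> (e n \<rho>)))"
      by (rule lin_map_sum[OF is_repD(3)[OF rT \<sigma>] is_repD(2)[OF rT]]) (simp add: e_in_T)
    also have "\<dots> = comp_at g (std n) (e n \<sigma>)"
      unfolding g(2) by (rule sum.cong) (auto simp: sact_e[OF \<sigma>] pC_e[OF _ \<sigma>])
    finally show "comp_at h (std n) (e n \<sigma>) = comp_at g (std n) (e n \<sigma>)" .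
  qed
  then have "h = g" using h g(1) by (intro arrow_eqI) simp_all
  then show ?thesis using g(3) by simp
qed

text \<open>The only link between \<open>F\<close> on arbitrary arrows and place permutations:
  \<open>\<psi>\<close> after \<open>h\<close> after \<open>\<theta>\<close> is an endomorphism of a
  power, whose coefficients are the values of \<open>\<xi>\<close> on translates of
  \<open>h v\<close>.\<close>

lemma sandwich:
  assumes V: "V \<in> species_obj" and W: "W \<in> species_obj"
    and v: "v \<in> sp V (std n)" and \<xi>: "functional (sp W (std n)) \<xi>"
  obtains \<theta> \<psi> where "\<theta> \<in> hom KS (T n) V" "\<psi> \<in> hom KS W (T n)"
    "\<And>\<sigma>. \<sigma> permutes {..<n} \<Longrightarrow> comp_at \<theta> (std n) (e n \<sigma>) = sact V n \<sigma> v"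
    "\<And>w. w \<in> sp W (std n) \<Longrightarrow> comp_at \<psi> (std n) w =
      (\<Sum>\<sigma> | \<sigma> permutes {..<n}. fscale (\<xi> (sact W n (inv \<sigma>) w)) (e n \<sigma>))"
    "\<And>h a t. h \<in> hom KS V W \<Longrightarrow> Fa \<psi> a (Fa h a (Fa \<theta> a t)) =
      (\<Sum>\<rho> | \<rho> permutes {..<n}. fscale (\<xi> (sact W n (inv \<rho>) (comp_at h (std n) v))) (Fa (pC n \<rho>) a t))"
proof -
  obtain \<theta>0 where \<theta>0: "\<theta>0 \<in> species_maps (T n) V"
    "\<And>\<sigma>. \<sigma> permutes {..<n} \<Longrightarrow> \<theta>0 (std n) (e n \<sigma>) = sact V n \<sigma> v"
    using theta_exists[OF V v] by blast
  obtain \<psi>0 where \<psi>0: "\<psi>0 \<in> species_maps W (T n)"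
    "\<And>w. w \<in> sp W (std n) \<Longrightarrow> \<psi>0 (std n) w =
      (\<Sum>\<sigma> | \<sigma> permutes {..<n}. fscale (\<xi> (sact W n (inv \<sigma>) w)) (e n \<sigma>))"
    using psi_exists[OF W \<xi>] by blast
  let ?\<theta> = "\<lparr>src = T n, tgt = V, comp_at = \<theta>0\<rparr>" and ?\<psi> = "\<lparr>src = W, tgt = T n, comp_at = \<psi>0\<rparr>"
  have \<theta>: "?\<theta> \<in> hom KS (T n) V" using \<theta>0 by simp
  have \<psi>: "?\<psi> \<in> hom KS W (T n)" using \<psi>0 by simp
  have "Fa ?\<psi> a (Fa h a (Fa ?\<theta> a t)) =
      (\<Sum>\<rho> | \<rho> permutes {..<n}. fscale (\<xi> (sact W n (inv \<rho>) (comp_at h (std n) v))) (Fa (pC n \<rho>) a t))"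
    if h: "h \<in> hom KS V W" for h a t
  proof -
    let ?h = "cmp KS ?\<psi> (cmp KS h ?\<theta>)"
    have o: "V \<in> obj KS" "W \<in> obj KS" "T n \<in> obj KS" using V W T_obj by simp_all
    have h\<theta>: "cmp KS h ?\<theta> \<in> hom KS (T n) W" by (rule W.cmp_hom[OF o(3,1,2) \<theta> h])
    have hh: "?h \<in> hom KS (T n) (T n)" by (rule W.cmp_hom[OF o(3,2,3) h\<theta> \<psi>])
    have "comp_at h (std n) v \<in> sp W (std n)" using lin_mapsD(1)[OF W.hom_lin[OF h] v] .
    then have "comp_at ?h (std n) (e n id) =
        (\<Sum>\<rho> | \<rho> permutes {..<n}. fscale (\<xi> (sact W n (inv \<rho>) (comp_at h (std n) v))) (e n \<rho>))"
      using \<theta>0(2)[OF permutes_id] is_repD(4)[OF sact_rep[OF V] v] \<psi>0(2) by simp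
    from end_decomposition[OF hh this, of a t] show ?thesis
      using Fa_cmp[OF T_obj W T_obj h\<theta> \<psi>] Fa_cmp[OF T_obj V W \<theta> h] by simp
  qed
  with that[OF \<theta> \<psi>] \<theta>0(2) \<psi>0(2) show ?thesis by simp
qed

end

section \<open>Characters of conjugate permutations and of the zero space\<close>

lemma character_conj:
  assumes V: "is_rep S V \<rho>" and g: "g permutes S" and \<sigma>: "\<sigma> permutes S"
  shows "tr V (\<rho> (g \<circ> \<sigma> \<circ> inv g)) = tr V (\<rho> \<sigma>)"
proof -
  note fV = is_repD(1)[OF V] and i = permutes_inv[OF g]
  have gs: "g \<circ> \<sigma> permutes S" by (rule permutes_compose[OF \<sigma> g])
  have "tr V (\<rho> (g \<circ> \<sigma> \<circ> inv g)) = tr V (\<rho> (g \<circ> \<sigma>) \<circ> \<rho> (inv g))"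
    by (rule tr_cong[OF fV]) (simp add: is_repD(5)[OF V gs i])
  also have "\<dots> = tr V (\<rho> (inv g) \<circ> \<rho> (g \<circ> \<sigma>))"
    by (rule tr_commute[OF fV fV is_repD(3)[OF V i] is_repD(3)[OF V gs]])
  also have "\<dots> = tr V (\<rho> \<sigma>)"
  proof (rule tr_cong[OF fV])
    fix v assume v: "v \<in> V"
    show "(\<rho> (inv g) \<circ> \<rho> (g \<circ> \<sigma>)) v = \<rho> \<sigma> v"
      using is_repD(5)[OF V g \<sigma> v] is_repD(8)[OF V g is_repD(6)[OF V \<sigma> v]] by simp
  qed
  finally show ?thesis .
qed

lemma tr_zero_space:
  assumes "is_rep S {0} \<rho>" "\<sigma> permutes S"
  shows "tr {0} (\<rho> \<sigma>) = 0"
proof -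
  have "frame {0} ({} :: nat set) (\<lambda>_. 0) (\<lambda>_ _. 0)" unfolding frame_def by simp
  from tr_frame[OF is_repD(1)[OF assms(1)] this is_repD(3)[OF assms]] show ?thesis by simp
qed

section \<open>Faithfulness and conservativity\<close>

context ext_setup
begin

text \<open>There are infinitely many unit sequences, so words of every length without repetition
  exist.\<close>

definition letters :: "nat \<Rightarrow> (nat \<Rightarrow>\<^sub>0 nat) list" where
  "letters n = map (\<lambda>i. Poly_Mapping.single i 1) [0..<n]"

lemma letters_word: "letters n \<in> swords n (sum_list (letters n))"
  unfolding swords_iff using weight_1_iff by (auto simp: letters_def)

lemma permute_letters:
  assumes "\<rho> permutes {..<n}"
  shows "permute_list \<rho> (letters n) = letters n \<longleftrightarrow> \<rho> = id"
proof
  assume fixed: "permute_list \<rho> (letters n) = letters n"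
  have "\<rho> i = i" for i
  proof (cases "i < n")
    case True
    then have "letters n ! \<rho> i = letters n ! i"
      using fixed permute_list_fixed_iff[OF assms, of "letters n"] by (simp add: letters_def)
    then have "Poly_Mapping.single (\<rho> i) (1::nat) = Poly_Mapping.single i 1"
      using True permutes_in_image[OF assms, of i] by (simp add: letters_def)
    then show ?thesis by (metis lookup_single_eq lookup_single_not_eq one_neq_zero)
  next
    case False
    then show ?thesis using permutes_not_in[OF assms] by simp
  qed
  then show "\<rho> = id" by auto
qed simp

text \<open>Applied to the word \<open>letters n\<close> and read off at the same word, the sandwich
  returns its coefficient at the identity, which is a coordinate of \<open>h v\<close>. So
  \<open>F h\<close> determines all coordinates of \<open>h\<close> on standard sets.\<close>

lemma F_faithful:
  assumes V: "V \<in> species_obj" and W: "W \<in> species_obj" and f: "f \<in> hom KS V W" and g: "g \<in> hom KS V W"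
    and eq: "fa F f = fa F g"
  shows "f = g"
proof -
  have fm: "comp_at f \<in> species_maps V W" and gm: "comp_at g \<in> species_maps V W" using f g by simp_all
  have "comp_at f = comp_at g"
  proof (rule species_map_unique[OF V fm gm])
    fix n v assume v: "v \<in> sp V (std n)"
    let ?G = "{\<rho>. \<rho> permutes {..<n}}"
    have finG: "finite ?G" by (rule finite_permutations) simp
    let ?a = "sum_list (letters n)" and ?t = "ev (wd seq_pcm (letters n)) :: (nat \<Rightarrow>\<^sub>0 nat, 'k) vec"
    have t: "?t \<in> S n ?a"
      unfolding A.U_tpow by (rule ev_word_in_powsp[OF letters_word])
    obtain \<kappa>' where \<kappa>': "\<kappa>' \<in> lin_maps (fo F (T n) ?a) (S n ?a)" "\<forall>t\<in>S n ?a. \<kappa>' (\<kappa> n ?a t) = t"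
      using \<kappa>_inverse[of n ?a] by (elim bexE conjE)
    show "comp_at f (std n) v = comp_at g (std n) v"
    proof
      fix j
      define \<xi> :: "(nat fset, 'k) vec \<Rightarrow> 'k" where "\<xi> = (\<lambda>w. w j)"
      have \<xi>: "functional (sp W (std n)) \<xi>" unfolding \<xi>_def by (rule functional_coord)
      \<comment> \<open>The outer arrows are chosen before \<open>h\<close>, so one pair serves both
        \<open>f\<close> and \<open>g\<close>.\<close>
      have "\<exists>\<theta> \<psi>. \<forall>h a t. h \<in> hom KS V W \<longrightarrow> Fa \<psi> a (Fa h a (Fa \<theta> a t)) =
          (\<Sum>\<rho>\<in>?G. fscale (\<xi> (sact W n (inv \<rho>) (comp_at h (std n) v))) (Fa (pC n \<rho>) a t))"
        by (rule sandwich[OF V W v \<xi>]) blast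
      then obtain \<theta> \<psi> where "\<forall>h a t. h \<in> hom KS V W \<longrightarrow> Fa \<psi> a (Fa h a (Fa \<theta> a t)) =
          (\<Sum>\<rho>\<in>?G. fscale (\<xi> (sact W n (inv \<rho>) (comp_at h (std n) v))) (Fa (pC n \<rho>) a t))"
        by (elim exE)
      note s = this[rule_format]
      have coord: "\<kappa>' (Fa \<psi> ?a (Fa h ?a (Fa \<theta> ?a (\<kappa> n ?a ?t)))) (wd seq_pcm (letters n)) = \<xi> (comp_at h (std n) v)"
        if h: "h \<in> hom KS V W" for h
      proof -
        let ?c = "\<lambda>\<rho>. \<xi> (sact W n (inv \<rho>) (comp_at h (std n) v))"
        let ?w = "\<lambda>\<rho>. ev (wd seq_pcm (permute_list \<rho> (letters n))) :: (nat \<Rightarrow>\<^sub>0 nat, 'k) vec"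
        have w: "?w \<rho> \<in> S n ?a" "comp_at (pA n \<rho>) ?a ?t = ?w \<rho>" if "\<rho> \<in> ?G" for \<rho>
        proof -
          have p: "permute_list \<rho> (letters n) \<in> swords n ?a \<and> comp_at (pA n \<rho>) ?a ?t = ?w \<rho>"
            using perm_arrows(3)[of \<rho> n] that letters_word unfolding A.permutes_words_def by blast
          then show "comp_at (pA n \<rho>) ?a ?t = ?w \<rho>" by blast
          show "?w \<rho> \<in> S n ?a"
            unfolding A.U_tpow by (rule ev_word_in_powsp[OF conjunct1[OF p]])
        qed
        have "Fa \<psi> ?a (Fa h ?a (Fa \<theta> ?a (\<kappa> n ?a ?t))) = (\<Sum>\<rho>\<in>?G. fscale (?c \<rho>) (\<kappa> n ?a (?w \<rho>)))"
          unfolding s[OF h] by (rule sum.cong) (auto simp: Fa_pC_\<kappa> w(2))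
        then have "\<kappa>' (Fa \<psi> ?a (Fa h ?a (Fa \<theta> ?a (\<kappa> n ?a ?t)))) =
            (\<Sum>\<rho>\<in>?G. fscale (?c \<rho>) (\<kappa>' (\<kappa> n ?a (?w \<rho>))))"
          using lin_map_sum[OF \<kappa>'(1) fin_space_subspace[OF F_fin_space[OF T_obj]], of ?G "\<lambda>\<rho>. \<kappa> n ?a (?w \<rho>)" ?c]
            w(1) lin_mapsD(1)[OF \<kappa>_lin] by simp
        also have "\<dots> = (\<Sum>\<rho>\<in>?G. fscale (?c \<rho>) (?w \<rho>))"
          by (rule sum.cong) (use \<kappa>'(2) w(1) in auto)
        finally have "\<kappa>' (Fa \<psi> ?a (Fa h ?a (Fa \<theta> ?a (\<kappa> n ?a ?t)))) (wd seq_pcm (letters n)) =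
            (\<Sum>\<rho>\<in>?G. ?c \<rho> * ?w \<rho> (wd seq_pcm (letters n)))"
          by (simp add: sum_fun_apply fscale_def)
        also have "\<dots> = (\<Sum>\<rho>\<in>?G. if \<rho> = id then ?c \<rho> else 0)"
        proof (rule sum.cong)
          fix \<rho> assume "\<rho> \<in> ?G"
          then have "letters n = permute_list \<rho> (letters n) \<longleftrightarrow> \<rho> = id"
            using permute_letters[of \<rho> n] by auto
          then show "?c \<rho> * ?w \<rho> (wd seq_pcm (letters n)) = (if \<rho> = id then ?c \<rho> else 0)"
            unfolding ev_def wd_inject by simp
        qed simp
        also have "\<dots> = ?c id" using finG permutes_id by simp
        also have "\<dots> = \<xi> (comp_at h (std n) v)"
          using is_repD(4)[OF sact_rep[OF W]] lin_mapsD(1)[OF W.hom_lin[OF h] v] by (simp add: inv_id)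
        finally show ?thesis .
      qed
      have "\<xi> (comp_at f (std n) v) = \<xi> (comp_at g (std n) v)"
        using coord[OF f] coord[OF g] eq unfolding Fa_def by simp
      then show "comp_at f (std n) v j = comp_at g (std n) v j" by (simp add: \<xi>_def)
    qed
  qed
  then show ?thesis using f g by (intro arrow_eqI) simp_all
qed

text \<open>The equivariant quasi-inverses on standard sets assemble to an arrow \<open>?g\<close>
  with \<open>f\<close>, \<open>?g\<close>, \<open>f\<close> composing to \<open>f\<close>.
  Cancelling the invertible \<open>F f\<close> on either side makes its image a two-sided inverse,
  and faithfulness brings both equations back.\<close>

lemma F_conservative:
  assumes V: "V \<in> species_obj" and W: "W \<in> species_obj" and f: "f \<in> hom KS V W"
    and iso: "iso_arrow AI (fo F V) (fo F W) (fa F f)"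
  shows "iso_arrow KS V W f"
proof -
  have fm: "comp_at f \<in> species_maps V W" using f by simp
  have "\<exists>g. g \<in> lin_maps (sp W (std n)) (sp V (std n)) \<and>
      equivariant {..<n} (sp W (std n)) (sact W n) (sact V n) g \<and>
      (\<forall>v\<in>sp V (std n). comp_at f (std n) (g (comp_at f (std n) v)) = comp_at f (std n) v)" for n
  proof -
    have "equivariant {..<n} (sp V (std n)) (sact V n) (sact W n) (comp_at f (std n))"
      unfolding equivariant_def using species_map_equivariant[OF fm] by blast
    from equivariant_regular[OF finite_lessThan sact_rep[OF V] sact_rep[OF W] W.hom_lin[OF f] this]
    show ?thesis by metis
  qed
  then obtain g where g: "\<And>n. g n \<in> lin_maps (sp W (std n)) (sp V (std n))"
    "\<And>n. equivariant {..<n} (sp W (std n)) (sact W n) (sact V n) (g n)"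
    "\<And>n v. v \<in> sp V (std n) \<Longrightarrow> comp_at f (std n) (g n (comp_at f (std n) v)) = comp_at f (std n) v"
    by metis
  obtain g0 where g0: "g0 \<in> species_maps W V" "\<And>n v. v \<in> sp W (std n) \<Longrightarrow> g0 (std n) v = g n v"
    using species_map_extend[OF W V, of g] g(1,2) by metis
  let ?g = "\<lparr>src = W, tgt = V, comp_at = g0\<rparr>"
  have gh: "?g \<in> hom KS W V" using g0 by simp
  have o: "V \<in> obj KS" "W \<in> obj KS" using V W by simp_all
  have gf: "cmp KS ?g f \<in> hom KS V V" by (rule W.cmp_hom[OF o(1,2,1) f gh])
  have fg: "cmp KS f ?g \<in> hom KS W W" by (rule W.cmp_hom[OF o(2,1,2) gh f])
  have fgf: "cmp KS f (cmp KS ?g f) \<in> hom KS V W" by (rule W.cmp_hom[OF o(1,1,2) gf f])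
  have "cmp KS f (cmp KS ?g f) = f"
  proof (rule arrow_eqI)
    show "comp_at (cmp KS f (cmp KS ?g f)) = comp_at f"
    proof (rule species_map_unique[OF V _ fm])
      show "comp_at (cmp KS f (cmp KS ?g f)) \<in> species_maps V W"
        using fgf unfolding W.C_simps(4) by blast
      show "comp_at (cmp KS f (cmp KS ?g f)) (std n) v = comp_at f (std n) v" if v: "v \<in> sp V (std n)" for n v
        using g(3)[OF v] g0(2)[OF lin_mapsD(1)[OF W.hom_lin[OF f] v]] by simp
    qed
  qed (use f in simp_all)
  then have F1: "cmp AI (cmp AI (fa F f) (fa F ?g)) (fa F f) = fa F f"
    using R.fa_cmp[OF o(1,2,1) f gh] R.fa_cmp[OF o(1,1,2) gf f] R.assoc_all by metis
  obtain k where k: "fa F f \<in> hom AI (fo F V) (fo F W)" "k \<in> hom AI (fo F W) (fo F V)"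
    "cmp AI k (fa F f) = ide AI (fo F V)" "cmp AI (fa F f) k = ide AI (fo F W)"
    using iso unfolding iso_arrow_def by blast
  note Fg = R.fa_hom[OF o(2,1) gh]
  note Fo = R.fo_obj[OF o(1)] R.fo_obj[OF o(2)]
  have "cmp AI (fa F f) (fa F ?g) = cmp AI (cmp AI (fa F f) (fa F ?g)) (cmp AI (fa F f) k)"
    unfolding k(4) by (rule A.cmp_ide(1)[OF Fo(2,2) A.cmp_hom[OF Fo(2,1,2) Fg k(1)], symmetric])
  also have "\<dots> = cmp AI (fa F f) k" unfolding R.assoc_all F1 ..
  finally have 1: "fa F (cmp KS f ?g) = fa F (ide KS W)"
    using R.fa_cmp[OF o(2,1,2) gh f] R.fa_ide[OF o(2)] k(4) by simp
  have "cmp AI (fa F ?g) (fa F f) = cmp AI (cmp AI k (fa F f)) (cmp AI (fa F ?g) (fa F f))"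
    unfolding k(3) by (rule A.cmp_ide(2)[OF Fo(1,1) A.cmp_hom[OF Fo(1,2,1) k(1) Fg], symmetric])
  also have "\<dots> = cmp AI k (cmp AI (cmp AI (fa F f) (fa F ?g)) (fa F f))"
    by (simp only: R.assoc_all)
  finally have 2: "fa F (cmp KS ?g f) = fa F (ide KS V)"
    using R.fa_cmp[OF o(1,2,1) f gh] R.fa_ide[OF o(1)] k(3) F1 by simp
  have "cmp KS f ?g = ide KS W" by (rule F_faithful[OF W W fg W.ide_hom[OF o(2)] 1])
  moreover have "cmp KS ?g f = ide KS V" by (rule F_faithful[OF V V gf W.ide_hom[OF o(1)] 2])
  ultimately show ?thesis unfolding iso_arrow_def using f gh by blast
qed

subsection \<open>Graded dimensions are inner products with permutation characters\<close>

text \<open>By cyclicity the trace of \<open>F\<close> on \<open>\<theta>\<close> after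
  \<open>\<psi>\<close> equals the trace on \<open>\<psi>\<close> after \<open>\<theta>\<close>, an
  endomorphism of a power that the sandwich expresses by place permutations.\<close>

lemma graded_dimension:
  assumes V: "V \<in> species_obj" and N: "\<And>X. N \<le> fcard X \<Longrightarrow> sp V X = {0}"
  shows "tr (fo F V a) (restrict0 (fo F V a) (\<lambda>v. v)) =
    (\<Sum>n<N. 1 / of_nat (card {\<rho>. \<rho> permutes {..<n}}) *
      (\<Sum>\<rho> | \<rho> permutes {..<n}. tr (sp V (std n)) (sact V n (inv \<rho>)) * of_nat (fixed_words n a \<rho>)))"
proof -
  let ?G = "\<lambda>n. {\<rho>. \<rho> permutes {..<n}}"
  have finG: "finite (?G n)" for n :: nat by (rule finite_permutations) simp
  note rV = sact_rep[OF V]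
  have "\<exists>B \<xi>. frame (sp V (std n)) B (\<lambda>b. b) \<xi>" for n
    using frame_exists[OF species_objD(1)[OF V, of "std n"]] by metis
  then obtain B \<xi> where B: "\<And>n. frame (sp V (std n)) (B n) (\<lambda>b. b) (\<xi> n)" by metis
  have finB: "finite (B n)" and BV: "b \<in> B n \<Longrightarrow> b \<in> sp V (std n)"
    and fB: "b \<in> B n \<Longrightarrow> functional (sp V (std n)) (\<xi> n b)" for n b
    using B[of n] unfolding frame_def by auto
  let ?P = "\<lambda>n b \<theta> \<psi>. \<theta> \<in> hom KS (T n) V \<and> \<psi> \<in> hom KS V (T n) \<and>
    (\<forall>\<sigma>. \<sigma> permutes {..<n} \<longrightarrow> comp_at \<theta> (std n) (e n \<sigma>) = sact V n \<sigma> b) \<and>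
    (\<forall>w\<in>sp V (std n). comp_at \<psi> (std n) w = (\<Sum>\<sigma>\<in>?G n. fscale (\<xi> n b (sact V n (inv \<sigma>) w)) (e n \<sigma>))) \<and>
    (\<forall>h a t. h \<in> hom KS V V \<longrightarrow> Fa \<psi> a (Fa h a (Fa \<theta> a t)) =
      (\<Sum>\<rho>\<in>?G n. fscale (\<xi> n b (sact V n (inv \<rho>) (comp_at h (std n) b))) (Fa (pC n \<rho>) a t)))"
  have ex: "\<exists>\<theta> \<psi>. ?P n b \<theta> \<psi>" if b: "b \<in> B n" for n b
    by (rule sandwich[OF V V BV[OF b] fB[OF b]]) blast
  define I where "I = Sigma {..<N} B"
  have finI: "finite I" unfolding I_def using finB by blast
  have "\<forall>i\<in>I. \<exists>p. ?P (fst i) (snd i) (fst p) (snd p)"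
  proof
    fix i assume "i \<in> I"
    then have "snd i \<in> B (fst i)" unfolding I_def by auto
    from ex[OF this] obtain \<theta> \<psi> where "?P (fst i) (snd i) \<theta> \<psi>" by (elim exE)
    then have "?P (fst i) (snd i) (fst (\<theta>, \<psi>)) (snd (\<theta>, \<psi>))" unfolding fst_conv snd_conv .
    then show "\<exists>p. ?P (fst i) (snd i) (fst p) (snd p)" by (rule exI[of _ "(\<theta>, \<psi>)"])
  qed
  from bchoice[OF this] obtain p where p: "\<forall>i\<in>I. ?P (fst i) (snd i) (fst (p i)) (snd (p i))" by (elim exE)
  define \<theta> \<psi> where "\<theta> i = fst (p i)" and "\<psi> i = snd (p i)" for i
  have P: "?P (fst i) (snd i) (\<theta> i) (\<psi> i)" if "i \<in> I" for i
    using bspec[OF p that] unfolding \<theta>_def \<psi>_def .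
  \<comment> \<open>Every permutation contributes one full resolution of the identity at
    \<open>std n\<close>, whence the division by the group order.\<close>
  define c where "c i = (1 / of_nat (card (?G (fst i))) :: 'k)" for i :: "nat \<times> (nat fset, 'k) vec"
  have o: "V \<in> obj KS" "T n \<in> obj KS" for n using V T_obj by simp_all
  have tp: "cmp KS (\<theta> i) (\<psi> i) \<in> hom KS V V" if "i \<in> I" for i
    using W.cmp_hom[OF o(1) o(2)[of "fst i"] o(1)] P[OF that] by blast
  obtain g where g: "g \<in> hom KS V V"
    "\<And>X v. comp_at g X v = (\<Sum>i\<in>I. fscale (c i) (comp_at (cmp KS (\<theta> i) (\<psi> i)) X v))"
    "\<And>a t. Fa g a t = (\<Sum>i\<in>I. fscale (c i) (Fa (cmp KS (\<theta> i) (\<psi> i)) a t))"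
    using lin_comb[OF finI V V, of "\<lambda>i. cmp KS (\<theta> i) (\<psi> i)" c] tp by blast
  have gm: "comp_at g \<in> species_maps V V" using g(1) by simp
  have im: "comp_at (ide KS V) \<in> species_maps V V" using W.ide_hom[OF o(1)] by simp
  have "comp_at g = comp_at (ide KS V)"
  proof (rule species_map_unique[OF V gm im])
    fix m v assume v: "v \<in> sp V (std m)"
    have term_other: "comp_at (cmp KS (\<theta> i) (\<psi> i)) (std m) v = 0" if i: "i \<in> I" "fst i \<noteq> m" for i
    proof -
      have "comp_at (\<psi> i) (std m) v \<in> sp (T (fst i)) (std m)"
        by (rule lin_mapsD(1)[OF W.hom_lin v]) (use P[OF i(1)] in blast)
      then have z: "comp_at (\<psi> i) (std m) v = 0" using sp_T_other[OF i(2)] by simp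
      have l: "comp_at (\<theta> i) (std m) \<in> lin_maps (sp (T (fst i)) (std m)) (sp V (std m))"
        by (rule W.hom_lin) (use P[OF i(1)] in blast)
      show ?thesis unfolding W.C_simps(5) comp_apply z by (rule lin_maps_zero[OF l])
    qed
    have term_same: "comp_at (cmp KS (\<theta> (m, b)) (\<psi> (m, b))) (std m) v =
        (\<Sum>\<sigma>\<in>?G m. fscale (\<xi> m b (sact V m (inv \<sigma>) v)) (sact V m \<sigma> b))" if i: "(m, b) \<in> I" for b
    proof -
      note Pi = P[OF i, unfolded fst_conv snd_conv]
      have l: "comp_at (\<theta> (m, b)) (std m) \<in> lin_maps (sp (T m) (std m)) (sp V (std m))"
        by (rule W.hom_lin) (use Pi in blast)
      have "comp_at (cmp KS (\<theta> (m, b)) (\<psi> (m, b))) (std m) v =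
          comp_at (\<theta> (m, b)) (std m) (\<Sum>\<sigma>\<in>?G m. fscale (\<xi> m b (sact V m (inv \<sigma>) v)) (e m \<sigma>))"
        using Pi v by simp
      also have "\<dots> = (\<Sum>\<sigma>\<in>?G m. fscale (\<xi> m b (sact V m (inv \<sigma>) v)) (comp_at (\<theta> (m, b)) (std m) (e m \<sigma>)))"
        by (rule lin_map_sum[OF l species_objD(6)[OF T_obj]]) (simp add: e_in_T)
      also have "\<dots> = (\<Sum>\<sigma>\<in>?G m. fscale (\<xi> m b (sact V m (inv \<sigma>) v)) (sact V m \<sigma> b))"
        by (rule sum.cong) (use Pi in auto)
      finally show ?thesis .
    qed
    show "comp_at g (std m) v = comp_at (ide KS V) (std m) v"
    proof (cases "m < N")
      case False
      then have "v = 0" using N[of "std m"] v by simp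
      then show ?thesis
        using lin_maps_zero[OF W.hom_lin[OF g(1)]] lin_maps_zero[OF W.hom_lin[OF W.ide_hom[OF o(1)]]] by metis
    next
      case True
      let ?c = "1 / of_nat (card (?G m)) :: 'k"
      have "comp_at g (std m) v = (\<Sum>n<N. \<Sum>b\<in>B n. fscale (c (n, b)) (comp_at (cmp KS (\<theta> (n, b)) (\<psi> (n, b))) (std m) v))"
        unfolding g(2) I_def using finB by (subst sum.Sigma) (auto intro!: sum.cong)
      \<comment> \<open>A power has a nonzero value at \<open>std m\<close> only if its exponent is
        \<open>m\<close>.\<close>
      also have "\<dots> = (\<Sum>n<N. if n = m then \<Sum>b\<in>B m. fscale ?c (\<Sum>\<sigma>\<in>?G m. fscale (\<xi> m b (sact V m (inv \<sigma>) v)) (sact V m \<sigma> b)) else 0)"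
      proof (rule sum.cong)
        fix n assume n: "n \<in> {..<N}"
        have "fscale (c (n, b)) (comp_at (cmp KS (\<theta> (n, b)) (\<psi> (n, b))) (std m) v) = 0" if "n \<noteq> m" "b \<in> B n" for b
          using term_other[of "(n, b)"] that n by (simp add: I_def del: W.C_simps)
        moreover have "fscale (c (m, b)) (comp_at (cmp KS (\<theta> (m, b)) (\<psi> (m, b))) (std m) v) =
            fscale ?c (\<Sum>\<sigma>\<in>?G m. fscale (\<xi> m b (sact V m (inv \<sigma>) v)) (sact V m \<sigma> b))" if "b \<in> B m" for b
          using term_same[of b] that True by (simp add: I_def c_def del: W.C_simps)
        ultimately show "(\<Sum>b\<in>B n. fscale (c (n, b)) (comp_at (cmp KS (\<theta> (n, b)) (\<psi> (n, b))) (std m) v)) =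
            (if n = m then \<Sum>b\<in>B m. fscale ?c (\<Sum>\<sigma>\<in>?G m. fscale (\<xi> m b (sact V m (inv \<sigma>) v)) (sact V m \<sigma> b)) else 0)"
          by (cases "n = m") (auto intro!: sum.cong sum.neutral simp del: W.C_simps)
      qed simp
      also have "\<dots> = (\<Sum>b\<in>B m. \<Sum>\<sigma>\<in>?G m. fscale ?c (fscale (\<xi> m b (sact V m (inv \<sigma>) v)) (sact V m \<sigma> b)))"
        using True by (simp add: fs.scale_sum_right del: fs.scale_scale)
      also have "\<dots> = (\<Sum>\<sigma>\<in>?G m. \<Sum>b\<in>B m. fscale ?c (fscale (\<xi> m b (sact V m (inv \<sigma>) v)) (sact V m \<sigma> b)))"
        by (rule sum.swap)
      also have "\<dots> = (\<Sum>\<sigma>\<in>?G m. fscale ?c v)"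
      proof (rule sum.cong)
        fix \<sigma> assume "\<sigma> \<in> ?G m"
        then have \<sigma>: "\<sigma> permutes {..<m}" by simp
        have iv: "sact V m (inv \<sigma>) v \<in> sp V (std m)" by (rule is_repD(6)[OF rV permutes_inv[OF \<sigma>] v])
        have "(\<Sum>b\<in>B m. fscale (\<xi> m b (sact V m (inv \<sigma>) v)) (sact V m \<sigma> b)) =
            sact V m \<sigma> (\<Sum>b\<in>B m. fscale (\<xi> m b (sact V m (inv \<sigma>) v)) b)"
          by (rule lin_map_sum[OF is_repD(3)[OF rV \<sigma>] is_repD(2)[OF rV], symmetric]) (rule BV)
        also have "(\<Sum>b\<in>B m. fscale (\<xi> m b (sact V m (inv \<sigma>) v)) b) = sact V m (inv \<sigma>) v"
          \<comment> \<open>The frame reassembles the vector moved by \<open>inv \<sigma>\<close>,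
            so applying \<open>\<sigma>\<close> returns \<open>v\<close>.\<close>
          by (rule bspec[OF B[of m, unfolded frame_def, THEN conjunct2, THEN conjunct2] iv, symmetric])
        also have "sact V m \<sigma> (sact V m (inv \<sigma>) v) = v" by (rule is_repD(7)[OF rV \<sigma> v])
        finally show "(\<Sum>b\<in>B m. fscale ?c (fscale (\<xi> m b (sact V m (inv \<sigma>) v)) (sact V m \<sigma> b))) = fscale ?c v"
          unfolding fs.scale_sum_right[symmetric] by simp
      qed simp
      also have "\<dots> = v" by (rule sum_const_average[OF finite_lessThan rV rV])
      finally show ?thesis using v by (simp add: restrict0_def)
    qed
  qed
  then have gi: "g = ide KS V" using g(1) W.ide_hom[OF o(1)] by (intro arrow_eqI) simp_all
  have FV: "fin_space (fo F V a)" by (rule F_fin_space[OF V])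
  have term_trace: "tr (fo F V a) (Fa (cmp KS (\<theta> i) (\<psi> i)) a) =
      (\<Sum>\<rho>\<in>?G (fst i). \<xi> (fst i) (snd i) (sact V (fst i) (inv \<rho>) (snd i)) * of_nat (fixed_words (fst i) a \<rho>))"
    if i: "i \<in> I" for i
  proof -
    obtain n b where nb: "i = (n, b)" "b \<in> B n" using i unfolding I_def by blast
    note Pi = P[OF i, unfolded nb fst_conv snd_conv]
    have h: "\<theta> (n, b) \<in> hom KS (T n) V" "\<psi> (n, b) \<in> hom KS V (T n)" using Pi by blast+
    note lt = Fa_lin[OF T_obj V h(1)] and lp = Fa_lin[OF V T_obj h(2)]
    have "tr (fo F V a) (Fa (cmp KS (\<theta> (n, b)) (\<psi> (n, b))) a) = tr (fo F V a) (Fa (\<theta> (n, b)) a \<circ> Fa (\<psi> (n, b)) a)"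
      unfolding Fa_cmp[OF V T_obj V h(2,1)] ..
    also have "\<dots> = tr (fo F (T n) a) (Fa (\<psi> (n, b)) a \<circ> Fa (\<theta> (n, b)) a)"
      by (rule tr_commute[OF FV F_fin_space[OF T_obj] lp lt])
    also have "\<dots> = tr (fo F (T n) a) (\<lambda>t. \<Sum>\<rho>\<in>?G n. fscale (\<xi> n b (sact V n (inv \<rho>) b)) (Fa (pC n \<rho>) a t))"
    proof (rule tr_cong[OF F_fin_space[OF T_obj]])
      fix t assume t: "t \<in> fo F (T n) a"
      \<comment> \<open>Inserting the identity of \<open>V\<close> in the middle gives the shape to
        which the sandwich applies.\<close>
      have "Fa (\<psi> (n, b)) a (Fa (ide KS V) a (Fa (\<theta> (n, b)) a t)) =
          (\<Sum>\<rho>\<in>?G n. fscale (\<xi> n b (sact V n (inv \<rho>) (comp_at (ide KS V) (std n) b))) (Fa (pC n \<rho>) a t))"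
        using Pi W.ide_hom[OF o(1)] by blast
      moreover have "comp_at (ide KS V) (std n) b = b" using BV[OF nb(2)] by (simp add: restrict0_def)
      moreover have "Fa (ide KS V) a (Fa (\<theta> (n, b)) a t) = Fa (\<theta> (n, b)) a t"
        using lin_mapsD(1)[OF lt t] by (simp add: Fa_ide[OF V] restrict0_def)
      ultimately show "(Fa (\<psi> (n, b)) a \<circ> Fa (\<theta> (n, b)) a) t =
          (\<Sum>\<rho>\<in>?G n. fscale (\<xi> n b (sact V n (inv \<rho>) b)) (Fa (pC n \<rho>) a t))"
        by simp
    qed
    also have "\<dots> = (\<Sum>\<rho>\<in>?G n. \<xi> n b (sact V n (inv \<rho>) b) * tr (fo F (T n) a) (Fa (pC n \<rho>) a))"
      by (rule tr_lin_comb[OF F_fin_space[OF T_obj] Fa_lin[OF T_obj T_obj]]) (use perm_arrows(4) in blast)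
    also have "\<dots> = (\<Sum>\<rho>\<in>?G n. \<xi> n b (sact V n (inv \<rho>) b) * of_nat (fixed_words n a \<rho>))"
      by (rule sum.cong) (auto simp: trace_pC)
    finally show ?thesis unfolding nb by simp
  qed
  have "tr (fo F V a) (restrict0 (fo F V a) (\<lambda>v. v)) = tr (fo F V a) (\<lambda>t. \<Sum>i\<in>I. fscale (c i) (Fa (cmp KS (\<theta> i) (\<psi> i)) a t))"
    unfolding g(3)[symmetric] gi Fa_ide[OF V] ..
  also have "\<dots> = (\<Sum>i\<in>I. c i * tr (fo F V a) (Fa (cmp KS (\<theta> i) (\<psi> i)) a))"
    by (rule tr_lin_comb[OF FV Fa_lin[OF V V tp]])
  also have "\<dots> = (\<Sum>i\<in>I. c i * (\<Sum>\<rho>\<in>?G (fst i). \<xi> (fst i) (snd i) (sact V (fst i) (inv \<rho>) (snd i)) * of_nat (fixed_words (fst i) a \<rho>)))"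
    by (rule sum.cong[OF refl]) (simp only: term_trace)
  also have "\<dots> = (\<Sum>n<N. \<Sum>b\<in>B n. c (n, b) * (\<Sum>\<rho>\<in>?G n. \<xi> n b (sact V n (inv \<rho>) b) * of_nat (fixed_words n a \<rho>)))"
    unfolding I_def using finB by (subst sum.Sigma) (auto intro!: sum.cong)
  also have "\<dots> = (\<Sum>n<N. 1 / of_nat (card (?G n)) * (\<Sum>\<rho>\<in>?G n. tr (sp V (std n)) (sact V n (inv \<rho>)) * of_nat (fixed_words n a \<rho>)))"
  proof (rule sum.cong)
    fix n
    have "(\<Sum>b\<in>B n. \<Sum>\<rho>\<in>?G n. \<xi> n b (sact V n (inv \<rho>) b) * of_nat (fixed_words n a \<rho>)) =
        (\<Sum>\<rho>\<in>?G n. (\<Sum>b\<in>B n. \<xi> n b (sact V n (inv \<rho>) b)) * of_nat (fixed_words n a \<rho>))"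
      unfolding sum_distrib_right by (rule sum.swap)
    also have "\<dots> = (\<Sum>\<rho>\<in>?G n. tr (sp V (std n)) (sact V n (inv \<rho>)) * of_nat (fixed_words n a \<rho>))"
      by (rule sum.cong) (auto simp: tr_frame[OF species_objD(1)[OF V] B is_repD(3)[OF rV permutes_inv]])
    finally show "(\<Sum>b\<in>B n. c (n, b) * (\<Sum>\<rho>\<in>?G n. \<xi> n b (sact V n (inv \<rho>) b) * of_nat (fixed_words n a \<rho>))) =
        1 / of_nat (card (?G n)) * (\<Sum>\<rho>\<in>?G n. tr (sp V (std n)) (sact V n (inv \<rho>)) * of_nat (fixed_words n a \<rho>))"
      unfolding c_def fst_conv sum_distrib_left[symmetric] by simp
  qed simp
  finally show ?thesis .
qed

section \<open>Recovering the character and the species\<close>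

lemma iso_graded_dimension:
  assumes V: "V \<in> species_obj" and W: "W \<in> species_obj" and iso: "isomorphic AI (fo F V) (fo F W)"
  shows "tr (fo F V a) (restrict0 (fo F V a) (\<lambda>v. v)) = tr (fo F W a) (restrict0 (fo F W a) (\<lambda>v. v))"
proof -
  obtain f g where f: "f \<in> hom AI (fo F V) (fo F W)" and g: "g \<in> hom AI (fo F W) (fo F V)"
    and gf: "cmp AI g f = ide AI (fo F V)" and fg: "cmp AI f g = ide AI (fo F W)"
    using iso unfolding isomorphic_def iso_arrow_def by blast
  have 1: "comp_at g a \<circ> comp_at f a = restrict0 (fo F V a) (\<lambda>v. v)"
    using arg_cong[OF gf, of "\<lambda>f. comp_at f a"] by simp
  have 2: "comp_at f a \<circ> comp_at g a = restrict0 (fo F W a) (\<lambda>v. v)"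
    using arg_cong[OF fg, of "\<lambda>f. comp_at f a"] by simp
  show ?thesis
    unfolding 1[symmetric] 2[symmetric]
    by (rule tr_commute[OF F_fin_space[OF V] F_fin_space[OF W] A.hom_lin[OF f] A.hom_lin[OF g]])
qed

text \<open>In the degree of a word of length \<open>n\<close> only the term of index
  \<open>n\<close> of \<open>graded_dimension\<close> survives. So the difference of the two
  characters, precomposed with inversion, is orthogonal to all permutation characters on
  words.\<close>

lemma equal_characters:
  assumes V: "V \<in> species_obj" and W: "W \<in> species_obj" and iso: "isomorphic AI (fo F V) (fo F W)"
    and \<sigma>: "\<sigma> permutes {..<n}"
  shows "tr (sp V (std n)) (sact V n \<sigma>) = tr (sp W (std n)) (sact W n \<sigma>)"
proof -
  obtain N1 N2 where N1: "\<And>X. N1 \<le> fcard X \<Longrightarrow> sp V X = {0}" and N2: "\<And>X. N2 \<le> fcard X \<Longrightarrow> sp W X = {0}"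
    using species_objD(5)[OF V] species_objD(5)[OF W] by blast
  \<comment> \<open>A common bound gives both dimension formulas the same range of
    summation.\<close>
  define N where "N = max N1 N2"
  have NV: "\<And>X. N \<le> fcard X \<Longrightarrow> sp V X = {0}" and NW: "\<And>X. N \<le> fcard X \<Longrightarrow> sp W X = {0}"
    using N1 N2 unfolding N_def by auto
  let ?G = "{\<rho>. \<rho> permutes {..<n}}"
  \<comment> \<open>The inverse appears because the dimension formula pairs the character at
    \<open>inv \<rho>\<close> with the word count at \<open>\<rho>\<close>.\<close>
  define d where "d \<rho> = tr (sp V (std n)) (sact V n (inv \<rho>)) - tr (sp W (std n)) (sact W n (inv \<rho>))" for \<rho>
  have "d (inv \<sigma>) = 0"
  proof (cases "n < N")
    case False
    \<comment> \<open>Beyond the bound the formula has no term of index \<open>n\<close>, but both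
      spaces are zero.\<close>
    then have z: "sp V (std n) = {0}" "sp W (std n) = {0}" using NV[of "std n"] NW[of "std n"] by simp_all
    show ?thesis
      using tr_zero_space[OF sact_rep[OF V, of n, unfolded z]] tr_zero_space[OF sact_rep[OF W, of n, unfolded z]]
        permutes_inv[OF permutes_inv[OF \<sigma>]] by (simp add: d_def z)
  next
    case True
    show ?thesis
    proof (rule class_function_zero[where d=d and \<sigma>="inv \<sigma>" and letter="\<lambda>i. Poly_Mapping.single i (1::nat)" and A="{a. weight a = Suc 0}"])
      fix g \<rho> assume g: "g permutes {..<n}" and \<rho>: "\<rho> permutes {..<n}"
      have "inv (g \<circ> \<rho> \<circ> inv g) = g \<circ> inv \<rho> \<circ> inv g"
        using permutes_bij[OF g] permutes_bij[OF \<rho>] permutes_bij[OF permutes_inv[OF g]]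
        by (simp add: o_inv_distrib bij_comp inv_inv_eq o_assoc)
      then show "d (g \<circ> \<rho> \<circ> inv g) = d \<rho>"
        unfolding d_def using character_conj[OF sact_rep[OF V] g permutes_inv[OF \<rho>]]
          character_conj[OF sact_rep[OF W] g permutes_inv[OF \<rho>]] by simp
    next
      show "inj (\<lambda>i. Poly_Mapping.single i (1::nat))"
        by (rule injI) (metis lookup_single_eq lookup_single_not_eq one_neq_zero)
      show "range (\<lambda>i. Poly_Mapping.single i 1) \<subseteq> {a. weight a = Suc 0}"
        using weight_1_iff by auto
      show "inv \<sigma> permutes {..<n}" by (rule permutes_inv[OF \<sigma>])
    next
      fix ds assume ds: "length ds = n" "set ds \<subseteq> {a. weight a = Suc 0}"
      let ?a = "sum_list ds"
      have dsw: "ds \<in> swords n ?a" unfolding swords_iff using ds by auto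
      have fw: "fixed_words n ?a \<rho> = card {ds'. mset ds' = mset ds \<and> permute_list \<rho> ds' = ds'}" for \<rho>
        unfolding fixed_words_def swords_mset[OF dsw] ..
      have other: "fixed_words m ?a \<rho> = 0" if "m \<noteq> n" for m \<rho>
      proof -
        have "swords m ?a = {}" using swords_weight[OF dsw] swords_weight[of _ m ?a] that by blast
        then show ?thesis by (simp add: fixed_words_def)
      qed
      have red: "(\<Sum>m<N. 1 / of_nat (card {\<rho>. \<rho> permutes {..<m}}) *
          (\<Sum>\<rho> | \<rho> permutes {..<m}. tr (sp Z (std m)) (sact Z m (inv \<rho>)) * of_nat (fixed_words m ?a \<rho>))) =
          1 / of_nat (card ?G) * (\<Sum>\<rho>\<in>?G. tr (sp Z (std n)) (sact Z n (inv \<rho>)) * of_nat (fixed_words n ?a \<rho>))" (is "?L = ?R") for Z :: "'k species"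
      proof -
        have "?L = (\<Sum>m<N. if m = n then ?R else 0)"
          by (rule sum.cong) (simp_all add: other)
        also have "\<dots> = ?R" using True by simp
        finally show ?thesis .
      qed
      have cancel: "x = y" if "1 / c * x = 1 / c * y" "c \<noteq> 0" for x y c :: 'k
        using that by simp
      have dim: "tr (fo F Z ?a) (restrict0 (fo F Z ?a) (\<lambda>v. v)) =
          1 / of_nat (card ?G) * (\<Sum>\<rho>\<in>?G. tr (sp Z (std n)) (sact Z n (inv \<rho>)) * of_nat (fixed_words n ?a \<rho>))"
        if "Z \<in> species_obj" "\<And>X. N \<le> fcard X \<Longrightarrow> sp Z X = {0}" for Z
        unfolding red[symmetric] by (rule graded_dimension[OF that(1)]) (erule that(2))
      have "1 / of_nat (card ?G) * (\<Sum>\<rho>\<in>?G. tr (sp V (std n)) (sact V n (inv \<rho>)) * of_nat (fixed_words n ?a \<rho>)) =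
          1 / of_nat (card ?G) * (\<Sum>\<rho>\<in>?G. tr (sp W (std n)) (sact W n (inv \<rho>)) * of_nat (fixed_words n ?a \<rho>))"
        using iso_graded_dimension[OF V W iso, of ?a] dim[of V] dim[of W] V W NV NW by simp
      moreover have "of_nat (card ?G) \<noteq> (0::'k)"
        by (rule card_permutes_nonzero[OF finite_lessThan sact_rep[OF V] sact_rep[OF V]])
      ultimately have "(\<Sum>\<rho>\<in>?G. tr (sp V (std n)) (sact V n (inv \<rho>)) * of_nat (fixed_words n ?a \<rho>)) =
          (\<Sum>\<rho>\<in>?G. tr (sp W (std n)) (sact W n (inv \<rho>)) * of_nat (fixed_words n ?a \<rho>))"
        by (rule cancel)
      then show "(\<Sum>\<rho>\<in>?G. d \<rho> * of_nat (card {ds'. mset ds' = mset ds \<and> permute_list \<rho> ds' = ds'})) = 0"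
        unfolding fw[symmetric] d_def left_diff_distrib sum_subtractf by simp
    qed
  qed
  then show ?thesis using permutes_inv_inv[OF \<sigma>] by (simp add: d_def)
qed

text \<open>The isomorphisms found for different \<open>n\<close> need no compatibility, since no
  bijection connects sets of different size; each family of them extends to arrows of
  species.\<close>

lemma F_essentially_injective:
  assumes V: "V \<in> species_obj" and W: "W \<in> species_obj" and iso: "isomorphic AI (fo F V) (fo F W)"
  shows "isomorphic KS V W"
proof -
  have "\<exists>f g. f \<in> lin_maps (sp V (std n)) (sp W (std n)) \<and>
      equivariant {..<n} (sp V (std n)) (sact V n) (sact W n) f \<and>
      g \<in> lin_maps (sp W (std n)) (sp V (std n)) \<and>
      equivariant {..<n} (sp W (std n)) (sact W n) (sact V n) g \<and>
      (\<forall>v\<in>sp V (std n). g (f v) = v) \<and> (\<forall>w\<in>sp W (std n). f (g w) = w)" for n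
    by (rule equal_characters_isomorphic[OF finite_lessThan sact_rep[OF V, of n] sact_rep[OF W, of n]
          equal_characters[OF V W iso]]) blast+
  then obtain f g where f: "\<And>n. f n \<in> lin_maps (sp V (std n)) (sp W (std n))"
      "\<And>n. equivariant {..<n} (sp V (std n)) (sact V n) (sact W n) (f n)"
    and g: "\<And>n. g n \<in> lin_maps (sp W (std n)) (sp V (std n))"
      "\<And>n. equivariant {..<n} (sp W (std n)) (sact W n) (sact V n) (g n)"
    and gf: "\<And>n v. v \<in> sp V (std n) \<Longrightarrow> g n (f n v) = v"
    and fg: "\<And>n w. w \<in> sp W (std n) \<Longrightarrow> f n (g n w) = w"
    by metis
  obtain f0 where f0: "f0 \<in> species_maps V W" "\<And>n v. v \<in> sp V (std n) \<Longrightarrow> f0 (std n) v = f n v"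
    using species_map_extend[OF V W f] by blast
  obtain g0 where g0: "g0 \<in> species_maps W V" "\<And>n v. v \<in> sp W (std n) \<Longrightarrow> g0 (std n) v = g n v"
    using species_map_extend[OF W V g] by blast
  let ?f = "\<lparr>src = V, tgt = W, comp_at = f0\<rparr>" and ?g = "\<lparr>src = W, tgt = V, comp_at = g0\<rparr>"
  have h: "?f \<in> hom KS V W" "?g \<in> hom KS W V" using f0 g0 by simp_all
  have o: "V \<in> obj KS" "W \<in> obj KS" using V W by simp_all
  have "cmp KS ?g ?f = ide KS V"
  proof (rule arrow_eqI)
    show "comp_at (cmp KS ?g ?f) = comp_at (ide KS V)"
    proof (rule species_map_unique[OF V])
      show "comp_at (cmp KS ?g ?f) \<in> species_maps V V"
        using W.cmp_hom[OF o(1,2,1) h] unfolding W.C_simps(4) by blast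
      show "comp_at (ide KS V) \<in> species_maps V V"
        using W.ide_hom[OF o(1)] unfolding W.C_simps(4) by blast
      show "comp_at (cmp KS ?g ?f) (std n) v = comp_at (ide KS V) (std n) v" if "v \<in> sp V (std n)" for n v
        using that f0(2)[OF that] g0(2)[OF lin_mapsD(1)[OF f(1) that]] gf by (simp add: restrict0_def)
    qed
  qed (use W.ide_hom[OF o(1)] in simp_all)
  moreover have "cmp KS ?f ?g = ide KS W"
  proof (rule arrow_eqI)
    show "comp_at (cmp KS ?f ?g) = comp_at (ide KS W)"
    proof (rule species_map_unique[OF W])
      show "comp_at (cmp KS ?f ?g) \<in> species_maps W W"
        using W.cmp_hom[OF o(2,1,2) h(2,1)] unfolding W.C_simps(4) by blast
      show "comp_at (ide KS W) \<in> species_maps W W"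
        using W.ide_hom[OF o(2)] unfolding W.C_simps(4) by blast
      show "comp_at (cmp KS ?f ?g) (std n) v = comp_at (ide KS W) (std n) v" if "v \<in> sp W (std n)" for n v
        using that g0(2)[OF that] f0(2)[OF lin_mapsD(1)[OF g(1) that]] fg by (simp add: restrict0_def)
    qed
  qed (use W.ide_hom[OF o(2)] in simp_all)
  ultimately show ?thesis unfolding isomorphic_def iso_arrow_def using h by blast
qed

end

theorem theorem14p1:
  fixes F :: "('k::field_char_0 species, ('k species, nat fset, 'k) arrow,
                'k family, ('k family, nat \<Rightarrow>\<^sub>0 nat, 'k) arrow) smfun"
  assumes "two_rig_map kS_bar A_infinity F"
    and "isomorphic A_infinity (fo F species_gen) s_sum"
  shows "is_extension kS_bar A_infinity F"
proof -
  obtain u where "iso_arrow A_infinity s_sum (fo F species_gen) u"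
    using assms(2) unfolding isomorphic_def iso_arrow_def by blast
  then interpret ext_setup F u using assms(1) by unfold_locales
  have obj: "obj kS_bar = (species_obj :: 'k species set)" by simp
  show ?thesis
    unfolding is_extension_def faithful_def conservative_def essentially_injective_def obj
    using F_faithful F_conservative F_essentially_injective by (blast intro: inj_onI)
qed

end
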